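(* Let $\mathbb{X}$ be $\mathbb{S}^d$, $P^d(\mathbb{R})$ with $d$ odd, $P^d(\mathbb{C})$, $P^d(\mathbb{H})$ or $P^{16}(Cay)$, with Laplace-Beltrami operator $\Delta$. Let $\psi:[0,\infty)\to\mathbb{R}$ be one of $$\psi(r)=r^2\ \text{(Schrödinger equation)},\qquad \psi(r)=r\sqrt{1+r^2}\ \text{(Boussinesq equation)},\qquad \psi(r)=\sqrt{1+r^4}\ \text{(Beam equation)}.$$ Let $0\le\alpha<\tfrac14$ and let $p\ge1$. Then there is no constant $C>0$ such that $$\left\|\sup_{0\le t<2\pi}\left|e^{-it\psi\left(\sqrt{-\Delta}\right)}f\right|\right\|_{L^p(\mathbb{X})}\le C\,\|f\|_{H^\alpha(\mathbb{X})}$$ holds for all $K$-biinvariant functions $f\in H^\alpha(\mathbb{X})$.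
   Context: Here $d$ is the real dimension of $\mathbb{X}=U/K$: $d\ge1$ for $\mathbb{S}^d$; $d\ge 3$ odd for $P^d(\mathbb{R})$; $d=4,6,8,\dots$ for $P^d(\mathbb{C})$; $d=8,12,16,\dots$ for $P^d(\mathbb{H})$. These are rank one Riemannian symmetric spaces of compact type. The metric is normalized so that the diameter is $\pi$, and the Riemannian measure so that $\mathbb{X}$ has total measure $1$. Fix an origin $o\in\mathbb{X}$; $K$ is the stabilizer of $o$. $K$-biinvariant functions on $U$ are identified with functions on $\mathbb{X}$ that are radial around $o$, i.e. depend only on $\theta=d(o,x)\in[0,\pi]$. The eigenvalues of $-\Delta$ are $\lambda_n^2=n(n+\sigma+\tau+1)$, $n=0,1,2,\dots$ ($\lambda_n\ge0$), where $\sigma=\frac{d-2}{2}$ and $\tau=\frac{d-2}{2},-\frac12,0,1,3$ for $\mathbb{S}^d,P^d(\mathbb{R}),P^d(\mathbb{C}),P^d(\mathbb{H}),P^{16}(Cay)$ respectively. The radial functions in the $n$-th eigenspace form a line spanned by $\tilde Z_n$, the $L^2(\mathbb{X})$-normalized positive multiple of $x\mapsto P_n^{(\sigma,\tau)}(\cos d(o,x))$, with $P_n^{(\sigma,\tau)}$ the Jacobi polynomial. Every $K$-biinvariant $f\in L^2(\mathbb{X})$ has the expansion $f=\sum_{n\ge0}a_n\tilde Z_n$, with $\|f\|_{H^\alpha(\mathbb{X})}=\big(\sum_{n\ge0}(1+\lambda_n^2)^\alpha|a_n|^2\big)^{1/2}$, and $e^{-it\psi(\sqrt{-\Delta})}f=\sum_{n}e^{-it\psi(\lambda_n)}a_n\tilde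 Z_n$. For $f\in C^\infty(\mathbb{X})$ this series converges absolutely and uniformly and the supremum over $t$ is taken pointwise; for general $f\in H^\alpha(\mathbb{X})$ the supremum of the family of ($L^2$ classes of) functions $|e^{-it\psi(\sqrt{-\Delta})}f|$, $t\in[0,2\pi)$, is understood as the essential (lattice) supremum of measurable functions, which agrees with the pointwise one for smooth $f$. *)

theory Defs
  imports "HOL-Analysis.Analysis"
begin

section \<open>Octonions\<close>

text \<open>
  Quaternions and octonions by Cayley--Dickson doubling of the complex numbers. On these product
  types the library's addition, scalar multiplication and inner product are the Euclidean ones of
  real dimension 4 and 8. The real, complex and quaternionic scalars are the subalgebras in which
  only the first 1, 2 or 4 real coordinates may be non-zero.
\<close>

type_synonym quaternion = "complex \<times> complex"
type_synonym octonion = "quaternion \<times> quaternion"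

definition quat_cnj :: "quaternion \<Rightarrow> quaternion" where
  "quat_cnj p = (cnj (fst p), - snd p)"

definition quat_mult :: "quaternion \<Rightarrow> quaternion \<Rightarrow> quaternion" where
  "quat_mult p q =
     (fst p * fst q - cnj (snd q) * snd p, snd q * fst p + snd p * cnj (fst q))"

definition oct_cnj :: "octonion \<Rightarrow> octonion" where
  "oct_cnj a = (quat_cnj (fst a), - snd a)"

definition oct_mult :: "octonion \<Rightarrow> octonion \<Rightarrow> octonion" where
  "oct_mult a b =
     (quat_mult (fst a) (fst b) - quat_mult (quat_cnj (snd b)) (snd a),
      quat_mult (snd b) (fst a) + quat_mult (snd a) (quat_cnj (fst b)))"

definition oct_one :: octonion where
  "oct_one = ((1, 0), (0, 0))"

definition oct_of :: "(nat \<Rightarrow> real) \<Rightarrow> octonion" where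
  "oct_of c = ((Complex (c 0) (c 1), Complex (c 2) (c 3)),
               (Complex (c 4) (c 5), Complex (c 6) (c 7)))"

definition scalars :: "nat \<Rightarrow> octonion set" where
  "scalars m = {oct_of c |c. \<forall>k\<ge>m. c k = 0}"


section \<open>The compact rank one symmetric spaces\<close>

text \<open>The parameter is the real dimension of the space, not the projective dimension.\<close>

datatype sym_space = Sphere nat | ProjR nat | ProjC nat | ProjH nat | ProjCay

fun admissible :: "sym_space \<Rightarrow> bool" where
  "admissible (Sphere d) \<longleftrightarrow> d \<ge> 1"
| "admissible (ProjR d) \<longleftrightarrow> d \<ge> 3 \<and> odd d"
| "admissible (ProjC d) \<longleftrightarrow> d \<ge> 4 \<and> 2 dvd d"
| "admissible (ProjH d) \<longleftrightarrow> d \<ge> 8 \<and> 4 dvd d"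
| "admissible ProjCay \<longleftrightarrow> True"

fun sdim :: "sym_space \<Rightarrow> nat" where
  "sdim (Sphere d) = d"
| "sdim (ProjR d) = d"
| "sdim (ProjC d) = d"
| "sdim (ProjH d) = d"
| "sdim ProjCay = 16"

text \<open>
  For a projective space this is the real dimension of the scalars, hence that of a projective
  line. The value \<open>d\<close> for the sphere makes the volume density below uniform in all cases.
\<close>

fun line_dim :: "sym_space \<Rightarrow> nat" where
  "line_dim (Sphere d) = d"
| "line_dim (ProjR d) = 1"
| "line_dim (ProjC d) = 2"
| "line_dim (ProjH d) = 4"
| "line_dim ProjCay = 8"

definition proj_dim :: "sym_space \<Rightarrow> nat" where
  "proj_dim S = sdim S div line_dim S"

text \<open>
  A point of the sphere is a unit vector of real \<open>(d+1)\<close>-space. A point of a projective space, a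
  line in \<open>(n+1)\<close>-space over the scalars, is represented by the orthogonal projection onto it: a
  Hermitian idempotent \<open>(n+1) \<times> (n+1)\<close> matrix of trace one. For the Cayley plane (\<open>n = 2\<close>) these
  matrices are its usual definition, as primitive idempotents of the exceptional Jordan algebra;
  the matrix square and the Jordan square are the same.
\<close>

datatype point = Vec "nat \<Rightarrow> real" | Mat "nat \<Rightarrow> nat \<Rightarrow> octonion"

definition unit_sphere :: "nat \<Rightarrow> (nat \<Rightarrow> real) set" where
  "unit_sphere d = {x. (\<Sum>i\<le>d. (x i)\<^sup>2) = 1 \<and> (\<forall>i>d. x i = 0)}"

definition proj_space :: "nat \<Rightarrow> nat \<Rightarrow> (nat \<Rightarrow> nat \<Rightarrow> octonion) set" where
  "proj_space m n = {P.
     (\<forall>i j. P i j \<in> scalars m) \<and>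
     (\<forall>i j. i > n \<or> j > n \<longrightarrow> P i j = 0) \<and>
     (\<forall>i j. P j i = oct_cnj (P i j)) \<and>
     (\<forall>i j. (\<Sum>k\<le>n. oct_mult (P i k) (P k j)) = P i j) \<and>
     (\<Sum>i\<le>n. P i i) = oct_one}"

definition points :: "sym_space \<Rightarrow> point set" where
  "points S = (case S of
      Sphere d \<Rightarrow> Vec ` unit_sphere d
    | _ \<Rightarrow> Mat ` proj_space (line_dim S) (proj_dim S))"

definition origin :: "sym_space \<Rightarrow> point" where
  "origin S = (case S of
      Sphere d \<Rightarrow> Vec (\<lambda>i. if i = 0 then 1 else 0)
    | _ \<Rightarrow> Mat (\<lambda>i j. if i = 0 \<and> j = 0 then oct_one else 0))"

text \<open>
  The Riemannian distance, scaled to diameter \<open>\<pi>\<close>. For two projections the double sum is the real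
  part of the trace of their product, i.e. the squared cosine of the angle between the lines.
\<close>

definition geodist :: "sym_space \<Rightarrow> point \<Rightarrow> point \<Rightarrow> real" where
  "geodist S a b = (case (a, b) of
      (Vec x, Vec y) \<Rightarrow> arccos (\<Sum>i\<le>sdim S. x i * y i)
    | (Mat P, Mat Q) \<Rightarrow>
        2 * arccos (sqrt (\<Sum>i\<le>proj_dim S. \<Sum>j\<le>proj_dim S. P i j \<bullet> Q i j))
    | _ \<Rightarrow> 0)"

definition sym_borel :: "sym_space \<Rightarrow> point measure" where
  "sym_borel S = sigma (points S)
     {{y \<in> points S. geodist S x y < r} |x r. x \<in> points S}"

text \<open>
  The complement of the cut locus of the origin, which is a null set, is parametrised by real
  \<open>d\<close>-space: by inverse stereographic projection for the sphere, and by the affine chart sending \<open>v\<close> to the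
  line through \<open>(1, v)\<close> for a projective space. In every case a point \<open>v\<close> is mapped to distance
  \<open>2 arctan \<bar>v\<bar>\<close> from the origin.
\<close>

definition chart_norm2 :: "sym_space \<Rightarrow> (nat \<Rightarrow> real) \<Rightarrow> real" where
  "chart_norm2 S v = (\<Sum>i<sdim S. (v i)\<^sup>2)"

definition sphere_chart :: "sym_space \<Rightarrow> (nat \<Rightarrow> real) \<Rightarrow> nat \<Rightarrow> real" where
  "sphere_chart S v i =
     (if i = 0 then (1 - chart_norm2 S v) / (1 + chart_norm2 S v)
      else if i \<le> sdim S then 2 * v (i - 1) / (1 + chart_norm2 S v)
      else 0)"

definition hom_coord :: "sym_space \<Rightarrow> (nat \<Rightarrow> real) \<Rightarrow> nat \<Rightarrow> octonion" where
  "hom_coord S v i =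
     (if i = 0 then oct_one
      else if i \<le> proj_dim S
        then oct_of (\<lambda>k. if k < line_dim S then v (line_dim S * (i - 1) + k) else 0)
      else 0)"

definition proj_chart :: "sym_space \<Rightarrow> (nat \<Rightarrow> real) \<Rightarrow> nat \<Rightarrow> nat \<Rightarrow> octonion" where
  "proj_chart S v i j =
     (1 / (1 + chart_norm2 S v)) *\<^sub>R oct_mult (hom_coord S v i) (oct_cnj (hom_coord S v j))"

definition chart :: "sym_space \<Rightarrow> (nat \<Rightarrow> real) \<Rightarrow> point" where
  "chart S v = (case S of
      Sphere d \<Rightarrow> Vec (sphere_chart S v)
    | _ \<Rightarrow> Mat (proj_chart S v))"

text \<open>
  In this chart the volume density of the round metric on the sphere is a constant multiple of
  \<open>(1 + \<bar>v\<bar>\<^sup>2)\<^sup>-\<^sup>d\<close>. That of the Fubini--Study metric is a constant multiple of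
  \<open>(1 + \<bar>v\<bar>\<^sup>2)\<close> to the power \<open>-(d+m)/2\<close>, with \<open>m\<close> the real dimension of the scalars: at \<open>v\<close> the
  metric is \<open>4/(1 + \<bar>v\<bar>\<^sup>2)\<^sup>2\<close> times the Euclidean one on the tangent space of the
  \<open>m\<close>-dimensional scalar line through the origin and \<open>v\<close>, and \<open>4/(1 + \<bar>v\<bar>\<^sup>2)\<close> times it on the
  orthogonal complement. Both are the same expression in \<open>line_dim\<close>. The constant disappears in
  the normalisation to total mass one.
\<close>

definition chart_volume :: "sym_space \<Rightarrow> (nat \<Rightarrow> real) measure" where
  "chart_volume S = density (Pi\<^sub>M {..<sdim S} (\<lambda>_. lborel))
     (\<lambda>v. ennreal ((1 + chart_norm2 S v) powr (- (real (sdim S) + real (line_dim S)) / 2)))"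

definition riem_measure :: "sym_space \<Rightarrow> point measure" where
  "riem_measure S =
     distr (uniform_measure (chart_volume S) (space (chart_volume S))) (sym_borel S) (chart S)"


section \<open>Spectral decomposition of the Laplacian on radial functions\<close>

definition sigma_par :: "sym_space \<Rightarrow> real" where
  "sigma_par S = (real (sdim S) - 2) / 2"

fun tau_par :: "sym_space \<Rightarrow> real" where
  "tau_par (Sphere d) = (real d - 2) / 2"
| "tau_par (ProjR d) = - 1 / 2"
| "tau_par (ProjC d) = 0"
| "tau_par (ProjH d) = 1"
| "tau_par ProjCay = 3"

definition jacobi_poly :: "nat \<Rightarrow> real \<Rightarrow> real \<Rightarrow> real \<Rightarrow> real" where
  "jacobi_poly n a b x =
     (\<Sum>s\<le>n. ((real n + a) gchoose (n - s)) * ((real n + b) gchoose s)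
            * ((x - 1) / 2) ^ s * ((x + 1) / 2) ^ (n - s))"

text \<open>\<open>freq S n\<close> is \<open>\<lambda>\<^sub>n\<close>: the eigenvalues of minus the Laplacian are the squares \<open>(freq S n)\<^sup>2\<close>.\<close>

definition freq :: "sym_space \<Rightarrow> nat \<Rightarrow> real" where
  "freq S n = sqrt (real n * (real n + sigma_par S + tau_par S + 1))"

definition zonal :: "sym_space \<Rightarrow> nat \<Rightarrow> point \<Rightarrow> real" where
  "zonal S n x = jacobi_poly n (sigma_par S) (tau_par S) (cos (geodist S (origin S) x))"

definition zonal_normalized :: "sym_space \<Rightarrow> nat \<Rightarrow> point \<Rightarrow> real" where
  "zonal_normalized S n x =
     zonal S n x / sqrt (\<integral>y. (zonal S n y)\<^sup>2 \<partial>riem_measure S)"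

definition coeff :: "sym_space \<Rightarrow> (point \<Rightarrow> complex) \<Rightarrow> nat \<Rightarrow> complex" where
  "coeff S f n = (\<integral>x. f x * complex_of_real (zonal_normalized S n x) \<partial>riem_measure S)"

definition radial :: "sym_space \<Rightarrow> (point \<Rightarrow> complex) \<Rightarrow> bool" where
  "radial S f \<longleftrightarrow> (\<exists>F. \<forall>x\<in>points S. f x = F (geodist S (origin S) x))"

definition radial_L2 :: "sym_space \<Rightarrow> (point \<Rightarrow> complex) set" where
  "radial_L2 S = {f. radial S f \<and> f \<in> borel_measurable (riem_measure S)
                     \<and> integrable (riem_measure S) (\<lambda>x. (norm (f x))\<^sup>2)}"

definition radial_Sobolev :: "sym_space \<Rightarrow> real \<Rightarrow> (point \<Rightarrow> complex) set" where
  "radial_Sobolev S \<alpha> = {f \<in> radial_L2 S.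
     summable (\<lambda>n. (1 + (freq S n)\<^sup>2) powr \<alpha> * (norm (coeff S f n))\<^sup>2)}"

definition Sobolev_norm :: "sym_space \<Rightarrow> real \<Rightarrow> (point \<Rightarrow> complex) \<Rightarrow> real" where
  "Sobolev_norm S \<alpha> f =
     sqrt (\<Sum>n. (1 + (freq S n)\<^sup>2) powr \<alpha> * (norm (coeff S f n))\<^sup>2)"


section \<open>The maximal function\<close>

definition is_evolution ::
    "sym_space \<Rightarrow> (real \<Rightarrow> real) \<Rightarrow> real \<Rightarrow> (point \<Rightarrow> complex) \<Rightarrow> (point \<Rightarrow> complex) \<Rightarrow> bool" where
  "is_evolution S \<psi> t f g \<longleftrightarrow>
     g \<in> borel_measurable (riem_measure S) \<and>
     (\<lambda>N. \<integral>\<^sup>+x. ennreal ((norm (g x -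
         (\<Sum>n<N. exp (- \<i> * complex_of_real (t * \<psi> (freq S n))) * coeff S f n
                  * complex_of_real (zonal_normalized S n x))))\<^sup>2) \<partial>riem_measure S)
       \<longlonglongrightarrow> 0"

text \<open>
  This is the series for \<open>exp (-it\<psi>(\<surd>(-\<Delta>))) f\<close>. It converges in \<open>L\<^sup>2\<close>, so its sum is unique up to null sets; the
  choice picks a representative. The same applies to the lattice supremum below, which by
  definition does not depend on the representatives of the members of the family.
\<close>

definition evolution ::
    "sym_space \<Rightarrow> (real \<Rightarrow> real) \<Rightarrow> real \<Rightarrow> (point \<Rightarrow> complex) \<Rightarrow> point \<Rightarrow> complex" where
  "evolution S \<psi> t f = (SOME g. is_evolution S \<psi> t f g)"

definition is_lattice_Sup ::
    "'a measure \<Rightarrow> 'i set \<Rightarrow> ('i \<Rightarrow> 'a \<Rightarrow> ennreal) \<Rightarrow> ('a \<Rightarrow> ennreal) \<Rightarrow> bool" where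
  "is_lattice_Sup M I u G \<longleftrightarrow>
     G \<in> borel_measurable M \<and>
     (\<forall>t\<in>I. AE x in M. u t x \<le> G x) \<and>
     (\<forall>H\<in>borel_measurable M. (\<forall>t\<in>I. AE x in M. u t x \<le> H x) \<longrightarrow> (AE x in M. G x \<le> H x))"

definition lattice_Sup ::
    "'a measure \<Rightarrow> 'i set \<Rightarrow> ('i \<Rightarrow> 'a \<Rightarrow> ennreal) \<Rightarrow> 'a \<Rightarrow> ennreal" where
  "lattice_Sup M I u = (SOME G. is_lattice_Sup M I u G)"

definition maximal_function ::
    "sym_space \<Rightarrow> (real \<Rightarrow> real) \<Rightarrow> (point \<Rightarrow> complex) \<Rightarrow> point \<Rightarrow> ennreal" where
  "maximal_function S \<psi> f =
     lattice_Sup (riem_measure S) {0..<2 * pi} (\<lambda>t x. ennreal (norm (evolution S \<psi> t f x)))"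

text \<open>The power of an extended non-negative real, for a positive exponent.\<close>

definition ennreal_powr :: "ennreal \<Rightarrow> real \<Rightarrow> ennreal" where
  "ennreal_powr x p = (if x = \<infinity> then \<infinity> else ennreal (enn2real x powr p))"

definition Lp_norm :: "'a measure \<Rightarrow> real \<Rightarrow> ('a \<Rightarrow> ennreal) \<Rightarrow> ennreal" where
  "Lp_norm M p G = ennreal_powr (\<integral>\<^sup>+x. ennreal_powr (G x) p \<partial>M) (1 / p)"

definition schroedinger :: "real \<Rightarrow> real" where
  "schroedinger r = r\<^sup>2"

definition boussinesq :: "real \<Rightarrow> real" where
  "boussinesq r = r * sqrt (1 + r\<^sup>2)"

definition beam :: "real \<Rightarrow> real" where
  "beam r = sqrt (1 + r ^ 4)"

end

theory Submission
  imports Defs "HOL-Computational_Algebra.Polynomial"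
begin

text \<open>
  The extremal data are wave packets \<open>f = \<Sum> Z\<^sub>n\<close>, summed over \<open>N \<le> n < N + K\<close> with \<open>K\<close> a small
  multiple of \<open>\<surd>N\<close>. At distance \<open>\<theta>\<close> from the origin and time \<open>t = \<theta> / (2N)\<close> the phases
  \<open>t \<psi>(\<lambda>\<^sub>n)\<close> equal \<open>n \<theta>\<close> up to a common function of \<open>\<theta>\<close> and a small error. No pointwise
  asymptotics of \<open>Z\<^sub>n\<close> are needed: the \<open>L\<^sup>1\<close> norm of the maximal function is bounded below by
  duality, and it suffices that \<open>cos ((n + 2d) \<theta>) Z\<^sub>n\<close> has an integral of constant sign and
  bounded below in absolute value against the fixed bounded weight
  \<open>sin\<^sup>2\<^sup>d \<phi> cos\<^sup>2\<^sup>d \<phi>\<close>, \<open>\<phi> = \<theta> / 2\<close>, divided by the volume density. This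
  integral only sees the leading coefficient of \<open>Z\<^sub>n\<close>, which by orthogonality is at least that of
  the Chebyshev polynomial, since the latter is bounded by \<open>1\<close>. So the maximal function
  has \<open>L\<^sup>1\<close> norm of order \<open>K\<close>, while the Sobolev norm of \<open>f\<close> is of order at most
  \<open>K\<^sup>1\<^sup>/\<^sup>2 N\<^sup>\<alpha>\<close>, that is, \<open>K\<close> to the power \<open>1/2 + 2\<alpha> < 1\<close>.
\<close>

section \<open>The chart takes values in the space\<close>

text \<open>The scale \<open>K^2 ~ N\<close> is forced: the phase error is of order
  \<open>K^2 / N\<close> and has to stay below a fixed fraction of the correlation constant. It
  turns \<open>N^\<alpha>\<close> into \<open>K^(2 \<alpha>)\<close> and so decides the threshold
  1/4.

  The frequency is \<open>n + 2d\<close> and not \<open>n\<close> because multiplication by the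
  weight raises the top frequency of the n-th zonal function from \<open>n\<close> to
  \<open>n + 2d\<close>, and pairing with the top frequency isolates the leading coefficient. The
  surplus \<open>2d\<close> does not depend on \<open>n\<close>, so it disappears into the common
  phase. The sign of the correlation does not depend on \<open>n\<close> either, so the K
  contributions add up.

  The time used depends on the point, whereas the maximal function is a chosen lattice supremum of
  classes, each defined up to its own null set. Continuity in time of finite spectral sums produces
  one exceptional null set for all times.

  The exponent \<open>p\<close> enters only through the passage from \<open>L^p\<close> to
  \<open>L^1\<close> on a space of total mass one, and the equation only through
  \<open>\<bar>\<psi>(r) - r^2\<bar> \<le> 1\<close>.\<close>

lemma octonion_eq_iff:
  fixes x y :: octonion
  shows "x = y \<longleftrightarrow>
    Re (fst (fst x)) = Re (fst (fst y)) \<and> Im (fst (fst x)) = Im (fst (fst y)) \<and>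
    Re (snd (fst x)) = Re (snd (fst y)) \<and> Im (snd (fst x)) = Im (snd (fst y)) \<and>
    Re (fst (snd x)) = Re (fst (snd y)) \<and> Im (fst (snd x)) = Im (fst (snd y)) \<and>
    Re (snd (snd x)) = Re (snd (snd y)) \<and> Im (snd (snd x)) = Im (snd (snd y))"
  by (auto simp: prod_eq_iff complex_eq_iff)

lemma octonion_inner:
  fixes x y :: octonion
  shows "x \<bullet> y =
    Re (fst (fst x)) * Re (fst (fst y)) + Im (fst (fst x)) * Im (fst (fst y)) +
    Re (snd (fst x)) * Re (snd (fst y)) + Im (snd (fst x)) * Im (snd (fst y)) +
    Re (fst (snd x)) * Re (fst (snd y)) + Im (fst (snd x)) * Im (fst (snd y)) +
    Re (snd (snd x)) * Re (snd (snd y)) + Im (snd (snd x)) * Im (snd (snd y))"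
  by (simp add: inner_prod_def inner_complex_def)

lemmas oct_defs = oct_mult_def quat_mult_def oct_cnj_def quat_cnj_def oct_one_def

lemma oct_cnj_mult: "oct_cnj (oct_mult a b) = oct_mult (oct_cnj b) (oct_cnj a)"
  by (simp add: octonion_eq_iff oct_defs algebra_simps)

lemma oct_cnj_cnj [simp]: "oct_cnj (oct_cnj a) = a"
  by (simp add: octonion_eq_iff oct_defs)

lemma oct_cnj_scaleR: "oct_cnj (r *\<^sub>R a) = r *\<^sub>R oct_cnj a"
  by (simp add: octonion_eq_iff oct_defs)

lemma oct_mult_scaleR: "oct_mult (r *\<^sub>R a) (s *\<^sub>R b) = (r * s) *\<^sub>R oct_mult a b"
  by (simp add: octonion_eq_iff oct_defs algebra_simps)

lemma oct_mult_zero [simp]: "oct_mult 0 a = 0" "oct_mult a 0 = 0" "oct_cnj 0 = 0"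
  by (simp_all add: octonion_eq_iff oct_defs)

lemma oct_mult_one [simp]: "oct_mult oct_one a = a" "oct_mult a oct_one = a" "oct_cnj oct_one = oct_one"
  by (simp_all add: octonion_eq_iff oct_defs)

lemma oct_mult_cnj_self: "oct_mult a (oct_cnj a) = (a \<bullet> a) *\<^sub>R oct_one"
  by (simp add: octonion_eq_iff octonion_inner oct_defs algebra_simps)

lemma oct_inner_cnj: "oct_cnj a \<bullet> oct_cnj b = a \<bullet> b"
  by (simp add: octonion_inner oct_defs)

lemma oct_mult_self_cnj: "oct_mult (oct_cnj a) a = (a \<bullet> a) *\<^sub>R oct_one"
  by (simp add: octonion_eq_iff octonion_inner oct_defs algebra_simps)

lemma oct_alternative_left: "oct_mult (oct_cnj a) (oct_mult a b) = (a \<bullet> a) *\<^sub>R b"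
  by (simp add: octonion_eq_iff octonion_inner oct_defs algebra_simps)

lemma oct_alternative_left': "oct_mult a (oct_mult (oct_cnj a) b) = (a \<bullet> a) *\<^sub>R b"
  using oct_alternative_left[of "oct_cnj a"] by (simp add: oct_inner_cnj)

lemma oct_alternative_right: "oct_mult (oct_mult b a) (oct_cnj a) = (a \<bullet> a) *\<^sub>R b"
  using arg_cong[OF oct_alternative_left'[of a "oct_cnj b"], of oct_cnj]
  by (simp add: oct_cnj_mult oct_cnj_scaleR)

lemma oct_alternative_right': "oct_mult (oct_mult b (oct_cnj a)) a = (a \<bullet> a) *\<^sub>R b"
  using oct_alternative_right[of b "oct_cnj a"] by (simp add: oct_inner_cnj)

lemma oct_inner_mult_left: "oct_mult a b \<bullet> c = b \<bullet> oct_mult (oct_cnj a) c"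
  by (simp add: octonion_inner oct_defs algebra_simps)

lemma oct_inner_mult: "oct_mult a b \<bullet> oct_mult a b = (a \<bullet> a) * (b \<bullet> b)"
  by (simp add: oct_inner_mult_left oct_alternative_left)

lemma quat_mult_assoc:
  assumes "snd a = 0" "snd b = 0" "snd c = 0"
  shows "oct_mult (oct_mult a b) c = oct_mult a (oct_mult b c)"
  using assms by (simp add: octonion_eq_iff oct_defs algebra_simps)

lemma quat_mult_middle:
  assumes "snd a = 0" "snd b = 0" "snd c = 0"
  shows "oct_mult (oct_mult a (oct_cnj b)) (oct_mult b (oct_cnj c)) = (b \<bullet> b) *\<^sub>R oct_mult a (oct_cnj c)"
proof -
  have "snd (oct_mult a (oct_cnj b)) = 0" "snd (oct_cnj c) = 0"
    using assms by (simp_all add: oct_defs prod_eq_iff)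
  then have "oct_mult (oct_mult a (oct_cnj b)) (oct_mult b (oct_cnj c))
           = oct_mult (oct_mult (oct_mult a (oct_cnj b)) b) (oct_cnj c)"
    using assms by (intro quat_mult_assoc[symmetric]) auto
  also have "\<dots> = (b \<bullet> b) *\<^sub>R oct_mult a (oct_cnj c)"
    using oct_mult_scaleR[of "b \<bullet> b" a 1] by (simp add: oct_alternative_right')
  finally show ?thesis .
qed

text \<open>Only two octonions besides \<open>1\<close> occur in the Cayley plane, and any two octonions
  generate an associative algebra.\<close>

lemma oct_mult_middle:
  assumes "{a, b, c} \<subseteq> {oct_one, x, y}"
  shows "oct_mult (oct_mult a (oct_cnj b)) (oct_mult b (oct_cnj c)) = (b \<bullet> b) *\<^sub>R oct_mult a (oct_cnj c)"
proof -
  have [simp]: "oct_one \<bullet> oct_one = 1"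
    by (simp add: octonion_inner oct_defs)
  have scale: "oct_mult (r *\<^sub>R a) b = r *\<^sub>R oct_mult a b" "oct_mult a (r *\<^sub>R b) = r *\<^sub>R oct_mult a b" for r a b
    using oct_mult_scaleR[of r a 1 b] oct_mult_scaleR[of 1 a r b] by simp_all
  \<comment> \<open>The case \<open>c = a\<close>, which the alternative laws do not reach: the two
    factors are conjugate to each other, so the product is a squared norm, and the norm is
    multiplicative.\<close>
  have middle: "oct_mult (oct_mult a (oct_cnj b)) (oct_mult b (oct_cnj a)) = (b \<bullet> b) *\<^sub>R (a \<bullet> a) *\<^sub>R oct_one" for a b
    using oct_mult_cnj_self[of "oct_mult a (oct_cnj b)"]
    by (simp add: oct_cnj_mult oct_inner_mult oct_inner_cnj mult.commute)
  show ?thesis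
    using assms
    by (auto simp: oct_mult_cnj_self oct_mult_self_cnj scale oct_alternative_left oct_alternative_left'
        oct_alternative_right oct_alternative_right' middle)
qed

section \<open>Scalars and homogeneous coordinates\<close>

lemma in_scalars_iff:
  "x \<in> scalars m \<longleftrightarrow>
    (m \<le> 7 \<longrightarrow> Im (snd (snd x)) = 0) \<and> (m \<le> 6 \<longrightarrow> Re (snd (snd x)) = 0) \<and>
    (m \<le> 5 \<longrightarrow> Im (fst (snd x)) = 0) \<and> (m \<le> 4 \<longrightarrow> Re (fst (snd x)) = 0) \<and>
    (m \<le> 3 \<longrightarrow> Im (snd (fst x)) = 0) \<and> (m \<le> 2 \<longrightarrow> Re (snd (fst x)) = 0) \<and>
    (m \<le> 1 \<longrightarrow> Im (fst (fst x)) = 0) \<and> (m \<le> 0 \<longrightarrow> Re (fst (fst x)) = 0)"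
  (is "_ \<longleftrightarrow> ?R")
proof
  assume "x \<in> scalars m"
  then show ?R by (auto simp: scalars_def oct_of_def)
next
  assume R: ?R
  define c where "c k = (if k = 0 then Re (fst (fst x)) else if k = 1 then Im (fst (fst x)) else
    if k = 2 then Re (snd (fst x)) else if k = 3 then Im (snd (fst x)) else
    if k = 4 then Re (fst (snd x)) else if k = 5 then Im (fst (snd x)) else
    if k = 6 then Re (snd (snd x)) else if k = 7 then Im (snd (snd x)) else 0)" for k :: nat
  have "x = oct_of c"
    by (simp add: octonion_eq_iff oct_of_def c_def)
  moreover have "c k = 0" if "k \<ge> m" for k
  proof -
    consider "k = 0" | "k = 1" | "k = 2" | "k = 3" | "k = 4" | "k = 5" | "k = 6" | "k = 7" | "k > 7"
      by linarith
    then show ?thesis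
      using R that by cases (simp_all add: c_def)
  qed
  ultimately show "x \<in> scalars m" by (auto simp: scalars_def)
qed

text \<open>Only in these dimensions is the coordinate subspace a subalgebra: for
  \<open>m = 3\<close> it would contain two imaginary units but not their product.\<close>

lemma scalars_mult_cnj:
  assumes "x \<in> scalars m" "y \<in> scalars m" "m \<in> {1, 2, 4, 8}"
  shows "r *\<^sub>R oct_mult x (oct_cnj y) \<in> scalars m"
proof -
  consider "m = 1" | "m = 2" | "m = 4" | "m = 8" using assms(3) by auto
  then show ?thesis
    using assms(1,2) by cases (simp_all add: in_scalars_iff oct_defs)
qed

fun is_proj :: "sym_space \<Rightarrow> bool" where
  "is_proj (Sphere d) = False"
| "is_proj _ = True"

lemma line_dim_proj: "is_proj S \<Longrightarrow> line_dim S \<in> {1, 2, 4, 8}"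
  by (cases S) auto

lemma sdim_proj: "is_proj S \<Longrightarrow> admissible S \<Longrightarrow> sdim S = line_dim S * proj_dim S"
  by (cases S) (auto simp: proj_dim_def)

lemma line_dim_le: "admissible S \<Longrightarrow> 1 \<le> line_dim S \<and> line_dim S \<le> sdim S"
  by (cases S) auto

lemma hom_coord_scalars:
  assumes "is_proj S"
  shows "hom_coord S v i \<in> scalars (line_dim S)"
proof -
  have "oct_one \<in> scalars (line_dim S)" "0 \<in> scalars (line_dim S)"
    using line_dim_proj[OF assms] by (auto simp: in_scalars_iff oct_one_def)
  moreover have "oct_of (\<lambda>k. if k < line_dim S then v (line_dim S * (i - 1) + k) else 0) \<in> scalars (line_dim S)"
    by (auto simp: scalars_def intro!: exI)
  ultimately show ?thesis
    by (simp add: hom_coord_def)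
qed

lemma oct_of_inner_self:
  assumes "m \<in> {1, 2, 4, 8}"
  shows "oct_of (\<lambda>k. if k < m then c k else 0) \<bullet> oct_of (\<lambda>k. if k < m then c k else 0) = (\<Sum>k<m. (c k)\<^sup>2)"
  using assms by (auto simp: octonion_inner oct_of_def lessThan_nat_numeral lessThan_Suc power2_eq_square eval_nat_numeral)

lemma sum_hom_coord:
  assumes "is_proj S" "admissible S"
  shows "(\<Sum>i\<le>proj_dim S. hom_coord S v i \<bullet> hom_coord S v i) = 1 + chart_norm2 S v"
proof -
  let ?m = "line_dim S" and ?n = "proj_dim S"
  have "(\<Sum>i\<le>?n. hom_coord S v i \<bullet> hom_coord S v i) =
     hom_coord S v 0 \<bullet> hom_coord S v 0 + (\<Sum>i<?n. hom_coord S v (Suc i) \<bullet> hom_coord S v (Suc i))"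
    by (rule sum.atMost_shift)
  also have "hom_coord S v 0 \<bullet> hom_coord S v 0 = 1"
    by (simp add: hom_coord_def oct_one_def octonion_inner)
  also have "(\<Sum>i<?n. hom_coord S v (Suc i) \<bullet> hom_coord S v (Suc i)) = (\<Sum>i<?n. \<Sum>k<?m. (v (?m * i + k))\<^sup>2)"
    by (intro sum.cong) (auto simp: hom_coord_def oct_of_inner_self[OF line_dim_proj[OF assms(1)]])
  \<comment> \<open>Each homogeneous coordinate after the first uses one block of
    \<open>line_dim S\<close> consecutive entries of \<open>v\<close>, and these blocks tile the
    \<open>sdim S\<close> entries.\<close>
  also have "\<dots> = (\<Sum>i<?n. sum (\<lambda>j. (v j)\<^sup>2) {i * ?m..<i * ?m + ?m})"
  proof (rule sum.cong[OF refl])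
    fix i
    show "(\<Sum>k<?m. (v (?m * i + k))\<^sup>2) = sum (\<lambda>j. (v j)\<^sup>2) {i * ?m..<i * ?m + ?m}"
      using sum.shift_bounds_nat_ivl[of "\<lambda>j. (v j)\<^sup>2" 0 "i * ?m" ?m]
      by (simp add: lessThan_atLeast0 add.commute mult.commute)
  qed
  also have "\<dots> = (\<Sum>j<?n * ?m. (v j)\<^sup>2)"
    by (rule sum.nat_group)
  also have "\<dots> = chart_norm2 S v"
    by (simp add: chart_norm2_def sdim_proj[OF assms] mult.commute)
  finally show ?thesis .
qed

lemma chart_norm2_nonneg: "chart_norm2 S v \<ge> 0"
  by (simp add: chart_norm2_def sum_nonneg)

text \<open>Summed over \<open>k\<close>, this becomes the idempotence of the projection matrix.
  Associativity yields it when the scalars are at most quaternions. In the Cayley plane it rests on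
  the first coordinate being 1, which leaves only two arbitrary octonions.\<close>

lemma hom_coord_mult_middle:
  assumes "is_proj S"
  shows "oct_mult (oct_mult (hom_coord S v i) (oct_cnj (hom_coord S v k)))
                  (oct_mult (hom_coord S v k) (oct_cnj (hom_coord S v j)))
       = (hom_coord S v k \<bullet> hom_coord S v k) *\<^sub>R oct_mult (hom_coord S v i) (oct_cnj (hom_coord S v j))"
proof (cases "S = ProjCay")
  case True
  have range: "hom_coord S v i \<in> {0, oct_one, hom_coord S v 1, hom_coord S v 2}" for i
  proof -
    consider "i = 0" | "i = 1" | "i = 2" | "i > 2" by linarith
    then show ?thesis
      by cases (auto simp: True hom_coord_def proj_dim_def)
  qed
  show ?thesis
  proof (cases "hom_coord S v i = 0 \<or> hom_coord S v j = 0 \<or> hom_coord S v k = 0")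
    case True
    then show ?thesis by auto
  next
    case False
    with range[of i] range[of j] range[of k] show ?thesis
      by (intro oct_mult_middle[where x = "hom_coord S v 1" and y = "hom_coord S v 2"]) blast
  qed
next
  case False
  with assms have "line_dim S \<le> 4" by (cases S) auto
  then have "snd (hom_coord S v i) = 0" for i
    using hom_coord_scalars[OF assms, of v i] by (auto simp: in_scalars_iff prod_eq_iff complex_eq_iff)
  then show ?thesis by (intro quat_mult_middle) auto
qed

text \<open>The matrix is \<open>h h^* / \<bar>h\<bar>^2\<close> for the column \<open>h\<close> of
  homogeneous coordinates, and \<open>sum_hom_coord\<close> identifies
  \<open>\<bar>h\<bar>^2\<close> with the normalizing factor.\<close>

lemma proj_chart_in_proj_space:
  assumes "is_proj S" "admissible S"
  shows "proj_chart S v \<in> proj_space (line_dim S) (proj_dim S)"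
proof -
  let ?h = "hom_coord S v" and ?n = "proj_dim S" and ?r = "1 / (1 + chart_norm2 S v)"
  have r: "?r * (1 + chart_norm2 S v) = 1"
    using chart_norm2_nonneg[of S v] by (simp add: add_nonneg_eq_0_iff)
  have idem: "(\<Sum>k\<le>?n. oct_mult (proj_chart S v i k) (proj_chart S v k j)) = proj_chart S v i j" for i j
  proof -
    have "(\<Sum>k\<le>?n. oct_mult (proj_chart S v i k) (proj_chart S v k j))
        = (\<Sum>k\<le>?n. (?h k \<bullet> ?h k) *\<^sub>R ((?r * ?r) *\<^sub>R oct_mult (?h i) (oct_cnj (?h j))))"
      by (intro sum.cong) (simp_all add: proj_chart_def oct_mult_scaleR hom_coord_mult_middle[OF assms(1)])
    also have "\<dots> = (1 + chart_norm2 S v) *\<^sub>R ((?r * ?r) *\<^sub>R oct_mult (?h i) (oct_cnj (?h j)))"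
      by (simp only: scaleR_sum_left[symmetric] sum_hom_coord[OF assms])
    also have "\<dots> = (?r * (?r * (1 + chart_norm2 S v))) *\<^sub>R oct_mult (?h i) (oct_cnj (?h j))"
      by (simp add: mult_ac)
    also have "\<dots> = proj_chart S v i j"
      unfolding r by (simp add: proj_chart_def)
    finally show ?thesis .
  qed
  have trace: "(\<Sum>i\<le>?n. proj_chart S v i i) = oct_one"
  proof -
    have "(\<Sum>i\<le>?n. proj_chart S v i i) = (\<Sum>i\<le>?n. (?h i \<bullet> ?h i) *\<^sub>R (?r *\<^sub>R oct_one))"
      by (intro sum.cong) (simp_all add: proj_chart_def oct_mult_cnj_self)
    also have "\<dots> = (1 + chart_norm2 S v) *\<^sub>R (?r *\<^sub>R oct_one)"
      by (simp only: scaleR_sum_left[symmetric] sum_hom_coord[OF assms])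
    also have "\<dots> = oct_one"
      using r by (simp add: mult.commute)
    finally show ?thesis .
  qed
  have "proj_chart S v i j \<in> scalars (line_dim S)" for i j
    unfolding proj_chart_def
    by (intro scalars_mult_cnj hom_coord_scalars line_dim_proj assms)
  moreover have "proj_chart S v i j = 0" if "i > ?n \<or> j > ?n" for i j
    using that by (auto simp: proj_chart_def hom_coord_def)
  moreover have "proj_chart S v j i = oct_cnj (proj_chart S v i j)" for i j
    by (simp add: proj_chart_def oct_cnj_scaleR oct_cnj_mult)
  ultimately show ?thesis
    unfolding proj_space_def using idem trace by blast
qed

lemma sphere_chart_in_unit_sphere: "sphere_chart (Sphere d) v \<in> unit_sphere d"
proof -
  let ?N = "chart_norm2 (Sphere d) v"
  have N: "1 + ?N > 0" using chart_norm2_nonneg[of "Sphere d" v] by simp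
  have "(\<Sum>i\<le>d. (sphere_chart (Sphere d) v i)\<^sup>2) =
        (sphere_chart (Sphere d) v 0)\<^sup>2 + (\<Sum>i<d. (sphere_chart (Sphere d) v (Suc i))\<^sup>2)"
    by (rule sum.atMost_shift)
  also have "(\<Sum>i<d. (sphere_chart (Sphere d) v (Suc i))\<^sup>2) = (\<Sum>i<d. 4 / (1 + ?N)\<^sup>2 * (v i)\<^sup>2)"
    by (intro sum.cong) (auto simp: sphere_chart_def power_divide power_mult_distrib)
  also have "\<dots> = 4 / (1 + ?N)\<^sup>2 * ?N"
    by (simp only: sum_distrib_left[symmetric]) (simp add: chart_norm2_def)
  also have "(sphere_chart (Sphere d) v 0)\<^sup>2 + 4 / (1 + ?N)\<^sup>2 * ?N = ((1 - ?N)\<^sup>2 + 4 * ?N) / (1 + ?N)\<^sup>2"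
    by (simp add: sphere_chart_def power_divide add_divide_distrib)
  also have "(1 - ?N)\<^sup>2 + 4 * ?N = (1 + ?N)\<^sup>2" by (simp add: power2_eq_square algebra_simps)
  finally show ?thesis
    using N by (auto simp: unit_sphere_def sphere_chart_def)
qed

lemma points_proj: "is_proj S \<Longrightarrow> points S = Mat ` proj_space (line_dim S) (proj_dim S)"
  by (cases S) (simp_all add: points_def)

lemma chart_proj: "is_proj S \<Longrightarrow> chart S v = Mat (proj_chart S v)"
  by (cases S) (simp_all add: chart_def)

lemma origin_proj: "is_proj S \<Longrightarrow> origin S = Mat (\<lambda>i j. if i = 0 \<and> j = 0 then oct_one else 0)"
  by (cases S) (simp_all add: origin_def)

lemma not_is_projE: "\<not> is_proj S \<Longrightarrow> (\<And>d. S = Sphere d \<Longrightarrow> P) \<Longrightarrow> P"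
  by (cases S) auto

lemma chart_in_points: "admissible S \<Longrightarrow> chart S v \<in> points S"
  using proj_chart_in_proj_space[of S v] sphere_chart_in_unit_sphere[of _ v]
  by (cases "is_proj S") (auto elim!: not_is_projE simp: chart_proj points_proj, auto simp: chart_def points_def)

lemma origin_eq_chart: "admissible S \<Longrightarrow> origin S = chart S (\<lambda>_. 0)"
proof (cases "is_proj S")
  case True
  have "(if i = 0 \<and> j = 0 then oct_one else 0) = proj_chart S (\<lambda>_. 0) i j" for i j
    by (auto simp: proj_chart_def hom_coord_def chart_norm2_def)
       (auto simp: octonion_eq_iff oct_of_def oct_defs)
  with True show ?thesis by (auto simp: chart_proj origin_proj)
next
  case False
  then show ?thesis
    by (auto elim!: not_is_projE simp: chart_def origin_def sphere_chart_def chart_norm2_def fun_eq_iff)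
qed

lemma origin_in_points: "admissible S \<Longrightarrow> origin S \<in> points S"
  using chart_in_points[of S] origin_eq_chart[of S] by simp

text \<open>Put \<open>a = arctan \<bar>v\<bar>\<close>, so
  \<open>cos^2 a = 1 / (1 + \<bar>v\<bar>^2)\<close>. The trace against the origin is the (0,0)
  entry \<open>cos^2 a\<close> of the projection; on the sphere the inner product is the 0-th
  coordinate \<open>cos (2 a)\<close>.\<close>

lemma geodist_chart:
  assumes "admissible S"
  shows "geodist S (origin S) (chart S v) = 2 * arctan (sqrt (chart_norm2 S v))"
proof -
  let ?N = "chart_norm2 S v" and ?a = "arctan (sqrt (chart_norm2 S v))"
  have N: "0 \<le> ?N" by (rule chart_norm2_nonneg)
  have a: "0 \<le> ?a" "?a < pi / 2" "- (pi / 2) \<le> ?a" "?a \<le> pi"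
    using N arctan_ubound[of "sqrt ?N"] arctan_lbound[of "sqrt ?N"] pi_gt_zero by (auto simp del: pi_gt_zero)
  have cos2: "(cos ?a)\<^sup>2 = 1 / (1 + ?N)"
    using N by (simp add: cos_arctan power_divide)
  show ?thesis
  proof (cases "is_proj S")
    case True
    have "(\<Sum>i\<le>proj_dim S. \<Sum>j\<le>proj_dim S. (if i = 0 \<and> j = 0 then oct_one else 0) \<bullet> proj_chart S v i j)
        = (\<Sum>i\<le>proj_dim S. \<Sum>j\<le>proj_dim S. if i = 0 \<and> j = 0 then oct_one \<bullet> proj_chart S v 0 0 else 0)"
      by (intro sum.cong) auto
    also have "\<dots> = (\<Sum>i\<le>proj_dim S. if i = 0 then oct_one \<bullet> proj_chart S v 0 0 else 0)"
      by (intro sum.cong) (auto simp: sum.delta)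
    also have "\<dots> = oct_one \<bullet> proj_chart S v 0 0" by (simp add: sum.delta)
    also have "\<dots> = (cos ?a)\<^sup>2"
      unfolding cos2 by (simp add: proj_chart_def hom_coord_def) (simp add: octonion_inner oct_one_def)
    finally show ?thesis
      using cos_ge_zero[of ?a] arccos_cos[of ?a] a pi_gt_zero
      by (simp add: True geodist_def origin_proj chart_proj)
  next
    case False
    then obtain d where S: "S = Sphere d" by (rule not_is_projE)
    have "(\<Sum>i\<le>d. (if i = 0 then 1 else 0) * sphere_chart S v i) = (\<Sum>i\<le>d. if i = 0 then sphere_chart S v 0 else 0)"
      by (intro sum.cong) auto
    also have "\<dots> = sphere_chart S v 0" by (simp add: sum.delta)
    also have "\<dots> = 2 * (cos ?a)\<^sup>2 - 1"
      unfolding cos2 using N by (simp add: sphere_chart_def field_simps)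
    also have "\<dots> = cos (2 * ?a)" by (simp add: cos_double_cos)
    finally show ?thesis
      using a by (simp add: S geodist_def origin_def chart_def arccos_cos)
  qed
qed

section \<open>The Riemannian measure in polar coordinates\<close>

text \<open>Outside [-1,1] the defining description of \<open>arccos\<close> is the same
  unsatisfiable predicate for every argument, so its value there is constant. This makes distances
  measurable without bounding inner products of arbitrary points.\<close>

lemma borel_measurable_arccos_global [measurable]: "arccos \<in> borel_measurable borel"
proof -
  have out: "arccos y = arccos 2" if "y \<notin> {-1..1}" for y
  proof -
    have "(\<lambda>x. 0 \<le> x \<and> x \<le> pi \<and> cos x = z) = (\<lambda>x. False)" if "z \<notin> {-1..1}" for z
    proof -
      have "cos x \<noteq> z" for x
        using that cos_le_one[of x] cos_ge_minus_one[of x] by auto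
      then show ?thesis by simp
    qed
    from this[OF that] this[of 2] show ?thesis by (simp add: arccos_def)
  qed
  have "arccos = (\<lambda>x. if x \<in> {-1..1} then arccos x else arccos 2)"
  proof
    fix y
    show "arccos y = (if y \<in> {-1..1} then arccos y else arccos 2)"
      using out[of y] by (simp only: if_split simp_thms) blast
  qed
  moreover have "(\<lambda>x::real. if x \<in> {-1..1} then arccos x else arccos 2) \<in> borel_measurable borel"
    by (intro borel_measurable_continuous_on_if continuous_on_arccos') auto
  ultimately show ?thesis by (rule ssubst[where P = "\<lambda>f. f \<in> borel_measurable borel"])
qed

section \<open>Measurability of the chart\<close>

lemma space_chart_volume: "space (chart_volume S) = space (Pi\<^sub>M {..<sdim S} (\<lambda>_. lborel))"
  and sets_chart_volume: "sets (chart_volume S) = sets (Pi\<^sub>M {..<sdim S} (\<lambda>_. lborel))"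
  by (simp_all add: chart_volume_def)

lemma measurable_chart_volume_iff:
  "f \<in> measurable (chart_volume S) N \<longleftrightarrow> f \<in> measurable (Pi\<^sub>M {..<sdim S} (\<lambda>_. lborel)) N"
  by (rule arg_cong[of _ _ "\<lambda>A. f \<in> A"], rule measurable_cong_sets) (simp_all add: sets_chart_volume)

lemma coordinate_measurable:
  "i < d \<Longrightarrow> (\<lambda>v. v i) \<in> borel_measurable (Pi\<^sub>M {..<d} (\<lambda>_. lborel))"
  using measurable_component_singleton[of i "{..<d}" "\<lambda>_. lborel"] by (simp cong: measurable_cong_sets)

lemma norm_measurable:
  "(\<lambda>v. sqrt (\<Sum>i<d. (v i)\<^sup>2)) \<in> borel_measurable (Pi\<^sub>M {..<d} (\<lambda>_. lborel))"
proof -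
  have "(\<lambda>v. \<Sum>i<d. (v i :: real)\<^sup>2) \<in> borel_measurable (Pi\<^sub>M {..<d} (\<lambda>_. lborel))"
    by (intro borel_measurable_sum borel_measurable_power) (simp add: coordinate_measurable)
  then show ?thesis by simp
qed

lemma chart_norm2_measurable [measurable]:
  "chart_norm2 S \<in> borel_measurable (Pi\<^sub>M {..<sdim S} (\<lambda>_. lborel))"
  unfolding chart_norm2_def[abs_def]
  by (intro borel_measurable_sum borel_measurable_power) (simp add: coordinate_measurable)

lemma oct_of_measurable:
  assumes "\<And>k. (\<lambda>v. c v k) \<in> borel_measurable M"
  shows "(\<lambda>v. oct_of (c v)) \<in> borel_measurable M"
  using assms unfolding oct_of_def Complex_eq
  by (intro borel_measurable_Pair borel_measurable_add borel_measurable_times borel_measurable_of_real) auto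

lemma oct_mult_cnj_measurable:
  assumes "f \<in> borel_measurable M" "g \<in> borel_measurable M"
  shows "(\<lambda>v. oct_mult (f v) (oct_cnj (g v))) \<in> borel_measurable M"
  by (rule borel_measurable_continuous_Pair[OF assms])
     (unfold oct_defs, intro continuous_intros)

lemma hom_coord_measurable:
  assumes "is_proj S" "admissible S"
  shows "(\<lambda>v. hom_coord S v i) \<in> borel_measurable (Pi\<^sub>M {..<sdim S} (\<lambda>_. lborel))"
proof (cases "i = 0 \<or> i > proj_dim S")
  case True
  then show ?thesis by (auto simp: hom_coord_def)
next
  case False
  then obtain j where i: "i = Suc j" and j: "j < proj_dim S"
    by (cases i) auto
  have *: "line_dim S * j + k < sdim S" if "k < line_dim S" for k
  proof -
    have "line_dim S * j + k < line_dim S * Suc j" using that by simp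
    also have "\<dots> \<le> line_dim S * proj_dim S" using j by (intro mult_le_mono2) simp
    finally show ?thesis by (simp add: sdim_proj[OF assms])
  qed
  have "(\<lambda>v. oct_of (\<lambda>k. if k < line_dim S then v (line_dim S * j + k) else 0))
      \<in> borel_measurable (Pi\<^sub>M {..<sdim S} (\<lambda>_. lborel))"
  proof (rule oct_of_measurable)
    fix k
    show "(\<lambda>v. if k < line_dim S then v (line_dim S * j + k) else 0)
        \<in> borel_measurable (Pi\<^sub>M {..<sdim S} (\<lambda>_. lborel))"
      using *[of k] by (cases "k < line_dim S") (simp_all add: coordinate_measurable)
  qed
  then show ?thesis
    using j unfolding i hom_coord_def diff_Suc_1 by simp
qed

text \<open>The centre \<open>x\<close> is arbitrary because \<open>sym_borel\<close> is generated
  by balls about all points.\<close>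

lemma geodist_chart_measurable:
  assumes "admissible S" "x \<in> points S"
  shows "(\<lambda>v. geodist S x (chart S v)) \<in> borel_measurable (Pi\<^sub>M {..<sdim S} (\<lambda>_. lborel))"
proof (cases "is_proj S")
  case True
  then obtain P where x: "x = Mat P" using assms(2) by (auto simp: points_proj)
  have [measurable]: "(\<lambda>v. proj_chart S v i j) \<in> borel_measurable (Pi\<^sub>M {..<sdim S} (\<lambda>_. lborel))" for i j
    unfolding proj_chart_def
    by (intro borel_measurable_scaleR oct_mult_cnj_measurable hom_coord_measurable True assms) measurable
  show ?thesis
    by (simp add: x chart_proj[OF True] geodist_def)
next
  case False
  then obtain d where S: "S = Sphere d" by (rule not_is_projE)
  then obtain y where x: "x = Vec y" using assms(2) by (auto simp: points_def)
  have [measurable]: "(\<lambda>v. sphere_chart S v i) \<in> borel_measurable (Pi\<^sub>M {..<sdim S} (\<lambda>_. lborel))" for i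
  proof (cases "0 < i \<and> i \<le> sdim S")
    case True
    then have [measurable]: "(\<lambda>v. v (i - 1)) \<in> borel_measurable (Pi\<^sub>M {..<sdim S} (\<lambda>_. lborel))"
      by (intro coordinate_measurable) auto
    show ?thesis unfolding sphere_chart_def using True by measurable
  next
    case False
    then have "i = 0 \<or> i > sdim S" by auto
    then show ?thesis unfolding sphere_chart_def by auto
  qed
  have "chart S v = Vec (sphere_chart S v)" for v by (simp add: S chart_def)
  then show ?thesis
    by (simp add: x geodist_def)
qed

lemma chart_measurable:
  assumes "admissible S"
  shows "chart S \<in> measurable (Pi\<^sub>M {..<sdim S} (\<lambda>_. lborel)) (sym_borel S)"
  unfolding sym_borel_def
proof (rule measurable_measure_of)
  show "chart S \<in> space (Pi\<^sub>M {..<sdim S} (\<lambda>_. lborel)) \<rightarrow> points S"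
    using chart_in_points[OF assms] by auto
next
  fix B assume "B \<in> {{y \<in> points S. geodist S x y < r} |x r. x \<in> points S}"
  then obtain x r where x: "x \<in> points S" and B: "B = {y \<in> points S. geodist S x y < r}" by auto
  note [measurable] = geodist_chart_measurable[OF assms x]
  have "chart S -` B \<inter> space (Pi\<^sub>M {..<sdim S} (\<lambda>_. lborel)) =
      {v \<in> space (Pi\<^sub>M {..<sdim S} (\<lambda>_. lborel)). geodist S x (chart S v) < r}"
    using chart_in_points[OF assms] by (auto simp: B)
  also have "\<dots> \<in> sets (Pi\<^sub>M {..<sdim S} (\<lambda>_. lborel))" by measurable
  finally show "chart S -` B \<inter> space (Pi\<^sub>M {..<sdim S} (\<lambda>_. lborel)) \<in> sets (Pi\<^sub>M {..<sdim S} (\<lambda>_. lborel))" .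
qed auto

lemma space_sym_borel [simp]: "space (sym_borel S) = points S"
  unfolding sym_borel_def by (intro space_measure_of) auto

lemma space_riem_measure [simp]: "space (riem_measure S) = points S"
  by (simp add: riem_measure_def)

lemma sets_riem_measure [simp]: "sets (riem_measure S) = sets (sym_borel S)"
  by (simp add: riem_measure_def)

lemma geodist_origin_measurable:
  assumes "admissible S"
  shows "geodist S (origin S) \<in> borel_measurable (riem_measure S)"
proof (rule borel_measurableI_less)
  fix r
  have "{y \<in> points S. geodist S (origin S) y < r} \<in> sets (sym_borel S)"
    unfolding sym_borel_def using origin_in_points[OF assms] by (intro in_measure_of) auto
  then show "{x \<in> space (riem_measure S). geodist S (origin S) x < r} \<in> sets (riem_measure S)"
    by simp
qed

text \<open>Both measures give \<open>{..r}\<close> the volume of the ball of radius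
  \<open>r\<close>, of which the density is the derivative; half-lines generate the Borel
  sets.\<close>

lemma distr_norm_PiM_lborel:
  assumes "d > 0"
  shows "distr (Pi\<^sub>M {..<d} (\<lambda>_. lborel)) borel (\<lambda>v. sqrt (\<Sum>i<d. (v i)\<^sup>2)) =
    density lborel (\<lambda>r. ennreal (real d * unit_ball_vol (real d) * r ^ (d - 1)) * indicator {0..} r)"
    (is "?L = ?R")
proof -
  let ?P = "Pi\<^sub>M {..<d} (\<lambda>_. lborel :: real measure)"
  let ?V = "unit_ball_vol (real d)"
  define \<rho> :: "(nat \<Rightarrow> real) \<Rightarrow> real" where "\<rho> v = sqrt (\<Sum>i<d. (v i)\<^sup>2)" for v
  have \<rho>_nn: "\<rho> v \<ge> 0" for v by (simp add: \<rho>_def sum_nonneg)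
  have [measurable]: "\<rho> \<in> borel_measurable ?P"
    unfolding \<rho>_def[abs_def] by (rule norm_measurable)
  have ball: "emeasure ?P {v \<in> space ?P. \<rho> v \<le> r} = ennreal (?V * r ^ d)" if "r > 0" for r
  proof -
    have "{v \<in> space ?P. \<rho> v \<le> r} = {f. sqrt (\<Sum>i\<in>{..<d}. (f i)\<^sup>2) \<le> r} \<inter> space ?P"
      by (auto simp: \<rho>_def)
    then show ?thesis
      using emeasure_cball_aux[of "{..<d}" r] that by simp
  qed
  have L: "emeasure ?L {..r} = ennreal (?V * (max 0 r) ^ d)" for r
  proof -
    have eq: "emeasure ?L {..r} = emeasure ?P {v \<in> space ?P. \<rho> v \<le> r}"
      unfolding \<rho>_def[symmetric]
      by (subst emeasure_distr) (auto intro!: arg_cong[where f = "emeasure ?P"])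
    show ?thesis
    proof (cases "r > 0")
      case True
      then show ?thesis using ball[OF True] eq by (simp add: max_def)
    next
      case False
      \<comment> \<open>For \<open>r \<le> 0\<close> the set lies in arbitrarily small balls. Since
        \<open>r' \<le> 1\<close> and \<open>d \<ge> 1\<close>, \<open>r' ^ d \<le> r'\<close>,
        which makes \<open>e / ?V\<close> a sufficient radius.\<close>
      have "emeasure ?P {v \<in> space ?P. \<rho> v \<le> r} \<le> 0 + ennreal e" if "e > 0" for e
      proof -
        define r' where "r' = min 1 (e / ?V)"
        have V: "?V > 0" by simp
        have r': "0 < r'" "r' \<le> 1" "?V * r' \<le> e"
          using that V by (auto simp: r'_def min_def field_simps)
        have "emeasure ?P {v \<in> space ?P. \<rho> v \<le> r} \<le> emeasure ?P {v \<in> space ?P. \<rho> v \<le> r'}"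
          using False r' by (intro emeasure_mono) auto
        also have "\<dots> = ennreal (?V * r' ^ d)" by (rule ball) (rule r')
        also have "\<dots> \<le> ennreal (?V * r')"
          using r' power_decreasing[of 1 d r'] assms V by (intro ennreal_leI mult_left_mono) auto
        also have "\<dots> \<le> ennreal e" using r' by (intro ennreal_leI)
        finally show ?thesis by simp
      qed
      then have "emeasure ?P {v \<in> space ?P. \<rho> v \<le> r} \<le> 0"
        by (rule ennreal_le_epsilon)
      then show ?thesis using False assms eq by (simp add: max_def)
    qed
  qed
  have R: "emeasure ?R {..r} = ennreal (?V * (max 0 r) ^ d)" for r
  proof -
    have "emeasure ?R {..r} = (\<integral>\<^sup>+x. ennreal (real d * ?V * x ^ (d - 1)) * indicator {0..max 0 r} x \<partial>lborel)"
    proof -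
      have "emeasure ?R {..r} = (\<integral>\<^sup>+x. ennreal (real d * ?V * x ^ (d - 1)) * indicator {0..} x * indicator {..r} x \<partial>lborel)"
        by (rule emeasure_density) auto
      also have "\<dots> = (\<integral>\<^sup>+x. ennreal (real d * ?V * x ^ (d - 1)) * indicator {0..max 0 r} x \<partial>lborel)"
      proof (rule nn_integral_cong_AE)
        \<comment> \<open>For negative \<open>r\<close> the right side still sees the point 0,
          because of \<open>max 0 r\<close>.\<close>
        show "AE x in lborel. ennreal (real d * ?V * x ^ (d - 1)) * indicator {0..} x * indicator {..r} x =
            ennreal (real d * ?V * x ^ (d - 1)) * indicator {0..max 0 r} x"
          using AE_lborel_singleton[of 0] by eventually_elim (simp add: indicator_def max_def)
      qed
      finally show ?thesis .
    qed
    also have "\<dots> = ennreal (?V * (max 0 r) ^ d - ?V * 0 ^ d)"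
      by (rule nn_integral_FTC_Icc)
         (auto intro!: derivative_eq_intros mult_nonneg_nonneg)
    finally show ?thesis using assms by simp
  qed
  show ?thesis
  proof (rule measure_eqI_generator_eq[where E = "range atMost" and \<Omega> = UNIV and A = "\<lambda>n. {..real n}"])
    show "Int_stable (range (atMost :: real \<Rightarrow> _))"
      by (auto simp: Int_stable_def)
    show "\<And>X. X \<in> range atMost \<Longrightarrow> emeasure ?L X = emeasure ?R X"
      using L R by auto
    show "sets ?L = sigma_sets UNIV (range atMost)" "sets ?R = sigma_sets UNIV (range atMost)"
      by (simp_all add: borel_eq_atMost)
    show "(\<Union>n. {..real n}) = UNIV"
      using real_arch_simple by auto
    show "emeasure ?L {..real n} \<noteq> \<infinity>" for n
      by (simp add: L)
  qed auto
qed

text \<open>The substitution is made on \<open>[0, arctan n]\<close>, where the cosine does not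
  vanish, and monotone convergence exhausts the half-line. The missing end point
  \<open>pi / 2\<close> is a null set.\<close>

lemma nn_integral_substitution_tan:
  fixes f :: "real \<Rightarrow> real"
  assumes [measurable]: "f \<in> borel_measurable borel"
  shows "(\<integral>\<^sup>+r. ennreal (f r) * indicator {0..} r \<partial>lborel) =
    (\<integral>\<^sup>+\<phi>. ennreal (f (tan \<phi>) * (1 + (tan \<phi>)\<^sup>2)) * indicator {0..pi / 2} \<phi> \<partial>lborel)"
proof -
  have tan_meas [measurable]: "(tan :: real \<Rightarrow> real) \<in> borel_measurable borel"
    unfolding tan_def[abs_def] by measurable
  have "(\<integral>\<^sup>+r. ennreal (f r) * indicator {0..} r \<partial>lborel) =
     (\<integral>\<^sup>+r. (SUP n. ennreal (f r) * indicator {0..real n} r) \<partial>lborel)"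
  proof (rule nn_integral_cong)
    fix r :: real
    obtain n where n: "r \<le> real n" using real_arch_simple by blast
    show "ennreal (f r) * indicator {0..} r = (SUP n. ennreal (f r) * indicator {0..real n} r)"
      using n by (intro antisym SUP_least SUP_upper2[of n]) (auto split: split_indicator)
  qed
  also have "\<dots> = (SUP n. \<integral>\<^sup>+r. ennreal (f r) * indicator {0..real n} r \<partial>lborel)"
    by (rule nn_integral_monotone_convergence_SUP)
       (auto simp: incseq_def le_fun_def split: split_indicator)
  also have "\<dots> = (SUP n. \<integral>\<^sup>+\<phi>. ennreal (f (tan \<phi>) * (1 + (tan \<phi>)\<^sup>2)) * indicator {0..arctan (real n)} \<phi> \<partial>lborel)"
  proof (rule SUP_cong[OF refl])
    fix n :: nat
    have cosnz: "cos x \<noteq> 0" if "x \<in> {0..arctan (real n)}" for x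
    proof -
      have "0 < cos x" using that arctan_ubound[of "real n"] by (intro cos_gt_zero_pi) auto
      then show ?thesis by simp
    qed
    have cont: "continuous_on {0..arctan (real n)} (\<lambda>x. 1 + (tan x)\<^sup>2)"
      using cosnz by (intro continuous_intros) auto
    have "(\<integral>\<^sup>+x. ennreal (f x * indicator {tan 0..tan (arctan (real n))} x) \<partial>lborel)
       = (\<integral>\<^sup>+x. ennreal (f (tan x) * (1 + (tan x)\<^sup>2) * indicator {0..arctan (real n)} x) \<partial>lborel)"
    proof (rule nn_integral_substitution[OF _ _ cont])
      show "set_borel_measurable borel {tan 0..tan (arctan (real n))} f"
        by (simp add: set_borel_measurable_def)
      show "(tan has_real_derivative 1 + (tan x)\<^sup>2) (at x)" if "x \<in> {0..arctan (real n)}" for x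
        using DERIV_tan[OF cosnz[OF that]] tan_sec[OF cosnz[OF that]] by (simp add: power_inverse)
    qed auto
    then show "(\<integral>\<^sup>+r. ennreal (f r) * indicator {0..real n} r \<partial>lborel) =
      (\<integral>\<^sup>+\<phi>. ennreal (f (tan \<phi>) * (1 + (tan \<phi>)\<^sup>2)) * indicator {0..arctan (real n)} \<phi> \<partial>lborel)"
      by (simp add: ennreal_mult'' ennreal_indicator tan_arctan)
  qed
  also have "\<dots> = (\<integral>\<^sup>+\<phi>. (SUP n. ennreal (f (tan \<phi>) * (1 + (tan \<phi>)\<^sup>2)) * indicator {0..arctan (real n)} \<phi>) \<partial>lborel)"
    by (rule nn_integral_monotone_convergence_SUP[symmetric])
       (auto simp: incseq_def le_fun_def arctan_monotone' intro: order_trans split: split_indicator)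
  also have "\<dots> = (\<integral>\<^sup>+\<phi>. ennreal (f (tan \<phi>) * (1 + (tan \<phi>)\<^sup>2)) * indicator {0..pi / 2} \<phi> \<partial>lborel)"
  proof (rule nn_integral_cong_AE, rule AE_I[where N = "{pi / 2}"])
    have "(SUP n. ennreal (f (tan \<phi>) * (1 + (tan \<phi>)\<^sup>2)) * indicator {0..arctan (real n)} \<phi>) =
       ennreal (f (tan \<phi>) * (1 + (tan \<phi>)\<^sup>2)) * indicator {0..pi / 2} \<phi>" if "\<phi> \<noteq> pi / 2" for \<phi>
    proof (cases "0 \<le> \<phi> \<and> \<phi> < pi / 2")
      case True
      obtain n where n: "tan \<phi> \<le> real n" using real_arch_simple by blast
      have "\<phi> = arctan (tan \<phi>)" using True by (intro arctan_tan[symmetric]) auto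
      also have "\<dots> \<le> arctan (real n)" using n by (rule arctan_monotone')
      finally have "\<phi> \<le> arctan (real n)" .
      with True show ?thesis
        by (intro antisym SUP_least SUP_upper2[of n]) (auto split: split_indicator)
    next
      case False
      with that arctan_ubound have "\<not> (0 \<le> \<phi> \<and> \<phi> \<le> arctan (real n))" for n
        by (metis less_le_trans not_le order_le_less_trans)
      then have "indicator {0..arctan (real n)} \<phi> = (0 :: ennreal)" for n by auto
      moreover have "indicator {0..pi / 2} \<phi> = (0 :: ennreal)" using False that by auto
      ultimately show ?thesis by simp
    qed
    then show "{\<phi> \<in> space lborel. (SUP n. ennreal (f (tan \<phi>) * (1 + (tan \<phi>)\<^sup>2)) * indicator {0..arctan (real n)} \<phi>) \<noteq>
       ennreal (f (tan \<phi>) * (1 + (tan \<phi>)\<^sup>2)) * indicator {0..pi / 2} \<phi>} \<subseteq> {pi / 2}" by blast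
  qed auto
  finally show ?thesis .
qed

text \<open>The variable is half the distance. On the sphere, where \<open>line_dim\<close> is
  \<open>d\<close>, this is the familiar \<open>(sin \<theta> / 2) ^ (d - 1)\<close>; in general it
  is the Jacobi weight in the angle variable.\<close>

definition polar_density :: "sym_space \<Rightarrow> real \<Rightarrow> real" where
  "polar_density S \<phi> = sin \<phi> ^ (sdim S - 1) * cos \<phi> ^ (line_dim S - 1) * indicator {0..pi / 2} \<phi>"

lemma polar_density_nonneg: "polar_density S \<phi> \<ge> 0"
proof (cases "\<phi> \<in> {0..pi / 2}")
  case True
  then have "0 \<le> sin \<phi>" "0 \<le> cos \<phi>"
    using sin_ge_zero[of \<phi>] cos_ge_zero[of \<phi>] by auto
  then show ?thesis by (simp add: polar_density_def)
qed (simp add: polar_density_def)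

lemma polar_density_measurable [measurable]: "polar_density S \<in> borel_measurable borel"
  unfolding polar_density_def[abs_def] by measurable

lemma emeasure_chart_volume_polar:
  assumes "admissible S" and [measurable]: "B \<in> sets borel"
  shows "emeasure (chart_volume S) {v \<in> space (chart_volume S). arctan (sqrt (chart_norm2 S v)) \<in> B} =
     (\<integral>\<^sup>+\<phi>. ennreal (real (sdim S) * unit_ball_vol (real (sdim S)) * polar_density S \<phi>) * indicator B \<phi> \<partial>lborel)"
proof -
  define d l V where "d = sdim S" and "l = line_dim S" and "V = unit_ball_vol (real d)"
  have d: "d > 0" "l > 0" using line_dim_le[OF assms(1)] by (auto simp: d_def l_def)
  have V: "V > 0" by (simp add: V_def)
  let ?P = "Pi\<^sub>M {..<d} (\<lambda>_. lborel :: real measure)"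
  let ?q = "\<lambda>r::real. (1 + r\<^sup>2) powr (- (real d + real l) / 2)"
  let ?f = "\<lambda>r::real. real d * V * r ^ (d - 1) * (?q r * indicator B (arctan r))"
  have meas: "chart_norm2 S \<in> borel_measurable ?P"
    unfolding d_def by simp
  have [measurable]: "(arctan :: real \<Rightarrow> real) \<in> borel_measurable borel"
    by (intro borel_measurable_continuous_onI continuous_intros)
  have "emeasure (chart_volume S) {v \<in> space (chart_volume S). arctan (sqrt (chart_norm2 S v)) \<in> B} =
     (\<integral>\<^sup>+v. ennreal ((1 + chart_norm2 S v) powr (- (real d + real l) / 2)) *
        indicator {v \<in> space (chart_volume S). arctan (sqrt (chart_norm2 S v)) \<in> B} v \<partial>?P)"
    unfolding chart_volume_def d_def[symmetric] l_def[symmetric]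
  proof (rule emeasure_density)
    show "(\<lambda>v. ennreal ((1 + chart_norm2 S v) powr (- (real d + real l) / 2))) \<in> borel_measurable ?P"
      using meas by measurable
    show "{v \<in> space (density ?P (\<lambda>v. ennreal ((1 + chart_norm2 S v) powr (- (real d + real l) / 2)))).
        arctan (sqrt (chart_norm2 S v)) \<in> B} \<in> sets ?P"
      using meas by simp
  qed
  also have "\<dots> = (\<integral>\<^sup>+v. ennreal (?q (sqrt (\<Sum>i<d. (v i)\<^sup>2)) * indicator B (arctan (sqrt (\<Sum>i<d. (v i)\<^sup>2)))) \<partial>?P)"
    by (intro nn_integral_cong)
       (auto simp: space_chart_volume d_def chart_norm2_def sum_nonneg split: split_indicator)
  also have "\<dots> = (\<integral>\<^sup>+r. ennreal (?q r * indicator B (arctan r))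
      \<partial>distr ?P borel (\<lambda>v. sqrt (\<Sum>i<d. (v i)\<^sup>2)))"
    by (rule nn_integral_distr[OF norm_measurable, symmetric]) measurable
  also have "\<dots> = (\<integral>\<^sup>+r. ennreal (?q r * indicator B (arctan r)) \<partial>density lborel
       (\<lambda>r. ennreal (real d * V * r ^ (d - 1)) * indicator {0..} r))"
    by (simp only: distr_norm_PiM_lborel[OF d(1)] V_def)
  also have "\<dots> = (\<integral>\<^sup>+r. (ennreal (real d * V * r ^ (d - 1)) * indicator {0..} r) *
       ennreal (?q r * indicator B (arctan r)) \<partial>lborel)"
    by (rule nn_integral_density) measurable
  also have "\<dots> = (\<integral>\<^sup>+r. ennreal (?f r) * indicator {0..} r \<partial>lborel)"
    using V by (intro nn_integral_cong) (auto simp: ennreal_mult split: split_indicator)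
  also have "\<dots> = (\<integral>\<^sup>+\<phi>. ennreal (?f (tan \<phi>) * (1 + (tan \<phi>)\<^sup>2)) * indicator {0..pi / 2} \<phi> \<partial>lborel)"
    by (rule nn_integral_substitution_tan) measurable
  also have "\<dots> = (\<integral>\<^sup>+\<phi>. ennreal (real d * V * polar_density S \<phi>) * indicator B \<phi> \<partial>lborel)"
  proof (rule nn_integral_cong_AE, rule AE_I[where N = "{pi / 2}"])
    have "ennreal (?f (tan \<phi>) * (1 + (tan \<phi>)\<^sup>2)) * indicator {0..pi / 2} \<phi> =
       ennreal (real d * V * polar_density S \<phi>) * indicator B \<phi>" if "\<phi> \<noteq> pi / 2" for \<phi>
    proof (cases "0 \<le> \<phi> \<and> \<phi> < pi / 2")
      case True
      then have c: "cos \<phi> > 0" by (intro cos_gt_zero_pi) auto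
      have at: "arctan (tan \<phi>) = \<phi>" using True by (intro arctan_tan) auto
      have sec: "1 + (tan \<phi>)\<^sup>2 = cos \<phi> powr (-2)"
        using tan_sec[of \<phi>] c by (simp add: powr_minus powr_numeral power_inverse)
      \<comment> \<open>The factor \<open>cos^2\<close> is carried on both sides so that the
        exponent \<open>d + l\<close> splits as \<open>(d - 1) + (l - 1) + 2\<close> without
        negative powers. The first part then cancels the denominator of
        \<open>tan ^ (d - 1)\<close>.\<close>
      have q: "?q (tan \<phi>) * (1 + (tan \<phi>)\<^sup>2) * cos \<phi> ^ 2 = cos \<phi> ^ (d - 1) * cos \<phi> ^ (l - 1) * cos \<phi> ^ 2"
      proof -
        have "?q (tan \<phi>) = cos \<phi> powr real (d + l)"
          unfolding sec powr_powr by (rule arg_cong[where f = "(powr) (cos \<phi>)"]) (simp add: field_simps)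
        also have "\<dots> = cos \<phi> ^ (d + l)" using c by (rule powr_realpow)
        also have "\<dots> = cos \<phi> ^ (d - 1) * cos \<phi> ^ (l - 1) * cos \<phi> ^ 2"
        proof -
          have "d + l = (d - 1) + (l - 1) + 2" using d by linarith
          then show ?thesis by (metis power_add)
        qed
        finally have "?q (tan \<phi>) = cos \<phi> ^ (d - 1) * cos \<phi> ^ (l - 1) * cos \<phi> ^ 2" .
        moreover have "(1 + (tan \<phi>)\<^sup>2) * cos \<phi> ^ 2 = 1"
          using tan_sec[of \<phi>] c by (simp add: power_mult_distrib[symmetric])
        ultimately show ?thesis by (metis mult.assoc mult.right_neutral)
      qed
      then have q': "?q (tan \<phi>) * (1 + (tan \<phi>)\<^sup>2) = cos \<phi> ^ (d - 1) * cos \<phi> ^ (l - 1)"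
        using c by simp
      have "tan \<phi> ^ (d - 1) * (?q (tan \<phi>) * (1 + (tan \<phi>)\<^sup>2)) = sin \<phi> ^ (d - 1) * cos \<phi> ^ (l - 1)"
        unfolding q' using c by (simp add: tan_def power_divide)
      then have eq: "?f (tan \<phi>) * (1 + (tan \<phi>)\<^sup>2) =
         real d * V * (sin \<phi> ^ (d - 1) * cos \<phi> ^ (l - 1)) * indicator B \<phi>"
        unfolding at by (simp add: mult_ac)
      show ?thesis
        unfolding eq using True by (simp add: polar_density_def d_def l_def split: split_indicator)
    next
      case False
      with that show ?thesis by (auto simp: polar_density_def)
    qed
    then show "{\<phi> \<in> space lborel. ennreal (?f (tan \<phi>) * (1 + (tan \<phi>)\<^sup>2)) * indicator {0..pi / 2} \<phi> \<noteq>
        ennreal (real d * V * polar_density S \<phi>) * indicator B \<phi>} \<subseteq> {pi / 2}" by blast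
  qed auto
  finally show ?thesis by (simp add: d_def V_def)
qed

definition polar_weight :: "sym_space \<Rightarrow> real \<Rightarrow> real" where
  "polar_weight S \<phi> = sin \<phi> ^ (sdim S - 1) * cos \<phi> ^ (line_dim S - 1)"

lemma polar_density_eq: "polar_density S \<phi> = indicator {0..pi / 2} \<phi> * polar_weight S \<phi>"
  by (simp add: polar_density_def polar_weight_def)

lemma continuous_on_polar_weight [continuous_intros]: "continuous_on A (polar_weight S)"
  unfolding polar_weight_def[abs_def] by (intro continuous_intros)

definition polar_mass :: "sym_space \<Rightarrow> real" where
  "polar_mass S = (\<integral>\<phi>. polar_density S \<phi> \<partial>lborel)"

lemma integrable_polar_density:
  fixes F :: "real \<Rightarrow> real"
  assumes "continuous_on UNIV F"
  shows "integrable lborel (\<lambda>\<phi>. polar_density S \<phi> * F \<phi>)"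
    and "(\<integral>\<phi>. polar_density S \<phi> * F \<phi> \<partial>lborel) = integral {0..pi / 2} (\<lambda>\<phi>. polar_weight S \<phi> * F \<phi>)"
proof -
  have cont: "continuous_on {0..pi / 2} (\<lambda>\<phi>. polar_weight S \<phi> * F \<phi>)"
    by (intro continuous_intros continuous_on_subset[OF assms]) auto
  then have int: "set_integrable lborel {0..pi / 2} (\<lambda>\<phi>. polar_weight S \<phi> * F \<phi>)"
    by (rule borel_integrable_atLeastAtMost')
  then show "integrable lborel (\<lambda>\<phi>. polar_density S \<phi> * F \<phi>)"
    by (simp add: set_integrable_def polar_density_eq mult.assoc)
  show "(\<integral>\<phi>. polar_density S \<phi> * F \<phi> \<partial>lborel) = integral {0..pi / 2} (\<lambda>\<phi>. polar_weight S \<phi> * F \<phi>)"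
    using set_borel_integral_eq_integral(2)[OF int]
    by (simp add: set_lebesgue_integral_def polar_density_eq mult.assoc)
qed

lemma nn_integral_polar_density: "(\<integral>\<^sup>+\<phi>. ennreal (polar_density S \<phi>) \<partial>lborel) = ennreal (polar_mass S)"
  unfolding polar_mass_def
  using integrable_polar_density(1)[of "\<lambda>_. 1" S] by (intro nn_integral_eq_integral) (auto simp: polar_density_nonneg)

lemma polar_mass_pos: "polar_mass S > 0"
proof (rule ccontr)
  assume "\<not> polar_mass S > 0"
  then have "(\<integral>\<^sup>+\<phi>. ennreal (polar_density S \<phi>) \<partial>lborel) = 0"
    unfolding nn_integral_polar_density by (simp add: ennreal_neg)
  then have "AE \<phi> in lborel. ennreal (polar_density S \<phi>) = 0"
    by (subst (asm) nn_integral_0_iff_AE) auto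
  then have "AE \<phi> in lborel. \<phi> \<notin> {0<..<pi / 2}"
  proof eventually_elim
    case (elim \<phi>)
    have "polar_density S \<phi> > 0" if "\<phi> \<in> {0<..<pi / 2}"
      using that sin_gt_zero[of \<phi>] cos_gt_zero[of \<phi>] by (simp add: polar_density_def)
    with elim show ?case by (auto simp: ennreal_eq_0_iff)
  qed
  then have "emeasure lborel {0<..<pi / 2} = 0"
    by (subst (asm) AE_iff_measurable[where N = "{0<..<pi / 2}"]) auto
  then show False by simp
qed

lemma emeasure_chart_volume_radial:
  assumes "admissible S" "B \<in> sets borel"
  shows "emeasure (chart_volume S) {v \<in> space (chart_volume S). arctan (sqrt (chart_norm2 S v)) \<in> B} =
    ennreal (real (sdim S) * unit_ball_vol (real (sdim S)) * polar_mass S) *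
      (\<integral>\<^sup>+\<phi>. ennreal (polar_density S \<phi> / polar_mass S) * indicator B \<phi> \<partial>lborel)"
proof -
  let ?K = "real (sdim S) * unit_ball_vol (real (sdim S))"
  have "ennreal (?K * polar_density S \<phi>) * indicator B \<phi> =
      ennreal (?K * polar_mass S) * (ennreal (polar_density S \<phi> / polar_mass S) * indicator B \<phi>)" for \<phi>
    using polar_mass_pos[of S] polar_density_nonneg[of S \<phi>]
    by (simp add: ennreal_mult[symmetric] mult.assoc[symmetric])
  then show ?thesis
    unfolding emeasure_chart_volume_polar[OF assms] using assms(2) by (simp add: nn_integral_cmult)
qed

lemma nn_integral_normalized_polar_density:
  "(\<integral>\<^sup>+\<phi>. ennreal (polar_density S \<phi> / polar_mass S) \<partial>lborel) = 1"
proof -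
  have "(\<integral>\<^sup>+\<phi>. ennreal (polar_density S \<phi> / polar_mass S) \<partial>lborel)
      = (\<integral>\<^sup>+\<phi>. ennreal (1 / polar_mass S) * ennreal (polar_density S \<phi>) \<partial>lborel)"
    using polar_mass_pos[of S] polar_density_nonneg[of S]
    by (intro nn_integral_cong) (simp add: ennreal_mult[symmetric])
  also have "\<dots> = ennreal (1 / polar_mass S) * ennreal (polar_mass S)"
    by (simp add: nn_integral_cmult nn_integral_polar_density)
  also have "\<dots> = 1"
    using polar_mass_pos[of S] by (simp add: ennreal_mult[symmetric])
  finally show ?thesis .
qed

lemma emeasure_chart_volume_space:
  assumes "admissible S"
  shows "emeasure (chart_volume S) (space (chart_volume S)) =
    ennreal (real (sdim S) * unit_ball_vol (real (sdim S)) * polar_mass S)"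
  using emeasure_chart_volume_radial[OF assms, of UNIV] nn_integral_normalized_polar_density[of S] by simp

lemma total_mass_pos:
  "admissible S \<Longrightarrow> real (sdim S) * unit_ball_vol (real (sdim S)) * polar_mass S > 0"
  using line_dim_le[of S] polar_mass_pos[of S] by (intro mult_pos_pos) auto

lemma emeasure_riem_measure_space:
  assumes "admissible S"
  shows "emeasure (riem_measure S) (points S) = 1"
proof -
  let ?C = "chart_volume S"
  have meas: "chart S \<in> measurable (uniform_measure ?C (space ?C)) (sym_borel S)"
    using chart_measurable[OF assms] by (simp add: measurable_chart_volume_iff[symmetric] cong: measurable_cong_sets)
  have "emeasure (riem_measure S) (points S) = emeasure (uniform_measure ?C (space ?C)) (space ?C)"
  proof -
    have "chart S -` points S \<inter> space ?C = space ?C"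
      using chart_in_points[OF assms] by auto
    moreover have "points S \<in> sets (sym_borel S)"
      using sets.top[of "sym_borel S"] by simp
    ultimately show ?thesis
      unfolding riem_measure_def by (subst emeasure_distr[OF meas]) simp_all
  qed
  also have "\<dots> = 1"
    using total_mass_pos[OF assms]
    by (intro emeasure_uniform_measure_1) (auto simp: emeasure_chart_volume_space[OF assms] ennreal_eq_0_iff)
  finally show ?thesis .
qed

lemma measure_riem_measure_space: "admissible S \<Longrightarrow> measure (riem_measure S) (points S) = 1"
  by (simp add: measure_def emeasure_riem_measure_space)

text \<open>The reduction to one variable: integrals of radial functions depend only on this law.
  The area of the unit sphere in the chart cancels in the normalization.\<close>

lemma distr_riem_measure_polar:
  assumes "admissible S"
  shows "distr (riem_measure S) borel (\<lambda>x. geodist S (origin S) x / 2) =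
    density lborel (\<lambda>\<phi>. ennreal (polar_density S \<phi> / polar_mass S))" (is "?L = ?R")
proof (rule measure_eqI)
  fix B assume "B \<in> sets ?L"
  then have B [measurable]: "B \<in> sets borel" by simp
  let ?C = "chart_volume S" and ?g = "\<lambda>x. geodist S (origin S) x / 2"
  let ?T = "real (sdim S) * unit_ball_vol (real (sdim S)) * polar_mass S"
  have meas: "chart S \<in> measurable (uniform_measure ?C (space ?C)) (sym_borel S)"
    using chart_measurable[OF assms] by (simp add: measurable_chart_volume_iff[symmetric] cong: measurable_cong_sets)
  note [measurable] = geodist_origin_measurable[OF assms]
  have gB: "?g -` B \<inter> points S \<in> sets (sym_borel S)"
    using measurable_sets[of ?g "riem_measure S" borel B] by simp
  have "emeasure ?L B = emeasure (riem_measure S) (?g -` B \<inter> points S)"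
    by (subst emeasure_distr) simp_all
  also have "\<dots> = emeasure (uniform_measure ?C (space ?C)) (chart S -` (?g -` B \<inter> points S) \<inter> space ?C)"
    unfolding riem_measure_def by (subst emeasure_distr[OF meas gB]) simp
  also have "chart S -` (?g -` B \<inter> points S) \<inter> space ?C =
     {v \<in> space ?C. arctan (sqrt (chart_norm2 S v)) \<in> B}"
    using chart_in_points[OF assms] by (auto simp: geodist_chart[OF assms])
  also have "emeasure (uniform_measure ?C (space ?C)) \<dots> =
      emeasure ?C (space ?C \<inter> {v \<in> space ?C. arctan (sqrt (chart_norm2 S v)) \<in> B}) / emeasure ?C (space ?C)"
  proof (rule emeasure_uniform_measure)
    have [measurable]: "(arctan :: real \<Rightarrow> real) \<in> borel_measurable borel"
      by (intro borel_measurable_continuous_onI continuous_intros)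
    have [measurable]: "chart_norm2 S \<in> borel_measurable ?C"
      by (simp add: measurable_chart_volume_iff)
    show "{v \<in> space ?C. arctan (sqrt (chart_norm2 S v)) \<in> B} \<in> sets ?C" by measurable
  qed simp
  also have "space ?C \<inter> {v \<in> space ?C. arctan (sqrt (chart_norm2 S v)) \<in> B}
      = {v \<in> space ?C. arctan (sqrt (chart_norm2 S v)) \<in> B}" by auto
  also have "emeasure ?C \<dots> / emeasure ?C (space ?C) =
      (\<integral>\<^sup>+\<phi>. ennreal (polar_density S \<phi> / polar_mass S) * indicator B \<phi> \<partial>lborel)"
    unfolding emeasure_chart_volume_space[OF assms] emeasure_chart_volume_radial[OF assms B]
    using total_mass_pos[OF assms] by (subst mult.commute, intro ennreal_mult_divide_eq) (auto simp: ennreal_eq_0_iff)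
  also have "\<dots> = emeasure ?R B"
    by (subst emeasure_density) simp_all
  finally show "emeasure ?L B = emeasure ?R B" .
qed simp

section \<open>Means of radial functions\<close>

definition radial_mean :: "sym_space \<Rightarrow> (real \<Rightarrow> real) \<Rightarrow> real" where
  "radial_mean S F = (\<integral>x. F (geodist S (origin S) x / 2) \<partial>riem_measure S)"

text \<open>Linearity and monotonicity of \<open>radial_mean\<close> are taken from the integral
  over the space; the interval integral serves for explicit evaluation.\<close>

lemma
  assumes S: "admissible S" and F: "continuous_on UNIV F"
  shows integrable_radial: "integrable (riem_measure S) (\<lambda>x. F (geodist S (origin S) x / 2))"
    and radial_mean_eq: "radial_mean S F = integral {0..pi / 2} (\<lambda>\<phi>. polar_weight S \<phi> * F \<phi>) / polar_mass S"
proof -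
  have g [measurable]: "(\<lambda>x. geodist S (origin S) x / 2) \<in> measurable (riem_measure S) borel"
    using geodist_origin_measurable[OF S] by measurable
  have [measurable]: "F \<in> borel_measurable borel"
    by (rule borel_measurable_continuous_onI[OF F])
  have nn: "AE \<phi> in lborel. 0 \<le> polar_density S \<phi> / polar_mass S"
    using polar_mass_pos[of S] polar_density_nonneg[of S] by auto
  have "integrable (density lborel (\<lambda>\<phi>. ennreal (polar_density S \<phi> / polar_mass S))) F"
    using integrable_polar_density(1)[OF F, of S] nn by (subst integrable_density) auto
  then show "integrable (riem_measure S) (\<lambda>x. F (geodist S (origin S) x / 2))"
    using integrable_distr_eq[OF g, of F] by (simp add: distr_riem_measure_polar[OF S])
  have "radial_mean S F = integral\<^sup>L (density lborel (\<lambda>\<phi>. ennreal (polar_density S \<phi> / polar_mass S))) F"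
    unfolding radial_mean_def distr_riem_measure_polar[OF S, symmetric]
    by (rule integral_distr[symmetric]) measurable
  also have "\<dots> = (\<integral>\<phi>. polar_density S \<phi> / polar_mass S * F \<phi> \<partial>lborel)"
    using nn by (subst integral_density) auto
  also have "\<dots> = (\<integral>\<phi>. polar_density S \<phi> * F \<phi> \<partial>lborel) / polar_mass S"
    by (simp add: field_simps)
  finally show "radial_mean S F = integral {0..pi / 2} (\<lambda>\<phi>. polar_weight S \<phi> * F \<phi>) / polar_mass S"
    by (simp only: integrable_polar_density(2)[OF F])
qed

text \<open>Read off from the support of the polar density, which avoids inner product estimates for
  arbitrary points.\<close>

lemma geodist_range:
  assumes "admissible S"
  shows "AE x in riem_measure S. 0 \<le> geodist S (origin S) x \<and> geodist S (origin S) x \<le> pi"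
proof -
  have g [measurable]: "(\<lambda>x. geodist S (origin S) x / 2) \<in> measurable (riem_measure S) borel"
    using geodist_origin_measurable[OF assms] by measurable
  have "AE \<phi> in density lborel (\<lambda>\<phi>. ennreal (polar_density S \<phi> / polar_mass S)). 0 \<le> \<phi> \<and> \<phi> \<le> pi / 2"
    by (subst AE_density) (auto simp: polar_density_def indicator_def)
  then have "AE \<phi> in distr (riem_measure S) borel (\<lambda>x. geodist S (origin S) x / 2). 0 \<le> \<phi> \<and> \<phi> \<le> pi / 2"
    by (simp only: distr_riem_measure_polar[OF assms])
  then have "AE x in riem_measure S. 0 \<le> geodist S (origin S) x / 2 \<and> geodist S (origin S) x / 2 \<le> pi / 2"
    by (subst (asm) AE_distr_iff) auto
  then show ?thesis by eventually_elim auto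
qed

section \<open>Orthogonality of Jacobi polynomials\<close>

lemma radial_mean_cmult: "radial_mean S (\<lambda>\<phi>. c * F \<phi>) = c * radial_mean S F"
  by (simp add: radial_mean_def)

lemma radial_mean_sum:
  assumes "admissible S" "\<And>i. i \<in> I \<Longrightarrow> continuous_on UNIV (F i)"
  shows "radial_mean S (\<lambda>\<phi>. \<Sum>i\<in>I. F i \<phi>) = (\<Sum>i\<in>I. radial_mean S (F i))"
  unfolding radial_mean_def using assms by (intro Bochner_Integration.integral_sum integrable_radial)

lemma radial_mean_add:
  assumes "admissible S" "continuous_on UNIV F" "continuous_on UNIV G"
  shows "radial_mean S (\<lambda>\<phi>. F \<phi> + G \<phi>) = radial_mean S F + radial_mean S G"
  unfolding radial_mean_def using assms by (intro Bochner_Integration.integral_add integrable_radial)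

lemma radial_mean_diff:
  assumes "admissible S" "continuous_on UNIV F" "continuous_on UNIV G"
  shows "radial_mean S (\<lambda>\<phi>. F \<phi> - G \<phi>) = radial_mean S F - radial_mean S G"
  unfolding radial_mean_def using assms by (intro Bochner_Integration.integral_diff integrable_radial)

lemma radial_mean_mono:
  assumes "admissible S" "continuous_on UNIV F" "continuous_on UNIV G" "\<And>\<phi>. F \<phi> \<le> G \<phi>"
  shows "radial_mean S F \<le> radial_mean S G"
  unfolding radial_mean_def using assms by (intro integral_mono integrable_radial)

lemma radial_mean_const: "admissible S \<Longrightarrow> radial_mean S (\<lambda>_. c) = c"
  by (simp add: radial_mean_def measure_riem_measure_space)

section \<open>Beta integrals and finite differences\<close>

definition wallis :: "nat \<Rightarrow> nat \<Rightarrow> real" where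
  "wallis p q = integral {0..pi / 2} (\<lambda>\<phi>. sin \<phi> ^ p * cos \<phi> ^ q)"

text \<open>\<open>wallis p q\<close> is half the Beta function at \<open>(p + 1) / 2\<close> and
  \<open>(q + 1) / 2\<close>. The recursion integrates the derivative of
  \<open>sin ^ (p + 1) * cos ^ (q + 1)\<close>, which vanishes at both ends.\<close>

lemma wallis_rec: "real (q + 1) * wallis (p + 2) q = real (p + 1) * wallis p (q + 2)"
proof -
  have int: "(\<lambda>\<phi>::real. sin \<phi> ^ p' * cos \<phi> ^ q') integrable_on {0..pi / 2}" for p' q'
    by (intro integrable_continuous_interval continuous_intros)
  have "((\<lambda>\<phi>. real (p + 1) * (sin \<phi> ^ p * cos \<phi> ^ (q + 2)) - real (q + 1) * (sin \<phi> ^ (p + 2) * cos \<phi> ^ q))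
     has_integral (sin (pi / 2) ^ (p + 1) * cos (pi / 2) ^ (q + 1) - sin 0 ^ (p + 1) * cos 0 ^ (q + 1))) {0..pi / 2}"
  proof (rule fundamental_theorem_of_calculus)
    fix x :: real
    have "((\<lambda>\<phi>. sin \<phi> ^ Suc p) has_real_derivative real (Suc p) * (cos x * sin x ^ p)) (at x within {0..pi / 2})"
         "((\<lambda>\<phi>. cos \<phi> ^ Suc q) has_real_derivative real (Suc q) * (- sin x * cos x ^ q)) (at x within {0..pi / 2})"
      using has_field_derivative_at_within[OF DERIV_power[OF DERIV_sin[of x], of "Suc p"]]
        has_field_derivative_at_within[OF DERIV_power[OF DERIV_cos[of x], of "Suc q"]] by simp_all
    from DERIV_cong[OF DERIV_mult[OF this], of "real (p + 1) * (sin x ^ p * cos x ^ (q + 2)) - real (q + 1) * (sin x ^ (p + 2) * cos x ^ q)"]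
    have "((\<lambda>\<phi>. sin \<phi> ^ (p + 1) * cos \<phi> ^ (q + 1)) has_real_derivative
        real (p + 1) * (sin x ^ p * cos x ^ (q + 2)) - real (q + 1) * (sin x ^ (p + 2) * cos x ^ q)) (at x within {0..pi / 2})"
      by (simp add: algebra_simps)
    then show "((\<lambda>\<phi>. sin \<phi> ^ (p + 1) * cos \<phi> ^ (q + 1)) has_vector_derivative
        real (p + 1) * (sin x ^ p * cos x ^ (q + 2)) - real (q + 1) * (sin x ^ (p + 2) * cos x ^ q)) (at x within {0..pi / 2})"
      by (simp only: has_real_derivative_iff_has_vector_derivative)
  qed simp
  then have "integral {0..pi / 2} (\<lambda>\<phi>. real (p + 1) * (sin \<phi> ^ p * cos \<phi> ^ (q + 2)) - real (q + 1) * (sin \<phi> ^ (p + 2) * cos \<phi> ^ q)) = 0"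
    by (simp add: integral_unique)
  then have "real (p + 1) * wallis p (q + 2) - real (q + 1) * wallis (p + 2) q = 0"
    unfolding wallis_def
    by (subst (asm) integral_diff) (use int in \<open>auto intro!: integrable_on_mult_right simp del: power_Suc of_nat_Suc of_nat_add\<close>)
  then show ?thesis by linarith
qed

text \<open>The recursion trades each \<open>sin^2\<close> for a \<open>cos^2\<close>. What remains
  in the last factor depends on \<open>s\<close> and \<open>r\<close> only through
  \<open>s + r\<close>, so it comes out of sums in which \<open>s + r\<close> is fixed.\<close>

lemma wallis_pochhammer:
  assumes "d > 0" "l > 0"
  shows "wallis (d - 1 + 2 * s) (l - 1 + 2 * r) = pochhammer (real d / 2) s * pochhammer (real l / 2) r *
    (wallis (d - 1) (l - 1 + 2 * (s + r)) / pochhammer (real l / 2) (s + r))"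
proof (induction s arbitrary: r)
  case 0
  have "pochhammer (real l / 2) r \<noteq> 0" using assms pochhammer_pos[of "real l / 2" r] by simp
  then show ?case by simp
next
  case (Suc s)
  have "real (l - 1 + 2 * r + 1) * wallis (d - 1 + 2 * s + 2) (l - 1 + 2 * r)
      = real (d - 1 + 2 * s + 1) * wallis (d - 1 + 2 * s) (l - 1 + 2 * r + 2)"
    by (rule wallis_rec)
  also have "real (l - 1 + 2 * r + 1) = 2 * (real l / 2 + real r)" using assms by (simp add: of_nat_diff)
  also have "real (d - 1 + 2 * s + 1) = 2 * (real d / 2 + real s)" using assms by (simp add: of_nat_diff)
  finally have eq: "(real l / 2 + real r) * wallis (d - 1 + 2 * Suc s) (l - 1 + 2 * r)
      = (real d / 2 + real s) * wallis (d - 1 + 2 * s) (l - 1 + 2 * Suc r)"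
    by (simp add: algebra_simps)
  have pos: "real l / 2 + real r > 0" using assms by simp
  define Y where "Y = wallis (d - 1) (l - 1 + 2 * (s + Suc r)) / pochhammer (real l / 2) (s + Suc r)"
  have IH: "wallis (d - 1 + 2 * s) (l - 1 + 2 * Suc r) = pochhammer (real d / 2) s * pochhammer (real l / 2) (Suc r) * Y"
    unfolding Y_def by (rule Suc.IH)
  have "(real l / 2 + real r) * wallis (d - 1 + 2 * Suc s) (l - 1 + 2 * r)
      = (real l / 2 + real r) * (pochhammer (real d / 2) (Suc s) * pochhammer (real l / 2) r * Y)"
    unfolding eq IH pochhammer_Suc by (simp only: mult_ac)
  then have "wallis (d - 1 + 2 * Suc s) (l - 1 + 2 * r) = pochhammer (real d / 2) (Suc s) * pochhammer (real l / 2) r * Y"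
    using pos by simp
  then show ?case unfolding Y_def by simp
qed

lemma alternating_binomial_sum_Suc:
  fixes f :: "nat \<Rightarrow> real"
  shows "(\<Sum>r\<le>Suc n. (-1) ^ r * real (Suc n choose r) * f r) =
    (\<Sum>r\<le>n. (-1) ^ r * real (n choose r) * (f r - f (Suc r)))"
proof -
  have "(\<Sum>r\<le>Suc n. (-1) ^ r * real (Suc n choose r) * f r) =
     f 0 + (\<Sum>r\<le>n. (-1) ^ Suc r * real (Suc n choose Suc r) * f (Suc r))"
    by (subst sum.atMost_Suc_shift) simp
  also have "(\<Sum>r\<le>n. (-1) ^ Suc r * real (Suc n choose Suc r) * f (Suc r)) =
     (\<Sum>r\<le>n. (-1) ^ Suc r * real (n choose Suc r) * f (Suc r)) - (\<Sum>r\<le>n. (-1) ^ r * real (n choose r) * f (Suc r))"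
    unfolding sum_subtractf[symmetric] by (intro sum.cong refl) (simp add: algebra_simps)
  also have "f 0 + ((\<Sum>r\<le>n. (-1) ^ Suc r * real (n choose Suc r) * f (Suc r)) - (\<Sum>r\<le>n. (-1) ^ r * real (n choose r) * f (Suc r)))
     = (\<Sum>r\<le>Suc n. (-1) ^ r * real (n choose r) * f r) - (\<Sum>r\<le>n. (-1) ^ r * real (n choose r) * f (Suc r))"
    unfolding sum.atMost_Suc_shift by simp
  also have "(\<Sum>r\<le>Suc n. (-1) ^ r * real (n choose r) * f r) = (\<Sum>r\<le>n. (-1) ^ r * real (n choose r) * f r)"
    by (simp add: binomial_eq_0)
  finally show ?thesis
    by (simp add: sum_subtractf[symmetric] right_diff_distrib)
qed

text \<open>An n-th finite difference annihilates polynomials of degree below \<open>n\<close>.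
  Rising factorials suit the induction: a first difference lowers the degree by one and shifts
  \<open>z\<close> by one.\<close>

lemma alternating_binomial_pochhammer:
  "j < n \<Longrightarrow> (\<Sum>r\<le>n. (-1) ^ r * real (n choose r) * pochhammer (z + real r) j) = 0"
proof (induction n arbitrary: j z)
  case (Suc n)
  show ?case
  proof (cases j)
    case 0
    then show ?thesis by (subst alternating_binomial_sum_Suc) simp
  next
    case (Suc i)
    have "pochhammer (z + real r) j - pochhammer (z + real (Suc r)) j = - real j * pochhammer (z + 1 + real r) i" for r
    proof -
      have "pochhammer (z + real r) j = (z + real r) * pochhammer (z + 1 + real r) i"
        by (simp add: Suc pochhammer_rec add_ac)
      moreover have "pochhammer (z + real (Suc r)) j = pochhammer (z + 1 + real r) i * (z + 1 + real r + real i)"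
        by (simp add: Suc pochhammer_Suc add_ac)
      ultimately show ?thesis by (simp add: Suc algebra_simps)
    qed
    then have "(\<Sum>r\<le>Suc n. (-1) ^ r * real (Suc n choose r) * pochhammer (z + real r) j) =
       (\<Sum>r\<le>n. - real j * ((-1) ^ r * real (n choose r) * pochhammer (z + 1 + real r) i))"
      by (subst alternating_binomial_sum_Suc) (simp add: mult_ac)
    also have "\<dots> = - real j * (\<Sum>r\<le>n. (-1) ^ r * real (n choose r) * pochhammer (z + 1 + real r) i)"
      by (rule sum_distrib_left[symmetric])
    also have "\<dots> = 0" using Suc.IH[of i "z + 1"] Suc.prems Suc by simp
    finally show ?thesis .
  qed
qed simp

text \<open>Combines a Jacobi coefficient with a Pochhammer symbol from the Beta integral; what
  depends on \<open>k\<close> is then only a factorial, and two of these make an ordinary binomial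
  coefficient.\<close>

lemma gbinomial_mult_pochhammer:
  fixes a :: real
  assumes "k \<le> n"
  shows "((real n + a) gchoose k) * pochhammer (a + 1) (n - k) = pochhammer (a + 1) n / fact k"
proof -
  have "(real n + a) gchoose k = pochhammer (a + 1 + real (n - k)) k / fact k"
    using assms by (simp add: gbinomial_pochhammer' of_nat_diff algebra_simps)
  moreover have "pochhammer (a + 1) n = pochhammer (a + 1) (n - k) * pochhammer (a + 1 + real (n - k)) k"
    using pochhammer_product[of "n - k" n "a + 1"] assms by simp
  ultimately show ?thesis by simp
qed

text \<open>Orthogonality of the Jacobi polynomial to \<open>(cos \<phi>)^(2 j)\<close>, written out
  term by term. All factors become constants except \<open>n choose (n - s)\<close>, a sign, and a
  rising factorial of degree \<open>j\<close> in \<open>n - s\<close>: a vanishing n-th finite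
  difference.\<close>

lemma wallis_jacobi_sum:
  assumes d: "d > 0" and l: "l > 0" and j: "j < n"
  defines "a \<equiv> real d / 2 - 1" and "b \<equiv> real l / 2 - 1"
  shows "(\<Sum>s\<le>n. ((real n + a) gchoose (n - s)) * ((real n + b) gchoose s) *
    ((-1) ^ s * wallis (d - 1 + 2 * s) (l - 1 + 2 * (n - s + j)))) = 0"
proof -
  define Y where "Y = wallis (d - 1) (l - 1 + 2 * (n + j)) / pochhammer (b + 1) (n + j)"
  define K where "K = pochhammer (a + 1) n * pochhammer (b + 1) n * Y / fact n"
  have a1: "a + 1 = real d / 2" "b + 1 = real l / 2" by (simp_all add: a_def b_def)
  have "(\<Sum>s\<le>n. ((real n + a) gchoose (n - s)) * ((real n + b) gchoose s) *
      ((-1) ^ s * wallis (d - 1 + 2 * s) (l - 1 + 2 * (n - s + j))))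
     = (\<Sum>s\<le>n. K * (-1) ^ n * ((-1) ^ (n - s) * real (n choose (n - s)) * pochhammer (b + 1 + real (n - s)) j))"
  proof (rule sum.cong[OF refl])
    fix s assume "s \<in> {..n}"
    then have s: "s \<le> n" by simp
    have W: "wallis (d - 1 + 2 * s) (l - 1 + 2 * (n - s + j)) = pochhammer (a + 1) s * pochhammer (b + 1) (n - s + j) * Y"
      using wallis_pochhammer[OF d l, of s "n - s + j"] s by (simp add: Y_def a1 add.assoc[symmetric])
    have P: "pochhammer (b + 1) (n - s + j) = pochhammer (b + 1) (n - s) * pochhammer (b + 1 + real (n - s)) j"
      using pochhammer_product[of "n - s" "n - s + j" "b + 1"] by simp
    have A: "((real n + a) gchoose (n - s)) * pochhammer (a + 1) s = pochhammer (a + 1) n / fact (n - s)"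
      using gbinomial_mult_pochhammer[of "n - s" n a] s by simp
    have B: "((real n + b) gchoose s) * pochhammer (b + 1) (n - s) = pochhammer (b + 1) n / fact s"
      using gbinomial_mult_pochhammer[of s n b] s by simp
    have sgn: "(-1::real) ^ n * (-1) ^ (n - s) = (-1) ^ s"
      using s by (simp add: power_add[symmetric] uminus_power_if)
    have C: "real (n choose (n - s)) = fact n / (fact s * fact (n - s))"
      using binomial_fact[of s n] s binomial_symmetric[of s n] by simp
    have "((real n + a) gchoose (n - s)) * ((real n + b) gchoose s) *
        ((-1) ^ s * wallis (d - 1 + 2 * s) (l - 1 + 2 * (n - s + j)))
       = (-1) ^ s * (((real n + a) gchoose (n - s)) * pochhammer (a + 1) s) *
         (((real n + b) gchoose s) * pochhammer (b + 1) (n - s)) * pochhammer (b + 1 + real (n - s)) j * Y"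
      unfolding W P by (simp only: mult_ac)
    also have "\<dots> = (-1) ^ s * (K * real (n choose (n - s))) * pochhammer (b + 1 + real (n - s)) j"
      unfolding A B C K_def by (simp add: mult_ac)
    also have "\<dots> = K * (-1) ^ n * ((-1) ^ (n - s) * real (n choose (n - s)) * pochhammer (b + 1 + real (n - s)) j)"
      unfolding sgn[symmetric] by (simp only: mult_ac)
    finally show "((real n + a) gchoose (n - s)) * ((real n + b) gchoose s) *
        ((-1) ^ s * wallis (d - 1 + 2 * s) (l - 1 + 2 * (n - s + j)))
       = K * (-1) ^ n * ((-1) ^ (n - s) * real (n choose (n - s)) * pochhammer (b + 1 + real (n - s)) j)" .
  qed
  also have "\<dots> = K * (-1) ^ n * (\<Sum>s\<le>n. (-1) ^ (n - s) * real (n choose (n - s)) * pochhammer (b + 1 + real (n - s)) j)"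
    by (rule sum_distrib_left[symmetric])
  also have "(\<Sum>s\<le>n. (-1) ^ (n - s) * real (n choose (n - s)) * pochhammer (b + 1 + real (n - s)) j)
     = (\<Sum>r\<le>n. (-1) ^ r * real (n choose r) * pochhammer (b + 1 + real r) j)"
    by (rule sum.reindex_bij_witness[where i = "\<lambda>r. n - r" and j = "\<lambda>r. n - r"]) auto
  also have "\<dots> = 0" by (rule alternating_binomial_pochhammer[OF j])
  finally show ?thesis by simp
qed

section \<open>Zonal functions as polynomials in the squared cosine of half the distance\<close>

definition zonal_profile :: "sym_space \<Rightarrow> nat \<Rightarrow> real \<Rightarrow> real" where
  "zonal_profile S n \<phi> = jacobi_poly n (sigma_par S) (tau_par S) (cos (2 * \<phi>))"

definition jacobi_coeff :: "sym_space \<Rightarrow> nat \<Rightarrow> nat \<Rightarrow> real" where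
  "jacobi_coeff S n s = ((real n + sigma_par S) gchoose (n - s)) * ((real n + tau_par S) gchoose s)"

lemma zonal_eq_profile: "zonal S n x = zonal_profile S n (geodist S (origin S) x / 2)"
  by (simp add: zonal_def zonal_profile_def)

text \<open>At \<open>x = cos (2 \<phi>)\<close> the factors \<open>(x - 1) / 2\<close> and
  \<open>(x + 1) / 2\<close> are \<open>- sin^2\<close> and \<open>cos^2\<close>, which is what the
  half distance is good for.\<close>

lemma zonal_profile_eq:
  "zonal_profile S n \<phi> = (\<Sum>s\<le>n. jacobi_coeff S n s * ((-1) ^ s * (sin \<phi> ^ (2 * s) * cos \<phi> ^ (2 * (n - s)))))"
proof -
  have "(cos (2 * \<phi>) - 1) / 2 = - ((sin \<phi>)\<^sup>2)" by (simp add: cos_double_sin)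
  moreover have "(cos (2 * \<phi>) + 1) / 2 = (cos \<phi>)\<^sup>2" by (simp add: cos_double_cos)
  ultimately show ?thesis
    unfolding zonal_profile_def jacobi_poly_def jacobi_coeff_def power_mult
    by (intro sum.cong) (simp_all add: power_minus[of "_ ^ 2"] mult_ac)
qed

lemma continuous_on_zonal_profile [continuous_intros]: "continuous_on A (zonal_profile S n)"
  unfolding zonal_profile_eq[abs_def] by (intro continuous_intros)

lemma sigma_tau_par:
  "admissible S \<Longrightarrow> sigma_par S = real (sdim S) / 2 - 1 \<and> tau_par S = real (line_dim S) / 2 - 1"
  by (cases S) (auto simp: sigma_par_def field_simps)

text \<open>Both parameters exceed -1, though they may be negative. Positivity excludes cancellation
  in the leading coefficient.\<close>

lemma jacobi_coeff_pos:
  assumes "admissible S" "s \<le> n"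
  shows "jacobi_coeff S n s > 0"
proof -
  have pos: "((real n + a) gchoose k) > 0" if "a > -1" "k \<le> n" for a k
  proof -
    have "((real n + a) gchoose k) * pochhammer (a + 1) (n - k) > 0"
      unfolding gbinomial_mult_pochhammer[OF that(2)] using that by (simp add: pochhammer_pos)
    moreover have "pochhammer (a + 1) (n - k) > 0" using that by (simp add: pochhammer_pos)
    ultimately show ?thesis by (simp add: zero_less_mult_iff)
  qed
  have "sigma_par S > -1" "tau_par S > -1"
    using sigma_tau_par[OF assms(1)] line_dim_le[OF assms(1)] by auto
  then show ?thesis
    unfolding jacobi_coeff_def using assms(2) by (intro mult_pos_pos pos) auto
qed

lemma zonal_profile_orthogonal_power:
  assumes S: "admissible S" and j: "j < n"
  shows "radial_mean S (\<lambda>\<phi>. ((cos \<phi>)\<^sup>2) ^ j * zonal_profile S n \<phi>) = 0"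
proof -
  let ?d = "sdim S" and ?l = "line_dim S"
  have int: "(\<lambda>\<phi>::real. sin \<phi> ^ p' * cos \<phi> ^ q') integrable_on {0..pi / 2}" for p' q'
    by (intro integrable_continuous_interval continuous_intros)
  have "polar_weight S \<phi> * (((cos \<phi>)\<^sup>2) ^ j * zonal_profile S n \<phi>) =
     (\<Sum>s\<le>n. jacobi_coeff S n s * (-1) ^ s * (sin \<phi> ^ (?d - 1 + 2 * s) * cos \<phi> ^ (?l - 1 + 2 * (n - s + j))))" for \<phi>
    unfolding zonal_profile_eq polar_weight_def sum_distrib_left power_mult[symmetric]
    by (intro sum.cong refl) (simp only: power_add power_mult distrib_left mult_ac)
  then have "integral {0..pi / 2} (\<lambda>\<phi>. polar_weight S \<phi> * (((cos \<phi>)\<^sup>2) ^ j * zonal_profile S n \<phi>)) =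
     (\<Sum>s\<le>n. jacobi_coeff S n s * (-1) ^ s * wallis (?d - 1 + 2 * s) (?l - 1 + 2 * (n - s + j)))"
    unfolding wallis_def using int by (simp add: integral_sum integrable_on_mult_right)
  also have "\<dots> = 0"
    using wallis_jacobi_sum[of ?d ?l j n] line_dim_le[OF S] sigma_tau_par[OF S] j
    by (simp add: jacobi_coeff_def mult.assoc)
  finally show ?thesis
    by (subst radial_mean_eq[OF S]) (auto intro!: continuous_intros)
qed

text \<open>The degree condition is put on coefficients, the form in which the cancellation of two
  leading terms is available later.\<close>

lemma zonal_profile_orthogonal_poly:
  assumes S: "admissible S" and q: "\<And>i. i \<ge> n \<Longrightarrow> Polynomial.coeff q i = 0"
  shows "radial_mean S (\<lambda>\<phi>. poly q ((cos \<phi>)\<^sup>2) * zonal_profile S n \<phi>) = 0"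
proof -
  have deg: "i < n" if "i \<le> degree q" "Polynomial.coeff q i \<noteq> 0" for i
    using q[of i] that by (meson not_le)
  have "poly q ((cos \<phi>)\<^sup>2) * zonal_profile S n \<phi> =
      (\<Sum>i\<le>degree q. Polynomial.coeff q i * (((cos \<phi>)\<^sup>2) ^ i * zonal_profile S n \<phi>))" for \<phi>
    by (simp add: poly_altdef sum_distrib_right mult.assoc)
  then have "radial_mean S (\<lambda>\<phi>. poly q ((cos \<phi>)\<^sup>2) * zonal_profile S n \<phi>) =
     (\<Sum>i\<le>degree q. radial_mean S (\<lambda>\<phi>. Polynomial.coeff q i * (((cos \<phi>)\<^sup>2) ^ i * zonal_profile S n \<phi>)))"
    by (simp only:) (intro radial_mean_sum[OF S] continuous_intros)
  also have "\<dots> = 0"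
  proof (rule sum.neutral, rule ballI)
    fix i assume "i \<in> {..degree q}"
    then show "radial_mean S (\<lambda>\<phi>. Polynomial.coeff q i * (((cos \<phi>)\<^sup>2) ^ i * zonal_profile S n \<phi>)) = 0"
      unfolding radial_mean_cmult using deg[of i] zonal_profile_orthogonal_power[OF S, of i n] by auto
  qed
  finally show ?thesis .
qed

definition zonal_poly :: "sym_space \<Rightarrow> nat \<Rightarrow> real poly" where
  "zonal_poly S n = (\<Sum>s\<le>n. smult (jacobi_coeff S n s) ([:-1, 1:] ^ s * [:0, 1:] ^ (n - s)))"

text \<open>The leading coefficient in the variable \<open>y = cos^2 \<phi>\<close>: every
  \<open>(y - 1)^s y^(n - s)\<close> is monic of degree \<open>n\<close>, so no signs occur.\<close>

definition zonal_lead :: "sym_space \<Rightarrow> nat \<Rightarrow> real" where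
  "zonal_lead S n = (\<Sum>s\<le>n. jacobi_coeff S n s)"

lemma zonal_lead_pos: "admissible S \<Longrightarrow> zonal_lead S n > 0"
  unfolding zonal_lead_def by (intro sum_pos jacobi_coeff_pos) auto

lemma poly_zonal_poly: "poly (zonal_poly S n) ((cos \<phi>)\<^sup>2) = zonal_profile S n \<phi>"
proof -
  have "(cos \<phi>)\<^sup>2 - 1 = - ((sin \<phi>)\<^sup>2)" by (simp add: sin_squared_eq)
  then show ?thesis
    unfolding zonal_profile_eq zonal_poly_def poly_sum power_mult
    by (intro sum.cong refl) (simp add: power_minus[of "_ ^ 2"])
qed

lemma coeff_zonal_poly:
  shows "i > n \<Longrightarrow> Polynomial.coeff (zonal_poly S n) i = 0" and "Polynomial.coeff (zonal_poly S n) n = zonal_lead S n"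
proof -
  have deg: "degree ([:-1, 1:] ^ s * [:0, 1::real:] ^ (n - s)) = n" if "s \<le> n" for s
    using that by (simp add: degree_mult_eq degree_power_eq)
  have lc: "Polynomial.coeff ([:-1, 1:] ^ s * [:0, 1::real:] ^ (n - s)) n = 1" if "s \<le> n" for s
    using lead_coeff_mult[of "[:-1, 1:] ^ s" "[:0, 1::real:] ^ (n - s)"] deg[OF that]
    by (simp add: lead_coeff_power)
  show "Polynomial.coeff (zonal_poly S n) n = zonal_lead S n"
    unfolding zonal_poly_def zonal_lead_def coeff_sum coeff_smult
    by (intro sum.cong refl) (simp add: lc)
  show "Polynomial.coeff (zonal_poly S n) i = 0" if "i > n"
    unfolding zonal_poly_def coeff_sum coeff_smult
    using deg that by (intro sum.neutral) (auto simp: coeff_eq_0)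
qed

lemma zonal_profile_orthogonal:
  assumes "admissible S" "m \<noteq> n"
  shows "radial_mean S (\<lambda>\<phi>. zonal_profile S m \<phi> * zonal_profile S n \<phi>) = 0"
proof -
  have *: "radial_mean S (\<lambda>\<phi>. zonal_profile S m \<phi> * zonal_profile S n \<phi>) = 0" if "m < n" for m n
    unfolding poly_zonal_poly[of S m, symmetric]
    using coeff_zonal_poly(1)[of m _ S] that by (intro zonal_profile_orthogonal_poly[OF assms(1)]) auto
  show ?thesis
    using *[of m n] *[of n m] assms(2) by (cases "m < n") (auto simp: mult.commute)
qed

section \<open>Correlation of zonal functions with plane waves\<close>

definition trig_moment :: "nat \<Rightarrow> nat \<Rightarrow> nat \<Rightarrow> real" where
  "trig_moment i j k = integral {0..pi / 2} (\<lambda>\<phi>. sin \<phi> ^ (2 * i) * cos \<phi> ^ (2 * j) * cos (2 * real k * \<phi>))"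

lemma trig_moment_integrable:
  "(\<lambda>\<phi>. sin \<phi> ^ (2 * i) * cos \<phi> ^ (2 * j) * cos (2 * real k * \<phi>)) integrable_on {0..pi / 2}"
  by (intro integrable_continuous_interval continuous_intros)

lemma trig_moment_combine:
  assumes "\<And>\<phi>. sin \<phi> ^ (2 * i') * cos \<phi> ^ (2 * j') * cos (2 * real k' * \<phi>) =
      1 / 2 * (sin \<phi> ^ (2 * i) * cos \<phi> ^ (2 * j) * cos (2 * real k1 * \<phi>)) +
      c * (sin \<phi> ^ (2 * i) * cos \<phi> ^ (2 * j) * cos (2 * real k2 * \<phi>)) +
      c * (sin \<phi> ^ (2 * i) * cos \<phi> ^ (2 * j) * cos (2 * real k3 * \<phi>))"
  shows "trig_moment i' j' k' = 1 / 2 * trig_moment i j k1 + c * trig_moment i j k2 + c * trig_moment i j k3"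
proof -
  have int: "((\<lambda>\<phi>. sin \<phi> ^ (2 * i) * cos \<phi> ^ (2 * j) * cos (2 * real k * \<phi>)) has_integral trig_moment i j k) {0..pi / 2}" for k
    unfolding trig_moment_def by (rule integrable_integral[OF trig_moment_integrable])
  show ?thesis
    unfolding trig_moment_def[of i' j' k'] assms
    by (intro integral_unique has_integral_add has_integral_mult_right int)
qed

text \<open>A factor \<open>cos^2\<close> spreads the frequency index by at most one step, with
  outer weights 1/4; a factor \<open>sin^2\<close> does the same with -1/4. This is the origin of
  \<open>4 ^ (i + j)\<close> and of the sign \<open>(-1) ^ i\<close> in the closed form.\<close>

lemma trig_moment_Suc_cos:
  "trig_moment i (Suc j) (Suc k) =
    1 / 2 * trig_moment i j (Suc k) + 1 / 4 * trig_moment i j (k + 2) + 1 / 4 * trig_moment i j k"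
proof (rule trig_moment_combine)
  fix \<phi> :: real
  have *: "(cos \<phi>)\<^sup>2 * cos (2 * real (Suc k) * \<phi>) =
      1 / 2 * cos (2 * real (Suc k) * \<phi>) + 1 / 4 * cos (2 * real (k + 2) * \<phi>) + 1 / 4 * cos (2 * real k * \<phi>)"
  proof -
    have "cos (2 * \<phi>) * cos (2 * real (Suc k) * \<phi>) = 1 / 2 * cos (2 * real (k + 2) * \<phi>) + 1 / 2 * cos (2 * real k * \<phi>)"
      using cos_times_cos[of "2 * real (Suc k) * \<phi>" "2 * \<phi>"] by (simp add: algebra_simps)
    moreover have "(cos \<phi>)\<^sup>2 * cos (2 * real (Suc k) * \<phi>) =
        1 / 2 * cos (2 * real (Suc k) * \<phi>) + 1 / 2 * (cos (2 * \<phi>) * cos (2 * real (Suc k) * \<phi>))"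
      unfolding cos_double_cos[of \<phi>] by (simp add: field_simps)
    ultimately show ?thesis by linarith
  qed
  have "sin \<phi> ^ (2 * i) * cos \<phi> ^ (2 * Suc j) * cos (2 * real (Suc k) * \<phi>) =
      sin \<phi> ^ (2 * i) * cos \<phi> ^ (2 * j) * ((cos \<phi>)\<^sup>2 * cos (2 * real (Suc k) * \<phi>))"
    by (simp add: power2_eq_square mult_ac)
  then show "sin \<phi> ^ (2 * i) * cos \<phi> ^ (2 * Suc j) * cos (2 * real (Suc k) * \<phi>) =
      1 / 2 * (sin \<phi> ^ (2 * i) * cos \<phi> ^ (2 * j) * cos (2 * real (Suc k) * \<phi>)) +
      1 / 4 * (sin \<phi> ^ (2 * i) * cos \<phi> ^ (2 * j) * cos (2 * real (k + 2) * \<phi>)) +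
      1 / 4 * (sin \<phi> ^ (2 * i) * cos \<phi> ^ (2 * j) * cos (2 * real k * \<phi>))"
    unfolding * by (simp only: distrib_left mult_ac)
qed

lemma trig_moment_Suc_sin:
  "trig_moment (Suc i) j (Suc k) =
    1 / 2 * trig_moment i j (Suc k) + (- 1 / 4) * trig_moment i j (k + 2) + (- 1 / 4) * trig_moment i j k"
proof (rule trig_moment_combine)
  fix \<phi> :: real
  have *: "(sin \<phi>)\<^sup>2 * cos (2 * real (Suc k) * \<phi>) =
      1 / 2 * cos (2 * real (Suc k) * \<phi>) + (- 1 / 4) * cos (2 * real (k + 2) * \<phi>) + (- 1 / 4) * cos (2 * real k * \<phi>)"
  proof -
    have "cos (2 * \<phi>) * cos (2 * real (Suc k) * \<phi>) = 1 / 2 * cos (2 * real (k + 2) * \<phi>) + 1 / 2 * cos (2 * real k * \<phi>)"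
      using cos_times_cos[of "2 * real (Suc k) * \<phi>" "2 * \<phi>"] by (simp add: algebra_simps)
    moreover have "(sin \<phi>)\<^sup>2 * cos (2 * real (Suc k) * \<phi>) =
        1 / 2 * cos (2 * real (Suc k) * \<phi>) - 1 / 2 * (cos (2 * \<phi>) * cos (2 * real (Suc k) * \<phi>))"
      unfolding cos_double_sin[of \<phi>] by (simp add: field_simps)
    ultimately show ?thesis by linarith
  qed
  have "sin \<phi> ^ (2 * Suc i) * cos \<phi> ^ (2 * j) * cos (2 * real (Suc k) * \<phi>) =
      sin \<phi> ^ (2 * i) * cos \<phi> ^ (2 * j) * ((sin \<phi>)\<^sup>2 * cos (2 * real (Suc k) * \<phi>))"
    by (simp add: power2_eq_square mult_ac)
  then show "sin \<phi> ^ (2 * Suc i) * cos \<phi> ^ (2 * j) * cos (2 * real (Suc k) * \<phi>) =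
      1 / 2 * (sin \<phi> ^ (2 * i) * cos \<phi> ^ (2 * j) * cos (2 * real (Suc k) * \<phi>)) +
      (- 1 / 4) * (sin \<phi> ^ (2 * i) * cos \<phi> ^ (2 * j) * cos (2 * real (k + 2) * \<phi>)) +
      (- 1 / 4) * (sin \<phi> ^ (2 * i) * cos \<phi> ^ (2 * j) * cos (2 * real k * \<phi>))"
    unfolding * by (simp only: distrib_left mult_ac)
qed

lemma trig_moment_0: "trig_moment 0 0 k = (if k = 0 then pi / 2 else 0)"
proof (cases "k = 0")
  case False
  have "((\<lambda>\<phi>. cos (2 * real k * \<phi>)) has_integral
      sin (2 * real k * (pi / 2)) / (2 * real k) - sin (2 * real k * 0) / (2 * real k)) {0..pi / 2}"
    using False
    by (intro fundamental_theorem_of_calculus)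
       (auto intro!: derivative_eq_intros simp: has_real_derivative_iff_has_vector_derivative[symmetric])
  then show ?thesis
    using False by (simp add: trig_moment_def integral_unique)
qed (simp add: trig_moment_def)

text \<open>\<open>sin\<^sup>2\<^sup>i cos\<^sup>2\<^sup>j\<close> is a cosine polynomial whose top frequency is \<open>2(i+j)\<close>.\<close>

lemma trig_moment_eq:
  "i + j \<le> k \<Longrightarrow> trig_moment i j k = (if k = i + j then (-1) ^ i / 4 ^ (i + j) * (pi / 2) else 0)"
proof (induction i arbitrary: j k)
  case 0
  then show ?case
  proof (induction j arbitrary: k)
    case 0
    then show ?case by (simp add: trig_moment_0)
  next
    case (Suc j)
    then obtain k' where k: "k = Suc k'" by (cases k) auto
    \<comment> \<open>Since \<open>j \<le> k'\<close>, only the lowest of the three frequencies can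
      equal the top frequency; the other two lie above it.\<close>
    have "trig_moment 0 j (Suc k') = 0" "trig_moment 0 j (k' + 2) = 0"
      and "trig_moment 0 j k' = (if k' = j then 1 / 4 ^ j * (pi / 2) else 0)"
      using Suc.IH[of "Suc k'"] Suc.IH[of "k' + 2"] Suc.IH[of k'] Suc.prems k by simp_all
    then show ?case by (simp add: k trig_moment_Suc_cos)
  qed
next
  case (Suc i)
  then obtain k' where k: "k = Suc k'" by (cases k) auto
  have "trig_moment i j (Suc k') = 0" "trig_moment i j (k' + 2) = 0"
    and "trig_moment i j k' = (if k' = i + j then (-1) ^ i / 4 ^ (i + j) * (pi / 2) else 0)"
    using Suc.IH[of j "Suc k'"] Suc.IH[of j "k' + 2"] Suc.IH[of j k'] Suc.prems k by simp_all
  then show ?case by (simp add: k trig_moment_Suc_sin)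
qed

text \<open>The exponents are \<open>2d - (d - 1)\<close> and \<open>2d - (l - 1)\<close>; the
  subtraction is exact since \<open>l \<le> d\<close>. After multiplication by the volume density
  the exponents are even, so that the product is a cosine polynomial in
  \<open>2 \<phi>\<close>.\<close>

definition probe :: "sym_space \<Rightarrow> real \<Rightarrow> real" where
  "probe S \<phi> = sin \<phi> ^ (sdim S + 1) * cos \<phi> ^ (2 * sdim S + 1 - line_dim S)"

lemma continuous_on_probe [continuous_intros]: "continuous_on A (probe S)"
  unfolding probe_def[abs_def] by (intro continuous_intros)

lemma abs_probe_le_1: "\<bar>probe S \<phi>\<bar> \<le> 1"
  unfolding probe_def abs_mult power_abs
  by (intro mult_le_one power_le_one zero_le_power abs_ge_zero abs_sin_le_one abs_cos_le_one)

lemma polar_weight_probe: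
  assumes "admissible S"
  shows "polar_weight S \<phi> * probe S \<phi> = sin \<phi> ^ (2 * sdim S) * cos \<phi> ^ (2 * sdim S)"
proof -
  have *: "sdim S - 1 + (sdim S + 1) = 2 * sdim S"
    "line_dim S - 1 + (2 * sdim S + 1 - line_dim S) = 2 * sdim S"
    using line_dim_le[OF assms] by auto
  have "polar_weight S \<phi> * probe S \<phi> = (sin \<phi> ^ (sdim S - 1) * sin \<phi> ^ (sdim S + 1)) *
      (cos \<phi> ^ (line_dim S - 1) * cos \<phi> ^ (2 * sdim S + 1 - line_dim S))"
    by (simp only: polar_weight_def probe_def mult_ac)
  then show ?thesis by (simp only: power_add[symmetric] *)
qed

text \<open>Every term of the weighted profile has total exponent \<open>2 (n + 2d)\<close>, so each
  moment is the extremal one. Its sign \<open>(-1) ^ (d + s)\<close> meets the sign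
  \<open>(-1) ^ s\<close> of the profile; all terms get the sign \<open>(-1) ^ d\<close> and the
  coefficients simply add to \<open>zonal_lead\<close>.\<close>

lemma zonal_profile_correlation:
  assumes S: "admissible S"
  shows "radial_mean S (\<lambda>\<phi>. probe S \<phi> * (cos (2 * real (n + 2 * sdim S) * \<phi>) * zonal_profile S n \<phi>))
    = (-1) ^ sdim S * (zonal_lead S n / 4 ^ (n + 2 * sdim S) * (pi / 2) / polar_mass S)"
proof -
  let ?m = "sdim S" and ?k = "n + 2 * sdim S"
  have "polar_weight S \<phi> * (probe S \<phi> * (cos (2 * real ?k * \<phi>) * zonal_profile S n \<phi>)) =
     (\<Sum>s\<le>n. (jacobi_coeff S n s * (-1) ^ s) *
        (sin \<phi> ^ (2 * (?m + s)) * cos \<phi> ^ (2 * (?m + (n - s))) * cos (2 * real ?k * \<phi>)))" for \<phi>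
  proof -
    have "polar_weight S \<phi> * (probe S \<phi> * (cos (2 * real ?k * \<phi>) * zonal_profile S n \<phi>)) =
      (polar_weight S \<phi> * probe S \<phi>) * cos (2 * real ?k * \<phi>) * zonal_profile S n \<phi>"
      by (simp only: mult_ac)
    also have "\<dots> = (\<Sum>s\<le>n. (jacobi_coeff S n s * (-1) ^ s) *
        (sin \<phi> ^ (2 * (?m + s)) * cos \<phi> ^ (2 * (?m + (n - s))) * cos (2 * real ?k * \<phi>)))"
      unfolding polar_weight_probe[OF S] zonal_profile_eq sum_distrib_left
      by (intro sum.cong refl) (simp only: power_add distrib_left mult_ac)
    finally show ?thesis .
  qed
  then have "integral {0..pi / 2} (\<lambda>\<phi>. polar_weight S \<phi> * (probe S \<phi> * (cos (2 * real ?k * \<phi>) * zonal_profile S n \<phi>)))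
    = integral {0..pi / 2} (\<lambda>\<phi>. \<Sum>s\<le>n. (jacobi_coeff S n s * (-1) ^ s) *
        (sin \<phi> ^ (2 * (?m + s)) * cos \<phi> ^ (2 * (?m + (n - s))) * cos (2 * real ?k * \<phi>)))"
    by (simp only:)
  also have "\<dots> = (\<Sum>s\<le>n. integral {0..pi / 2} (\<lambda>\<phi>. (jacobi_coeff S n s * (-1) ^ s) *
        (sin \<phi> ^ (2 * (?m + s)) * cos \<phi> ^ (2 * (?m + (n - s))) * cos (2 * real ?k * \<phi>))))"
    by (intro integral_sum integrable_on_mult_right trig_moment_integrable finite_atMost)
  also have "\<dots> = (\<Sum>s\<le>n. jacobi_coeff S n s * (-1) ^ s * trig_moment (?m + s) (?m + (n - s)) ?k)"
    unfolding trig_moment_def by (intro sum.cong refl integral_mult_right)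
  also have "\<dots> = (\<Sum>s\<le>n. jacobi_coeff S n s * ((-1) ^ ?m / 4 ^ ?k * (pi / 2)))"
  proof (intro sum.cong refl)
    fix s assume "s \<in> {..n}"
    then have k: "?m + s + (?m + (n - s)) = ?k" by simp
    have "(-1::real) ^ s * (-1) ^ (?m + s) = (-1) ^ ?m"
      by (simp add: power_add[symmetric] uminus_power_if)
    then have "(-1) ^ s * trig_moment (?m + s) (?m + (n - s)) ?k = (-1) ^ ?m / 4 ^ ?k * (pi / 2)"
      using trig_moment_eq[of "?m + s" "?m + (n - s)" ?k] unfolding k
      by (simp add: mult.assoc[symmetric] del: mult_minus1 mult_minus1_right)
    then show "jacobi_coeff S n s * (-1) ^ s * trig_moment (?m + s) (?m + (n - s)) ?k =
        jacobi_coeff S n s * ((-1) ^ ?m / 4 ^ ?k * (pi / 2))"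
      by (simp only: mult.assoc)
  qed
  also have "\<dots> = (-1) ^ ?m * (zonal_lead S n / 4 ^ ?k * (pi / 2))"
    unfolding sum_distrib_right[symmetric] zonal_lead_def[symmetric] by simp
  finally have "integral {0..pi / 2} (\<lambda>\<phi>. polar_weight S \<phi> * (probe S \<phi> * (cos (2 * real ?k * \<phi>) * zonal_profile S n \<phi>)))
     = (-1) ^ ?m * (zonal_lead S n / 4 ^ ?k * (pi / 2))" .
  then show ?thesis
    by (subst radial_mean_eq[OF S]) (auto intro!: continuous_intros)
qed

section \<open>Norms of zonal functions and comparison with Chebyshev polynomials\<close>

definition zonal_norm2 :: "sym_space \<Rightarrow> nat \<Rightarrow> real" where
  "zonal_norm2 S n = radial_mean S (\<lambda>\<phi>. (zonal_profile S n \<phi>)\<^sup>2)"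

text \<open>The arithmetic-geometric mean inequality in place of Cauchy-Schwarz. The choice of
  \<open>e\<close> as the \<open>L^2\<close> norm recovers the latter; leaving \<open>e\<close> free
  covers the situation where that norm is not yet known to be positive.\<close>

lemma radial_mean_abs_zonal_profile:
  assumes S: "admissible S" and e: "e > 0"
  shows "radial_mean S (\<lambda>\<phi>. \<bar>zonal_profile S n \<phi>\<bar>) \<le> e / 2 + zonal_norm2 S n / (2 * e)"
proof -
  have "radial_mean S (\<lambda>\<phi>. \<bar>zonal_profile S n \<phi>\<bar>) \<le>
      radial_mean S (\<lambda>\<phi>. e / 2 + 1 / (2 * e) * (zonal_profile S n \<phi>)\<^sup>2)"
  proof (rule radial_mean_mono[OF S])
    fix \<phi>
    have "0 \<le> (\<bar>zonal_profile S n \<phi>\<bar> - e)\<^sup>2" by simp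
    then have "2 * e * \<bar>zonal_profile S n \<phi>\<bar> \<le> e * e + (zonal_profile S n \<phi>)\<^sup>2"
      by (simp add: power2_diff power2_eq_square algebra_simps)
    then have "(2 * e * \<bar>zonal_profile S n \<phi>\<bar>) / (2 * e) \<le> (e * e + (zonal_profile S n \<phi>)\<^sup>2) / (2 * e)"
      using e by (intro divide_right_mono) auto
    then show "\<bar>zonal_profile S n \<phi>\<bar> \<le> e / 2 + 1 / (2 * e) * (zonal_profile S n \<phi>)\<^sup>2"
      using e by (simp add: add_divide_distrib)
  qed (intro continuous_intros)+
  also have "\<dots> = e / 2 + 1 / (2 * e) * zonal_norm2 S n"
    unfolding zonal_norm2_def radial_mean_cmult[symmetric]
    using e by (subst radial_mean_add[OF S]) (auto intro!: continuous_intros simp: radial_mean_const[OF S])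
  finally show ?thesis by simp
qed

lemma abs_radial_mean_le:
  assumes S: "admissible S" and F: "continuous_on UNIV F" and G: "continuous_on UNIV G"
    and le: "\<And>\<phi>. \<bar>F \<phi>\<bar> \<le> G \<phi>"
  shows "\<bar>radial_mean S F\<bar> \<le> radial_mean S G"
proof -
  have "radial_mean S F \<le> radial_mean S G"
    using le by (intro radial_mean_mono[OF S F G]) (smt (verit))
  moreover have "radial_mean S (\<lambda>\<phi>. - 1 * F \<phi>) \<le> radial_mean S G"
    using le by (intro radial_mean_mono[OF S _ G] continuous_intros F) (smt (verit))
  ultimately show ?thesis unfolding radial_mean_cmult by simp
qed

text \<open>A zero norm would force the \<open>L^1\<close> norm, hence the correlation with a
  bounded function, to vanish, but that correlation is an explicit nonzero number.\<close>

lemma zonal_norm2_pos: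
  assumes S: "admissible S"
  shows "zonal_norm2 S n > 0"
proof (rule ccontr)
  assume "\<not> zonal_norm2 S n > 0"
  define A where "A = radial_mean S (\<lambda>\<phi>. \<bar>zonal_profile S n \<phi>\<bar>)"
  have "A \<le> 0"
  proof (rule field_le_epsilon)
    fix e :: real assume e: "e > 0"
    have "zonal_norm2 S n / (2 * e) \<le> 0"
      using \<open>\<not> zonal_norm2 S n > 0\<close> e by (intro divide_nonpos_pos) auto
    then show "A \<le> 0 + e"
      using radial_mean_abs_zonal_profile[OF S e, of n] e by (simp add: A_def)
  qed
  have le: "\<bar>probe S \<phi> * (cos (2 * real (n + 2 * sdim S) * \<phi>) * zonal_profile S n \<phi>)\<bar> \<le> \<bar>zonal_profile S n \<phi>\<bar>" for \<phi>
  proof -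
    have "\<bar>probe S \<phi>\<bar> * \<bar>cos (2 * real (n + 2 * sdim S) * \<phi>)\<bar> \<le> 1"
      by (intro mult_le_one abs_probe_le_1 abs_cos_le_one) simp
    then show ?thesis
      unfolding abs_mult mult.assoc[symmetric] by (intro mult_left_le_one_le) auto
  qed
  have "\<bar>radial_mean S (\<lambda>\<phi>. probe S \<phi> * (cos (2 * real (n + 2 * sdim S) * \<phi>) * zonal_profile S n \<phi>))\<bar> \<le> A"
    unfolding A_def by (rule abs_radial_mean_le[OF S _ _ le]) (intro continuous_intros)+
  with \<open>A \<le> 0\<close> have "radial_mean S (\<lambda>\<phi>. probe S \<phi> * (cos (2 * real (n + 2 * sdim S) * \<phi>) * zonal_profile S n \<phi>)) = 0"
    by simp
  then show False
    unfolding zonal_profile_correlation[OF S] using zonal_lead_pos[OF S, of n] polar_mass_pos[of S] by simp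
qed

text \<open>This is the Chebyshev polynomial at \<open>2 y - 1\<close> with
  \<open>y = cos^2 \<phi>\<close>, built by the three-term recurrence. Its leading coefficient is
  \<open>2^(n-1) * 2^n\<close>, except for \<open>n = 0\<close>.\<close>

lemma chebyshev_poly_exists:
  "\<exists>T. (\<forall>i>n. Polynomial.coeff T i = 0) \<and> Polynomial.coeff T n = (if n = 0 then 1 else 4 ^ n / 2) \<and>
     (\<forall>\<phi>. poly T ((cos \<phi>)\<^sup>2) = cos (2 * real n * \<phi>))"
proof (induction n rule: less_induct)
  case (less n)
  consider "n = 0" | "n = 1" | k where "n = Suc (Suc k)"
    by (metis One_nat_def not0_implies_Suc)
  then show ?case
  proof cases
    case 1
    then show ?thesis by (intro exI[of _ 1]) (auto simp: coeff_eq_0)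
  next
    case 2
    have "\<forall>\<phi>. poly [:-1, 2::real:] ((cos \<phi>)\<^sup>2) = cos (2 * \<phi>)" by (simp add: cos_double_cos)
    with 2 show ?thesis by (intro exI[of _ "[:-1, 2::real:]"]) (auto simp: coeff_eq_0)
  next
    case 3
    obtain T where T: "\<forall>i>k. Polynomial.coeff T i = 0" "\<And>\<phi>. poly T ((cos \<phi>)\<^sup>2) = cos (2 * real k * \<phi>)"
      using less.IH[of k] 3 by auto
    obtain T' where T': "\<forall>i>Suc k. Polynomial.coeff T' i = 0" "Polynomial.coeff T' (Suc k) = 4 ^ Suc k / 2"
      "\<And>\<phi>. poly T' ((cos \<phi>)\<^sup>2) = cos (2 * real (Suc k) * \<phi>)"
      using less.IH[of "Suc k"] 3 by auto
    define R where "R = smult 2 ([:-1, 2:] * T') - T"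
    have coeff_R: "Polynomial.coeff R (Suc i) =
        2 * (2 * Polynomial.coeff T' i - Polynomial.coeff T' (Suc i)) - Polynomial.coeff T (Suc i)" for i
      by (simp add: R_def)
    have "poly R ((cos \<phi>)\<^sup>2) = cos (2 * real n * \<phi>)" for \<phi>
    proof -
      have "cos (2 * real n * \<phi>) + cos (2 * real k * \<phi>) = 2 * (cos (2 * \<phi>) * cos (2 * real (Suc k) * \<phi>))"
        using cos_times_cos[of "2 * real (Suc k) * \<phi>" "2 * \<phi>"] 3 by (simp add: algebra_simps)
      moreover have "poly R ((cos \<phi>)\<^sup>2) = 2 * ((2 * (cos \<phi>)\<^sup>2 - 1) * cos (2 * real (Suc k) * \<phi>)) - cos (2 * real k * \<phi>)"
        by (simp add: R_def T T' algebra_simps)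
      ultimately show ?thesis unfolding cos_double_cos[of \<phi>] by linarith
    qed
    moreover have "Polynomial.coeff R i = 0" if "i > n" for i
      using that 3 T T' coeff_R[of "i - 1"] by simp
    moreover have "Polynomial.coeff R n = 4 ^ n / 2"
      using 3 T T' coeff_R[of "Suc k"] by simp
    ultimately show ?thesis using 3 by (intro exI[of _ R]) auto
  qed
qed

text \<open>The multiple \<open>\<kappa> T\<^sub>n\<close> of the Chebyshev polynomial with the same leading coefficient as
  \<open>P\<^sub>n\<close> differs from \<open>P\<^sub>n\<close> by a polynomial orthogonal to \<open>P\<^sub>n\<close>, so the squared norm of
  \<open>P\<^sub>n\<close> is \<open>\<kappa>\<close> times the scalar product of \<open>T\<^sub>n\<close> and \<open>P\<^sub>n\<close>, where \<open>\<bar>T\<^sub>n\<bar> \<le> 1\<close>.\<close>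

lemma sqrt_zonal_norm2_le:
  assumes S: "admissible S" and n: "n \<ge> 1"
  shows "sqrt (zonal_norm2 S n) \<le> 2 / 4 ^ n * zonal_lead S n"
proof -
  obtain T where T: "\<forall>i>n. Polynomial.coeff T i = 0" "Polynomial.coeff T n = 4 ^ n / 2"
      "\<And>\<phi>. poly T ((cos \<phi>)\<^sup>2) = cos (2 * real n * \<phi>)"
    using chebyshev_poly_exists[of n] n by auto
  define \<kappa> where "\<kappa> = 2 / 4 ^ n * zonal_lead S n"
  have \<kappa>: "\<kappa> > 0" using zonal_lead_pos[OF S, of n] by (simp add: \<kappa>_def)
  define q where "q = zonal_poly S n - smult \<kappa> T"
  define e where "e = sqrt (zonal_norm2 S n)"
  have e: "e > 0" "zonal_norm2 S n = e * e"
    using zonal_norm2_pos[OF S, of n] by (simp_all add: e_def)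
  have "Polynomial.coeff q i = 0" if "i \<ge> n" for i
    using that coeff_zonal_poly(1)[of n i S] coeff_zonal_poly(2)[of S n] T by (cases "i = n") (auto simp: q_def \<kappa>_def field_simps)
  then have "radial_mean S (\<lambda>\<phi>. poly q ((cos \<phi>)\<^sup>2) * zonal_profile S n \<phi>) = 0"
    by (rule zonal_profile_orthogonal_poly[OF S])
  moreover have "poly q ((cos \<phi>)\<^sup>2) * zonal_profile S n \<phi> =
      (zonal_profile S n \<phi>)\<^sup>2 - \<kappa> * (cos (2 * real n * \<phi>) * zonal_profile S n \<phi>)" for \<phi>
  proof -
    have "poly q ((cos \<phi>)\<^sup>2) = zonal_profile S n \<phi> - \<kappa> * cos (2 * real n * \<phi>)"
      by (simp add: q_def poly_zonal_poly T)
    then show ?thesis unfolding power2_eq_square[of "zonal_profile S n \<phi>"] by (simp only: left_diff_distrib mult.assoc)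
  qed
  ultimately have "radial_mean S (\<lambda>\<phi>. (zonal_profile S n \<phi>)\<^sup>2 - \<kappa> * (cos (2 * real n * \<phi>) * zonal_profile S n \<phi>)) = 0"
    by simp
  then have "zonal_norm2 S n = \<kappa> * radial_mean S (\<lambda>\<phi>. cos (2 * real n * \<phi>) * zonal_profile S n \<phi>)"
    by (subst (asm) radial_mean_diff[OF S])
       (auto intro!: continuous_intros simp: radial_mean_cmult zonal_norm2_def)
  also have "\<dots> \<le> \<kappa> * radial_mean S (\<lambda>\<phi>. \<bar>zonal_profile S n \<phi>\<bar>)"
  proof (rule mult_left_mono)
    have "\<bar>radial_mean S (\<lambda>\<phi>. cos (2 * real n * \<phi>) * zonal_profile S n \<phi>)\<bar> \<le> radial_mean S (\<lambda>\<phi>. \<bar>zonal_profile S n \<phi>\<bar>)"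
      by (rule abs_radial_mean_le[OF S])
         (auto intro!: continuous_intros mult_left_le_one_le simp: abs_mult)
    then show "radial_mean S (\<lambda>\<phi>. cos (2 * real n * \<phi>) * zonal_profile S n \<phi>) \<le> radial_mean S (\<lambda>\<phi>. \<bar>zonal_profile S n \<phi>\<bar>)"
      by simp
  qed (use \<kappa> in simp)
  \<comment> \<open>With \<open>e\<close> the \<open>L^2\<close> norm the right side is
    \<open>e\<close> itself; the chain becomes \<open>e^2 \<le> \<kappa> e\<close>.\<close>
  also have "radial_mean S (\<lambda>\<phi>. \<bar>zonal_profile S n \<phi>\<bar>) \<le> e / 2 + zonal_norm2 S n / (2 * e)"
    by (rule radial_mean_abs_zonal_profile[OF S e(1)])
  also have "e / 2 + zonal_norm2 S n / (2 * e) = e" using e by simp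
  finally have "e * e \<le> \<kappa> * e" using \<kappa> e by simp
  then have "e \<le> \<kappa>" using e(1) by (rule mult_right_le_imp_le)
  then show ?thesis by (simp only: e_def \<kappa>_def)
qed

section \<open>Normalized zonal functions and the uniform correlation bound\<close>

definition unit_profile :: "sym_space \<Rightarrow> nat \<Rightarrow> real \<Rightarrow> real" where
  "unit_profile S n \<phi> = zonal_profile S n \<phi> / sqrt (zonal_norm2 S n)"

lemma continuous_on_unit_profile [continuous_intros]: "continuous_on A (unit_profile S n)"
  unfolding unit_profile_def[abs_def] divide_inverse by (intro continuous_intros)

lemma zonal_normalized_eq: "zonal_normalized S n x = unit_profile S n (geodist S (origin S) x / 2)"
  by (simp add: zonal_normalized_def unit_profile_def zonal_norm2_def radial_mean_def zonal_eq_profile)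

lemma unit_profile_orthonormal:
  assumes S: "admissible S"
  shows "radial_mean S (\<lambda>\<phi>. unit_profile S m \<phi> * unit_profile S n \<phi>) = (if m = n then 1 else 0)"
proof -
  have "unit_profile S m \<phi> * unit_profile S n \<phi> =
      1 / (sqrt (zonal_norm2 S m) * sqrt (zonal_norm2 S n)) * (zonal_profile S m \<phi> * zonal_profile S n \<phi>)" for \<phi>
    by (simp add: unit_profile_def)
  then have "radial_mean S (\<lambda>\<phi>. unit_profile S m \<phi> * unit_profile S n \<phi>) =
      1 / (sqrt (zonal_norm2 S m) * sqrt (zonal_norm2 S n)) * radial_mean S (\<lambda>\<phi>. zonal_profile S m \<phi> * zonal_profile S n \<phi>)"
    by (simp only: radial_mean_cmult)
  then show ?thesis
    using zonal_profile_orthogonal[OF S, of m n] zonal_norm2_pos[OF S, of n]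
    by (auto simp: zonal_norm2_def power2_eq_square[symmetric])
qed

lemma radial_mean_abs_unit_profile:
  assumes S: "admissible S"
  shows "radial_mean S (\<lambda>\<phi>. \<bar>unit_profile S n \<phi>\<bar>) \<le> 1"
proof -
  define e where "e = sqrt (zonal_norm2 S n)"
  have e: "e > 0" "zonal_norm2 S n = e * e"
    using zonal_norm2_pos[OF S, of n] by (simp_all add: e_def)
  have "radial_mean S (\<lambda>\<phi>. \<bar>unit_profile S n \<phi>\<bar>) = 1 / e * radial_mean S (\<lambda>\<phi>. \<bar>zonal_profile S n \<phi>\<bar>)"
    unfolding radial_mean_cmult[symmetric] using e(1) by (simp add: unit_profile_def e_def[symmetric] abs_divide)
  also have "\<dots> \<le> 1 / e * (e / 2 + zonal_norm2 S n / (2 * e))"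
    using e by (intro mult_left_mono radial_mean_abs_zonal_profile[OF S]) auto
  also have "\<dots> = 1" using e by simp
  finally show ?thesis .
qed

text \<open>The exact correlation \<open>zonal_lead / 4^(n + 2d) * (pi / 2) / polar_mass\<close>,
  divided by the norm bound \<open>2 / 4^n * zonal_lead\<close>: every dependence on
  \<open>n\<close> cancels.\<close>

definition correlation_bound :: "sym_space \<Rightarrow> real" where
  "correlation_bound S = pi / (4 * 16 ^ sdim S * polar_mass S)"

lemma correlation_bound_pos: "correlation_bound S > 0"
  using polar_mass_pos[of S] by (simp add: correlation_bound_def)

text \<open>The restriction on \<open>n\<close> comes from the Chebyshev leading coefficient, which
  is \<open>4 ^ n / 2\<close> from \<open>n = 1\<close> on.\<close>

lemma unit_profile_correlation:
  assumes S: "admissible S" and n: "n \<ge> 1"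
  shows "correlation_bound S \<le>
    (-1) ^ sdim S * radial_mean S (\<lambda>\<phi>. probe S \<phi> * (cos (2 * real (n + 2 * sdim S) * \<phi>) * unit_profile S n \<phi>))"
proof -
  define e where "e = sqrt (zonal_norm2 S n)"
  have e: "e > 0" using zonal_norm2_pos[OF S, of n] by (simp add: e_def)
  have lead: "1 \<le> 1 / e * (2 / 4 ^ n * zonal_lead S n)"
    using sqrt_zonal_norm2_le[OF S n] e by (simp add: e_def[symmetric] field_simps)
  have four: "(4::real) ^ (n + 2 * sdim S) = 4 ^ n * 16 ^ sdim S"
    by (simp add: power_add power_mult)
  have "radial_mean S (\<lambda>\<phi>. probe S \<phi> * (cos (2 * real (n + 2 * sdim S) * \<phi>) * unit_profile S n \<phi>))
      = 1 / e * radial_mean S (\<lambda>\<phi>. probe S \<phi> * (cos (2 * real (n + 2 * sdim S) * \<phi>) * zonal_profile S n \<phi>))"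
    unfolding radial_mean_cmult[symmetric] by (simp add: unit_profile_def e_def[symmetric] mult_ac)
  also have "\<dots> = (-1) ^ sdim S * (1 / e * (2 / 4 ^ n * zonal_lead S n) * correlation_bound S)"
    unfolding zonal_profile_correlation[OF S] four by (simp add: correlation_bound_def mult_ac)
  finally have "(-1) ^ sdim S * radial_mean S (\<lambda>\<phi>. probe S \<phi> * (cos (2 * real (n + 2 * sdim S) * \<phi>) * unit_profile S n \<phi>))
      = 1 / e * (2 / 4 ^ n * zonal_lead S n) * correlation_bound S"
    by (simp add: mult.assoc[symmetric] power_add[symmetric])
  then show ?thesis
    using mult_right_mono[OF lead, of "correlation_bound S"] correlation_bound_pos[of S] by simp
qed

section \<open>The maximal function of a finite spectral sum\<close>

text \<open>The exceptional null sets of uncountably many times cannot be united, but rational times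
  suffice for a version \<open>v\<close> continuous in time. The first claim gives existence, so
  that a choice by SOME is meaningful; the second holds for whichever supremum was chosen.\<close>

lemma is_lattice_Sup_separable:
  fixes u v :: "real \<Rightarrow> 'a \<Rightarrow> ennreal"
  assumes ab: "a < b"
    and v_meas: "\<And>t. v t \<in> borel_measurable M"
    and eq: "\<And>t. t \<in> {a..<b} \<Longrightarrow> AE x in M. u t x = v t x"
    and cont: "\<And>x. continuous_on UNIV (\<lambda>t. v t x)"
  shows "is_lattice_Sup M {a..<b} u (\<lambda>x. SUP q\<in>\<rat> \<inter> {a..<b}. v q x)"
    and "is_lattice_Sup M {a..<b} u G \<Longrightarrow> AE x in M. \<forall>t\<in>{a..<b}. v t x \<le> G x"
proof -
  let ?Q = "\<rat> \<inter> {a..<b}"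
  have Q: "countable ?Q" by (simp add: countable_rat)
  have dense: "v t x \<le> c" if "t \<in> {a..<b}" "\<And>q. q \<in> ?Q \<Longrightarrow> v q x \<le> c" for t x c
  proof -
    have "closed {t. v t x \<le> c}" by (intro closed_Collect_le cont continuous_on_const)
    then have "closure ?Q \<subseteq> {t. v t x \<le> c}" using that(2) by (intro closure_minimal) auto
    moreover have "t \<in> closure ?Q"
      unfolding closure_approachable
    proof (intro allI impI)
      fix e :: real assume "e > 0"
      \<comment> \<open>Rationals approach \<open>t\<close> from the right, which stays inside the
        half-open interval even at \<open>t = a\<close>.\<close>
      then have "t < min (t + e) b" using that(1) by auto
      then obtain q where "q \<in> \<rat>" "t < q" "q < min (t + e) b" using Rats_dense_in_real by blast
      then show "\<exists>q\<in>?Q. dist q t < e" using that(1) by (intro bexI[of _ q]) (auto simp: dist_real_def)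
    qed
    ultimately show ?thesis by auto
  qed
  have above: "AE x in M. \<forall>t\<in>{a..<b}. v t x \<le> H x" if "\<forall>t\<in>{a..<b}. AE x in M. u t x \<le> H x" for H
  proof -
    have "AE x in M. v q x \<le> H x" if "q \<in> ?Q" for q
      using eq[of q] \<open>\<forall>t\<in>{a..<b}. AE x in M. u t x \<le> H x\<close>[rule_format, of q] that
      by (auto elim!: eventually_elim2)
    then have "AE x in M. \<forall>q\<in>?Q. v q x \<le> H x"
      using Q by (subst AE_ball_countable) auto
    then show ?thesis
      by eventually_elim (use dense in blast)
  qed
  show "is_lattice_Sup M {a..<b} u (\<lambda>x. SUP q\<in>?Q. v q x)"
    unfolding is_lattice_Sup_def
  proof (intro conjI ballI impI)
    show "(\<lambda>x. SUP q\<in>?Q. v q x) \<in> borel_measurable M"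
      using Q v_meas by (intro borel_measurable_SUP) auto
    show "AE x in M. u t x \<le> (SUP q\<in>?Q. v q x)" if "t \<in> {a..<b}" for t
      using eq[OF that]
    proof eventually_elim
      case (elim x)
      have "v t x \<le> (SUP q\<in>?Q. v q x)" by (rule dense[OF that]) (rule SUP_upper)
      with elim show ?case by simp
    qed
    show "AE x in M. (SUP q\<in>?Q. v q x) \<le> H x" if "\<forall>t\<in>{a..<b}. AE x in M. u t x \<le> H x" for H
      using above[OF that] by eventually_elim (auto intro!: SUP_least)
  qed
  show "AE x in M. \<forall>t\<in>{a..<b}. v t x \<le> G x" if "is_lattice_Sup M {a..<b} u G"
    using that by (intro above) (simp add: is_lattice_Sup_def)
qed

text \<open>Rests on the pointwise bound \<open>G \<le> A + A^(1 - p) G^p\<close>: where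
  \<open>G > A\<close>, the factor \<open>(G / A)^(p - 1)\<close> is at least 1. The loss of a
  factor 2 against Jensen's inequality is harmless.\<close>

lemma nn_integral_le_Lp_norm:
  assumes prob: "emeasure M (space M) = 1" and G [measurable]: "G \<in> borel_measurable M"
    and p: "p \<ge> 1" and A: "A > 0" and le: "Lp_norm M p G \<le> ennreal A"
  shows "(\<integral>\<^sup>+x. G x \<partial>M) \<le> ennreal (2 * A)"
proof -
  have powr_meas [measurable]: "(\<lambda>x. ennreal_powr (G x) p) \<in> borel_measurable M"
    unfolding ennreal_powr_def by measurable
  define J where "J = (\<integral>\<^sup>+x. ennreal_powr (G x) p \<partial>M)"
  have J1: "ennreal_powr J (1 / p) \<le> ennreal A" using le by (simp add: Lp_norm_def J_def)
  then have Jfin: "J \<noteq> \<infinity>" by (auto simp: ennreal_powr_def top_unique)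
  then obtain j where j: "J = ennreal j" "j \<ge> 0" by (cases J) auto
  have "j powr (1 / p) \<le> A" using J1 j A by (simp add: ennreal_powr_def)
  then have "(j powr (1 / p)) powr p \<le> A powr p" using p by (intro powr_mono2) auto
  then have jA: "j \<le> A powr p" using p j by (simp add: powr_powr)
  have pt: "G x \<le> ennreal A + ennreal (A powr (1 - p)) * ennreal_powr (G x) p" for x
  proof (cases "G x")
    case (real g)
    show ?thesis
    proof (cases "g \<le> A")
      case True
      then have "G x \<le> ennreal A" using real by (simp add: ennreal_leI)
      then show ?thesis by (rule order_trans) simp
    next
      case False
      then have g: "g > 0" "A \<le> g" using A by auto
      have "g = g powr (1 - p) * g powr p" using g by (simp add: powr_add[symmetric])
      also have "\<dots> \<le> A powr (1 - p) * g powr p"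
        using p g A by (intro mult_right_mono powr_mono2') auto
      finally have "G x \<le> ennreal (A powr (1 - p)) * ennreal_powr (G x) p"
        using real by (simp add: ennreal_powr_def ennreal_mult[symmetric] ennreal_leI)
      then show ?thesis by (rule order_trans) simp
    qed
  next
    case top
    then show ?thesis using A by (simp add: ennreal_powr_def ennreal_mult_top)
  qed
  have "(\<integral>\<^sup>+x. G x \<partial>M) \<le> (\<integral>\<^sup>+x. ennreal A + ennreal (A powr (1 - p)) * ennreal_powr (G x) p \<partial>M)"
    by (intro nn_integral_mono pt)
  also have "\<dots> = ennreal A + ennreal (A powr (1 - p)) * J"
    by (simp add: nn_integral_add nn_integral_cmult prob J_def)
  also have "\<dots> = ennreal (A + A powr (1 - p) * j)"
    using A j by (simp add: ennreal_mult ennreal_plus)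
  also have "\<dots> \<le> ennreal (2 * A)"
  proof (rule ennreal_leI)
    have "A powr (1 - p) * j \<le> A powr (1 - p) * A powr p" using jA by (intro mult_left_mono) auto
    also have "\<dots> = A" using A by (simp add: powr_add[symmetric])
    finally show "A + A powr (1 - p) * j \<le> 2 * A" by simp
  qed
  finally show ?thesis .
qed

section \<open>Evolution and maximal function of finite spectral sums\<close>

definition spectral_sum :: "sym_space \<Rightarrow> nat set \<Rightarrow> point \<Rightarrow> complex" where
  "spectral_sum S I x = (\<Sum>n\<in>I. complex_of_real (zonal_normalized S n x))"

text \<open>A representative of the evolution defined at every point and continuous in time, unlike
  the chosen \<open>evolution\<close>.\<close>

definition spectral_wave :: "sym_space \<Rightarrow> (real \<Rightarrow> real) \<Rightarrow> nat set \<Rightarrow> real \<Rightarrow> point \<Rightarrow> complex" where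
  "spectral_wave S \<psi> I t x =
     (\<Sum>n\<in>I. exp (- \<i> * complex_of_real (t * \<psi> (freq S n))) * complex_of_real (zonal_normalized S n x))"

lemma zonal_normalized_measurable:
  assumes "admissible S"
  shows "zonal_normalized S n \<in> borel_measurable (riem_measure S)"
proof -
  have [measurable]: "unit_profile S n \<in> borel_measurable borel"
    by (intro borel_measurable_continuous_onI continuous_intros)
  note [measurable] = geodist_origin_measurable[OF assms]
  show ?thesis unfolding zonal_normalized_eq[abs_def] by measurable
qed

lemma spectral_wave_measurable:
  "admissible S \<Longrightarrow> spectral_wave S \<psi> I t \<in> borel_measurable (riem_measure S)"
  unfolding spectral_wave_def[abs_def]
  using zonal_normalized_measurable[of S] by measurable

lemma coeff_spectral_sum:
  assumes S: "admissible S" and I: "finite I"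
  shows "coeff S (spectral_sum S I) n = of_bool (n \<in> I)"
proof -
  have "coeff S (spectral_sum S I) n =
     (\<integral>x. complex_of_real (\<Sum>m\<in>I. zonal_normalized S m x * zonal_normalized S n x) \<partial>riem_measure S)"
    unfolding coeff_def spectral_sum_def by (simp add: sum_distrib_right)
  also have "\<dots> = complex_of_real (\<integral>x. (\<Sum>m\<in>I. zonal_normalized S m x * zonal_normalized S n x) \<partial>riem_measure S)"
    by (rule integral_complex_of_real)
  also have "(\<integral>x. (\<Sum>m\<in>I. zonal_normalized S m x * zonal_normalized S n x) \<partial>riem_measure S) =
      radial_mean S (\<lambda>\<phi>. \<Sum>m\<in>I. unit_profile S m \<phi> * unit_profile S n \<phi>)"
    unfolding radial_mean_def zonal_normalized_eq ..
  also have "\<dots> = (\<Sum>m\<in>I. radial_mean S (\<lambda>\<phi>. unit_profile S m \<phi> * unit_profile S n \<phi>))"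
    by (intro radial_mean_sum[OF S] continuous_intros)
  also have "\<dots> = of_bool (n \<in> I)"
    unfolding unit_profile_orthonormal[OF S] using I by (simp add: sum.delta)
  finally show ?thesis by simp
qed

lemma spectral_sum_radial_L2:
  assumes S: "admissible S"
  shows "spectral_sum S I \<in> radial_L2 S"
proof -
  have "radial S (spectral_sum S I)"
    unfolding radial_def spectral_sum_def zonal_normalized_eq
    by (intro exI[of _ "\<lambda>\<theta>. \<Sum>n\<in>I. complex_of_real (unit_profile S n (\<theta> / 2))"]) simp
  moreover have "spectral_sum S I \<in> borel_measurable (riem_measure S)"
    unfolding spectral_sum_def[abs_def]
    using zonal_normalized_measurable[OF S] by measurable
  moreover have "integrable (riem_measure S) (\<lambda>x. (norm (spectral_sum S I x))\<^sup>2)"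
  proof -
    have "(norm (spectral_sum S I x))\<^sup>2 = (\<Sum>n\<in>I. unit_profile S n (geodist S (origin S) x / 2))\<^sup>2" for x
      unfolding spectral_sum_def zonal_normalized_eq of_real_sum[symmetric] norm_of_real by simp
    then show ?thesis
      using integrable_radial[OF S, of "\<lambda>\<phi>. (\<Sum>n\<in>I. unit_profile S n \<phi>)\<^sup>2"]
      by (simp add: continuous_intros)
  qed
  ultimately show ?thesis by (simp add: radial_L2_def)
qed

lemma spectral_sum_Sobolev:
  assumes S: "admissible S" and I: "finite I"
  shows "spectral_sum S I \<in> radial_Sobolev S \<alpha>"
    and "Sobolev_norm S \<alpha> (spectral_sum S I) = sqrt (\<Sum>n\<in>I. (1 + (freq S n)\<^sup>2) powr \<alpha>)"
proof -
  have fin: "\<And>n. n \<notin> I \<Longrightarrow> (1 + (freq S n)\<^sup>2) powr \<alpha> * (norm (coeff S (spectral_sum S I) n))\<^sup>2 = 0"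
    by (simp add: coeff_spectral_sum[OF S I])
  show "spectral_sum S I \<in> radial_Sobolev S \<alpha>"
    using spectral_sum_radial_L2[OF S, of I] summable_finite[OF I fin] by (simp add: radial_Sobolev_def)
  show "Sobolev_norm S \<alpha> (spectral_sum S I) = sqrt (\<Sum>n\<in>I. (1 + (freq S n)\<^sup>2) powr \<alpha>)"
    unfolding Sobolev_norm_def by (subst suminf_finite[OF I fin]) (simp_all add: coeff_spectral_sum[OF S I])
qed

text \<open>The partial sums are constant from some index on, so convergence to 0 means that a fixed
  integral vanishes. One direction gives existence, the other determines the chosen
  representative.\<close>

lemma is_evolution_spectral_sum:
  assumes S: "admissible S" and I: "finite I"
  shows "is_evolution S \<psi> t (spectral_sum S I) g \<longleftrightarrow>
    g \<in> borel_measurable (riem_measure S) \<and> (AE x in riem_measure S. g x = spectral_wave S \<psi> I t x)"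
proof (cases "g \<in> borel_measurable (riem_measure S)")
  case [measurable]: True
  note [measurable] = spectral_wave_measurable[OF S]
  let ?f = "spectral_sum S I"
  let ?E = "\<integral>\<^sup>+x. ennreal ((norm (g x - spectral_wave S \<psi> I t x))\<^sup>2) \<partial>riem_measure S"
  have partial: "(\<Sum>n<N. exp (- \<i> * complex_of_real (t * \<psi> (freq S n))) * coeff S ?f n * complex_of_real (zonal_normalized S n x))
      = spectral_wave S \<psi> I t x" if "I \<subseteq> {..<N}" for N x
  proof -
    have "(\<Sum>n<N. exp (- \<i> * complex_of_real (t * \<psi> (freq S n))) * coeff S ?f n * complex_of_real (zonal_normalized S n x))
       = (\<Sum>n\<in>I. exp (- \<i> * complex_of_real (t * \<psi> (freq S n))) * coeff S ?f n * complex_of_real (zonal_normalized S n x))"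
      using that by (intro sum.mono_neutral_right) (auto simp: coeff_spectral_sum[OF S I])
    then show ?thesis by (simp add: spectral_wave_def coeff_spectral_sum[OF S I])
  qed
  obtain N0 where N0: "I \<subseteq> {..<N0}" using I finite_nat_iff_bounded by auto
  have ev: "eventually (\<lambda>N. (\<integral>\<^sup>+x. ennreal ((norm (g x -
         (\<Sum>n<N. exp (- \<i> * complex_of_real (t * \<psi> (freq S n))) * coeff S ?f n
                  * complex_of_real (zonal_normalized S n x))))\<^sup>2) \<partial>riem_measure S) = ?E) sequentially"
    using eventually_ge_at_top[of N0]
  proof eventually_elim
    case (elim N)
    then have "I \<subseteq> {..<N}" using N0 by auto
    then show ?case by (simp only: partial)
  qed
  have "is_evolution S \<psi> t ?f g \<longleftrightarrow> ((\<lambda>N::nat. ?E) \<longlonglongrightarrow> 0)"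
    unfolding is_evolution_def using True tendsto_cong[OF ev, of 0] by simp
  also have "\<dots> \<longleftrightarrow> ?E = 0" by (rule LIMSEQ_const_iff)
  also have "\<dots> \<longleftrightarrow> (AE x in riem_measure S. g x = spectral_wave S \<psi> I t x)"
    by (subst nn_integral_0_iff_AE) (auto simp: ennreal_eq_0_iff)
  finally show ?thesis using True by simp
qed (simp add: is_evolution_def)

lemma evolution_spectral_sum:
  assumes S: "admissible S" and I: "finite I"
  shows "AE x in riem_measure S. evolution S \<psi> t (spectral_sum S I) x = spectral_wave S \<psi> I t x"
proof -
  have "is_evolution S \<psi> t (spectral_sum S I) (spectral_wave S \<psi> I t)"
    by (simp add: is_evolution_spectral_sum[OF S I] spectral_wave_measurable[OF S])
  then have "is_evolution S \<psi> t (spectral_sum S I) (evolution S \<psi> t (spectral_sum S I))"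
    unfolding evolution_def by (rule someI[of "is_evolution S \<psi> t (spectral_sum S I)"])
  then show ?thesis by (simp add: is_evolution_spectral_sum[OF S I])
qed

text \<open>The quantifier over \<open>t\<close> stands inside the almost-everywhere statement, so
  that \<open>t\<close> may be chosen depending on \<open>x\<close>.\<close>

lemma maximal_function_spectral_sum:
  assumes S: "admissible S" and I: "finite I"
  shows "maximal_function S \<psi> (spectral_sum S I) \<in> borel_measurable (riem_measure S)"
    and "AE x in riem_measure S. \<forall>t\<in>{0..<2 * pi}.
      ennreal (norm (spectral_wave S \<psi> I t x)) \<le> maximal_function S \<psi> (spectral_sum S I) x"
proof -
  let ?u = "\<lambda>t x. ennreal (norm (evolution S \<psi> t (spectral_sum S I) x))"
  let ?v = "\<lambda>t x. ennreal (norm (spectral_wave S \<psi> I t x))"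
  have meas: "?v t \<in> borel_measurable (riem_measure S)" for t
    using spectral_wave_measurable[OF S] by measurable
  have eq: "AE x in riem_measure S. ?u t x = ?v t x" for t
    using evolution_spectral_sum[OF S I, of \<psi> t] by eventually_elim simp
  have cont: "continuous_on UNIV (\<lambda>t. ?v t x)" for x
    unfolding spectral_wave_def by (intro continuous_on_ennreal continuous_intros)
  have "is_lattice_Sup (riem_measure S) {0..<2 * pi} ?u (maximal_function S \<psi> (spectral_sum S I))"
    unfolding maximal_function_def lattice_Sup_def
    by (rule someI[of "is_lattice_Sup (riem_measure S) {0..<2 * pi} ?u"],
        rule is_lattice_Sup_separable(1)[where v = ?v]) (use meas eq cont in auto)
  then show "maximal_function S \<psi> (spectral_sum S I) \<in> borel_measurable (riem_measure S)"
    and "AE x in riem_measure S. \<forall>t\<in>{0..<2 * pi}.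
      ennreal (norm (spectral_wave S \<psi> I t x)) \<le> maximal_function S \<psi> (spectral_sum S I) x"
    using is_lattice_Sup_separable(2)[where v = ?v and u = ?u and M = "riem_measure S"] meas eq cont
    by (auto simp: is_lattice_Sup_def)
qed

section \<open>The counterexample\<close>

lemma abs_cos_diff_le: "\<bar>cos x - cos y\<bar> \<le> \<bar>x - y\<bar>" for x y :: real
proof -
  have "\<bar>cos x - cos y\<bar> = 2 * \<bar>sin ((x + y) / 2)\<bar> * \<bar>sin ((y - x) / 2)\<bar>"
    by (simp add: cos_diff_cos abs_mult)
  also have "\<dots> \<le> 2 * 1 * \<bar>(y - x) / 2\<bar>"
    by (intro mult_mono abs_sin_x_le_abs_x) auto
  finally show ?thesis by simp
qed

text \<open>A bounded perturbation of \<open>r^2\<close> suffices because the times used are at most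
  \<open>pi / (2 N)\<close>: it moves each phase by a multiple of \<open>1 / N\<close>.\<close>

lemma dispersion_close_to_square:
  assumes "\<psi> = schroedinger \<or> \<psi> = boussinesq \<or> \<psi> = beam" and r: "r \<ge> 0"
  shows "\<bar>\<psi> r - r\<^sup>2\<bar> \<le> 1"
proof -
  have "r\<^sup>2 \<le> r * sqrt (1 + r\<^sup>2)" "r * sqrt (1 + r\<^sup>2) \<le> r\<^sup>2 + 1"
  proof -
    have "r \<le> sqrt (1 + r\<^sup>2)" by (rule real_le_rsqrt) simp
    then show "r\<^sup>2 \<le> r * sqrt (1 + r\<^sup>2)"
      using r by (simp add: power2_eq_square mult_left_mono)
    have "r * sqrt (1 + r\<^sup>2) = sqrt (r\<^sup>2 * (1 + r\<^sup>2))"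
      using r by (simp add: real_sqrt_mult)
    also have "\<dots> \<le> r\<^sup>2 + 1"
      by (rule real_le_lsqrt) (simp_all add: power2_eq_square algebra_simps)
    finally show "r * sqrt (1 + r\<^sup>2) \<le> r\<^sup>2 + 1" .
  qed
  moreover have "r\<^sup>2 \<le> sqrt (1 + r ^ 4)" "sqrt (1 + r ^ 4) \<le> r\<^sup>2 + 1"
    by (rule real_le_rsqrt, simp add: power_mult[symmetric])
       (rule real_le_lsqrt, simp_all add: power2_sum power_mult[symmetric])
  ultimately show ?thesis
    using assms(1) by (auto simp: schroedinger_def boussinesq_def beam_def)
qed

definition spectral_shift :: "sym_space \<Rightarrow> real" where
  "spectral_shift S = sigma_par S + tau_par S + 1"

text \<open>The shift is \<open>(d + l) / 2 - 1\<close> with \<open>l = line_dim S\<close>; it is 0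
  for the circle.\<close>

lemma spectral_shift_nonneg: "admissible S \<Longrightarrow> spectral_shift S \<ge> 0"
  using sigma_tau_par[of S] line_dim_le[of S] by (auto simp: spectral_shift_def)

lemma freq_squared: "admissible S \<Longrightarrow> (freq S n)\<^sup>2 = real n * (real n + spectral_shift S)"
  and freq_nonneg: "admissible S \<Longrightarrow> freq S n \<ge> 0"
  using spectral_shift_nonneg[of S] by (simp_all add: freq_def spectral_shift_def add.assoc)

text \<open>The phase error grows with \<open>\<phi>\<close>, so its bound is available only on the
  range of half the distance.\<close>

lemma radial_mean_mono_interval:
  assumes S: "admissible S" and F: "continuous_on UNIV F" and G: "continuous_on UNIV G"
    and le: "\<And>\<phi>. 0 \<le> \<phi> \<Longrightarrow> \<phi> \<le> pi / 2 \<Longrightarrow> F \<phi> \<le> G \<phi>"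
  shows "radial_mean S F \<le> radial_mean S G"
  unfolding radial_mean_def
proof (rule integral_mono_AE)
  show "AE x in riem_measure S. F (geodist S (origin S) x / 2) \<le> G (geodist S (origin S) x / 2)"
    using geodist_range[OF S] by eventually_elim (auto intro: le)
qed (use S F G integrable_radial in auto)

text \<open>Along the ray \<open>t = \<theta> / (2N)\<close> the phases \<open>t \<psi>(\<lambda>\<^sub>n)\<close> with \<open>N \<le> n < N + K\<close> are
  \<open>n \<theta>\<close> plus a function of \<open>\<theta>\<close> alone, up to an error of order \<open>K\<^sup>2 / N\<close>. As everywhere, \<open>\<phi> = \<theta> / 2\<close>.\<close>

lemma phase_close:
  assumes S: "admissible S" and \<psi>: "\<psi> = schroedinger \<or> \<psi> = boussinesq \<or> \<psi> = beam"
    and N: "N \<ge> 1" and k: "k < K" and \<phi>: "0 \<le> \<phi>" "\<phi> \<le> pi / 2"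
  defines "c \<equiv> spectral_shift S"
  shows "\<bar>\<phi> / real N * \<psi> (freq S (N + k)) - \<phi> * (c - real N - 4 * real (sdim S))
      - 2 * real (N + k + 2 * sdim S) * \<phi>\<bar> \<le> pi / 2 * ((2 + c) * (real K)\<^sup>2) / real N"
proof -
  have c: "c \<ge> 0" using spectral_shift_nonneg[OF S] by (simp add: c_def)
  define e where "e = \<psi> (freq S (N + k)) - (freq S (N + k))\<^sup>2"
  have e: "\<bar>e\<bar> \<le> 1"
    unfolding e_def by (rule dispersion_close_to_square[OF \<psi> freq_nonneg[OF S]])
  have psi: "\<psi> (freq S (N + k)) = (real N + real k) * (real N + real k + c) + e"
    by (simp add: e_def freq_squared[OF S] c_def)
  have N0: "real N > 0" using N by simp
  \<comment> \<open>\<open>(N + k)(N + k + c) / N = N + 2k + c + (k^2 + c k) / N\<close>.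
    Subtracting the wanted frequency \<open>2 (N + k + 2d)\<close> leaves \<open>c - N - 4d\<close>
    free of \<open>k\<close>: the common phase.\<close>
  have "\<phi> / real N * \<psi> (freq S (N + k)) - \<phi> * (c - real N - 4 * real (sdim S))
      - 2 * real (N + k + 2 * sdim S) * \<phi> = \<phi> * ((real k)\<^sup>2 + c * real k + e) / real N"
    unfolding psi using N0 by (simp add: field_simps power2_eq_square)
  also have "\<bar>\<dots>\<bar> = \<phi> * \<bar>(real k)\<^sup>2 + c * real k + e\<bar> / real N"
    using \<phi> by (simp add: abs_mult)
  also have "\<dots> \<le> pi / 2 * ((2 + c) * (real K)\<^sup>2) / real N"
  proof (intro divide_right_mono mult_mono)
    have K: "real k + 1 \<le> real K" using k by linarith
    have "(real k)\<^sup>2 + 1 \<le> (real k + 1)\<^sup>2" by (simp add: power2_sum)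
    also have "\<dots> \<le> (real K)\<^sup>2" using K by (intro power_mono) auto
    finally have k2: "(real k)\<^sup>2 + 1 \<le> (real K)\<^sup>2" .
    have "real k \<le> (real K)\<^sup>2"
      using k2 sum_squares_ge_zero[of "real k - 1" 0] by (simp add: power2_eq_square algebra_simps)
    then have "c * real k \<le> c * (real K)\<^sup>2" using c by (rule mult_left_mono)
    moreover have "0 \<le> c * real k" "0 \<le> (real K)\<^sup>2" "0 \<le> (real k)\<^sup>2" using c by simp_all
    ultimately show "\<bar>(real k)\<^sup>2 + c * real k + e\<bar> \<le> (2 + c) * (real K)\<^sup>2"
      using k2 e unfolding distrib_right by (intro abs_leI) linarith+
  qed (use \<phi> in auto)
  finally show ?thesis .
qed

text \<open>The wave at time \<open>\<phi> / N\<close>, freed of the common phase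
  \<open>\<Theta>\<close>, is tested against the bounded function \<open>h\<close>. Replacing each
  exact cosine \<open>\<gamma> n\<close> by the actual \<open>\<beta> n\<close> costs at most
  \<open>b / 2\<close>, since the unit profiles have \<open>L^1\<close> norm at most 1; of each
  correlation \<open>b\<close> at least half survives.\<close>

lemma maximal_function_lower_bound:
  assumes S: "admissible S" and \<psi>: "\<psi> = schroedinger \<or> \<psi> = boussinesq \<or> \<psi> = beam"
    and N: "N \<ge> 1"
    and small: "pi / 2 * ((2 + spectral_shift S) * (real K)\<^sup>2) / real N \<le> correlation_bound S / 2"
  shows "ennreal (real K * correlation_bound S / 2) \<le>
    (\<integral>\<^sup>+x. maximal_function S \<psi> (spectral_sum S {N..<N + K}) x \<partial>riem_measure S)"
proof -
  let ?I = "{N..<N + K}" and ?M = "riem_measure S"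
  let ?G = "maximal_function S \<psi> (spectral_sum S ?I)"
  define b where "b = correlation_bound S"
  define \<Theta> where "\<Theta> \<phi> = \<phi> * (spectral_shift S - real N - 4 * real (sdim S))" for \<phi>
  define \<beta> where "\<beta> n \<phi> = cos (\<Theta> \<phi> - \<phi> / real N * \<psi> (freq S n))" for n \<phi>
  define \<gamma> where "\<gamma> n \<phi> = cos (2 * real (n + 2 * sdim S) * \<phi>)" for n \<phi>
  \<comment> \<open>The sign makes all K correlations positive.\<close>
  define h where "h \<phi> = (-1) ^ sdim S * probe S \<phi>" for \<phi>
  define H where "H \<phi> = (\<Sum>n\<in>?I. h \<phi> * (\<beta> n \<phi> * unit_profile S n \<phi>))" for \<phi>
  have cont: "continuous_on UNIV \<Theta>" "\<And>n. continuous_on UNIV (\<beta> n)" "\<And>n. continuous_on UNIV (\<gamma> n)"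
    "continuous_on UNIV h"
    unfolding \<Theta>_def[abs_def] \<beta>_def[abs_def] \<gamma>_def[abs_def] h_def[abs_def] divide_inverse
    by (intro continuous_intros)+
  have contH: "continuous_on UNIV H"
    unfolding H_def[abs_def] by (intro continuous_intros cont)
  have h1: "\<bar>h \<phi>\<bar> \<le> 1" for \<phi>
    using abs_probe_le_1[of S \<phi>] by (simp add: h_def abs_mult power_abs)
  have term_bound: "b / 2 \<le> radial_mean S (\<lambda>\<phi>. h \<phi> * (\<beta> n \<phi> * unit_profile S n \<phi>))" if n: "n \<in> ?I" for n
  proof -
    obtain k where k: "n = N + k" "k < K"
      using n by (metis atLeastLessThan_iff le_iff_add nat_add_left_cancel_less)
    have close: "\<bar>\<gamma> n \<phi> - \<beta> n \<phi>\<bar> \<le> b / 2" if \<phi>: "0 \<le> \<phi>" "\<phi> \<le> pi / 2" for \<phi>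
    proof -
      have "\<beta> n \<phi> = cos (\<phi> / real N * \<psi> (freq S n) - \<Theta> \<phi>)"
        unfolding \<beta>_def by (subst cos_minus[symmetric]) simp
      then have "\<bar>\<gamma> n \<phi> - \<beta> n \<phi>\<bar> \<le> \<bar>\<phi> / real N * \<psi> (freq S n) - \<Theta> \<phi> - 2 * real (n + 2 * sdim S) * \<phi>\<bar>"
        using abs_cos_diff_le[of "2 * real (n + 2 * sdim S) * \<phi>" "\<phi> / real N * \<psi> (freq S n) - \<Theta> \<phi>"]
        unfolding \<gamma>_def by (simp only: abs_minus_commute)
      also have "\<dots> \<le> pi / 2 * ((2 + spectral_shift S) * (real K)\<^sup>2) / real N"
        unfolding \<Theta>_def k(1) by (rule phase_close[OF S \<psi> N k(2) \<phi>])
      also have "\<dots> \<le> b / 2" unfolding b_def by (rule small)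
      finally show ?thesis .
    qed
    have "radial_mean S (\<lambda>\<phi>. h \<phi> * (\<gamma> n \<phi> * unit_profile S n \<phi>) - h \<phi> * (\<beta> n \<phi> * unit_profile S n \<phi>))
        \<le> radial_mean S (\<lambda>\<phi>. b / 2 * \<bar>unit_profile S n \<phi>\<bar>)"
    proof (rule radial_mean_mono_interval[OF S])
      fix \<phi> :: real assume \<phi>: "0 \<le> \<phi>" "\<phi> \<le> pi / 2"
      have "h \<phi> * (\<gamma> n \<phi> * unit_profile S n \<phi>) - h \<phi> * (\<beta> n \<phi> * unit_profile S n \<phi>)
          = h \<phi> * (\<gamma> n \<phi> - \<beta> n \<phi>) * unit_profile S n \<phi>"
        by (simp add: algebra_simps)
      also have "\<dots> \<le> \<bar>h \<phi>\<bar> * \<bar>\<gamma> n \<phi> - \<beta> n \<phi>\<bar> * \<bar>unit_profile S n \<phi>\<bar>"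
        unfolding abs_mult[symmetric] by (rule abs_ge_self)
      also have "\<dots> \<le> 1 * (b / 2) * \<bar>unit_profile S n \<phi>\<bar>"
        using h1 close[OF \<phi>] by (intro mult_right_mono mult_mono) auto
      finally show "h \<phi> * (\<gamma> n \<phi> * unit_profile S n \<phi>) - h \<phi> * (\<beta> n \<phi> * unit_profile S n \<phi>)
          \<le> b / 2 * \<bar>unit_profile S n \<phi>\<bar>" by simp
    qed (intro continuous_intros cont)+
    also have "\<dots> \<le> b / 2 * 1"
      unfolding radial_mean_cmult
      using correlation_bound_pos[of S] by (intro mult_left_mono radial_mean_abs_unit_profile[OF S]) (simp add: b_def)
    finally have "radial_mean S (\<lambda>\<phi>. h \<phi> * (\<gamma> n \<phi> * unit_profile S n \<phi>))
        - radial_mean S (\<lambda>\<phi>. h \<phi> * (\<beta> n \<phi> * unit_profile S n \<phi>)) \<le> b / 2"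
      by (subst (asm) radial_mean_diff[OF S]) (auto intro!: continuous_intros cont)
    moreover have "b \<le> radial_mean S (\<lambda>\<phi>. h \<phi> * (\<gamma> n \<phi> * unit_profile S n \<phi>))"
      using unit_profile_correlation[OF S, of n] n N
      unfolding radial_mean_cmult[symmetric] by (simp add: h_def \<gamma>_def b_def mult.assoc)
    ultimately show ?thesis by linarith
  qed
  have "real K * b / 2 = (\<Sum>n\<in>?I. b / 2)" by simp
  also have "\<dots> \<le> (\<Sum>n\<in>?I. radial_mean S (\<lambda>\<phi>. h \<phi> * (\<beta> n \<phi> * unit_profile S n \<phi>)))"
    by (intro sum_mono term_bound)
  also have "\<dots> = radial_mean S H"
    unfolding H_def[abs_def] by (intro radial_mean_sum[OF S, symmetric] continuous_intros cont)
  \<comment> \<open>The positive part makes the passage to the nonnegative integral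
    possible.\<close>
  also have "\<dots> \<le> radial_mean S (\<lambda>\<phi>. max 0 (H \<phi>))"
    by (intro radial_mean_mono[OF S] continuous_intros contH) auto
  finally have lower: "real K * b / 2 \<le> radial_mean S (\<lambda>\<phi>. max 0 (H \<phi>))" .
  have wave: "max 0 (H (geodist S (origin S) x / 2)) \<le>
      norm (spectral_wave S \<psi> ?I (geodist S (origin S) x / 2 / real N) x)" for x
  proof -
    let ?\<phi> = "geodist S (origin S) x / 2"
    let ?w = "spectral_wave S \<psi> ?I (?\<phi> / real N) x"
    have "Re (cis (\<Theta> ?\<phi>) * ?w) = (\<Sum>n\<in>?I. \<beta> n ?\<phi> * unit_profile S n ?\<phi>)"
    proof -
      have "cis (\<Theta> ?\<phi>) * ?w = (\<Sum>n\<in>?I. cis (\<Theta> ?\<phi> - ?\<phi> / real N * \<psi> (freq S n)) * complex_of_real (unit_profile S n ?\<phi>))"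
        unfolding spectral_wave_def zonal_normalized_eq sum_distrib_left
      proof (intro sum.cong refl)
        have "cis a * (exp (- \<i> * complex_of_real b) * z) = cis (a - b) * z" for a b z
        proof -
          have "exp (- \<i> * complex_of_real b) = cis (- b)" by (simp add: cis_conv_exp)
          then show ?thesis using cis_mult[of a "- b"] by (simp add: mult.assoc[symmetric])
        qed
        then show "cis (\<Theta> ?\<phi>) * (exp (- \<i> * complex_of_real (?\<phi> / real N * \<psi> (freq S n))) * complex_of_real (unit_profile S n ?\<phi>))
            = cis (\<Theta> ?\<phi> - ?\<phi> / real N * \<psi> (freq S n)) * complex_of_real (unit_profile S n ?\<phi>)" for n .
      qed
      then show ?thesis by (simp add: \<beta>_def)
    qed
    then have "H ?\<phi> = h ?\<phi> * Re (cis (\<Theta> ?\<phi>) * ?w)"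
      by (simp only: H_def sum_distrib_left)
    also have "\<dots> \<le> \<bar>h ?\<phi>\<bar> * \<bar>Re (cis (\<Theta> ?\<phi>) * ?w)\<bar>"
      unfolding abs_mult[symmetric] by (rule abs_ge_self)
    also have "\<dots> \<le> 1 * norm (cis (\<Theta> ?\<phi>) * ?w)"
      by (intro mult_mono h1 abs_Re_le_cmod) auto
    finally show ?thesis by (simp add: norm_mult)
  qed
  have "ennreal (real K * b / 2) \<le> ennreal (radial_mean S (\<lambda>\<phi>. max 0 (H \<phi>)))"
    using lower by (rule ennreal_leI)
  also have "\<dots> = (\<integral>\<^sup>+x. ennreal (max 0 (H (geodist S (origin S) x / 2))) \<partial>?M)"
    unfolding radial_mean_def
    by (intro nn_integral_eq_integral[symmetric] integrable_radial[OF S, of "\<lambda>\<phi>. max 0 (H \<phi>)"] continuous_intros contH) auto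
  also have "\<dots> \<le> (\<integral>\<^sup>+x. ?G x \<partial>?M)"
  proof (rule nn_integral_mono_AE)
    show "AE x in ?M. ennreal (max 0 (H (geodist S (origin S) x / 2))) \<le> ?G x"
      using maximal_function_spectral_sum(2)[OF S, of ?I \<psi>, simplified] geodist_range[OF S]
    proof eventually_elim
      case (elim x)
      let ?t = "geodist S (origin S) x / 2 / real N"
      \<comment> \<open>As \<open>N \<ge> 1\<close>, the time is at most half the distance, hence at
        most \<open>pi / 2\<close> and inside the time interval.\<close>
      have "?t \<le> geodist S (origin S) x / 2 / 1"
        using elim(2) N by (intro divide_left_mono) auto
      also have "\<dots> < 2 * pi" using elim(2) pi_gt_zero by linarith
      finally have "?t \<in> {0..<2 * pi}" using elim(2) by simp
      then have "ennreal (norm (spectral_wave S \<psi> ?I ?t x)) \<le> ?G x"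
        using elim(1) by auto
      then show ?case using ennreal_leI[OF wave[of x]] by (rule order_trans[rotated])
    qed
  qed
  finally show ?thesis by (simp add: b_def)
qed

text \<open>With \<open>N = B * K^2\<close> the indices are at most \<open>(B + 1) K^2\<close>, so
  every squared frequency is of order \<open>K^4\<close>; \<open>K \<ge> 1\<close> absorbs the lower
  order terms into \<open>D\<close>.\<close>

lemma Sobolev_norm_window:
  assumes S: "admissible S" and \<alpha>: "\<alpha> \<ge> 0" and K: "K \<ge> 1" and B: "B \<ge> (1::nat)"
  defines "D \<equiv> 1 + (real B + 1) * (real B + 1 + spectral_shift S)"
  shows "(Sobolev_norm S \<alpha> (spectral_sum S {B * K\<^sup>2..<B * K\<^sup>2 + K}))\<^sup>2 \<le> real K * (D powr \<alpha> * real K powr (4 * \<alpha>))"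
proof -
  let ?I = "{B * K\<^sup>2..<B * K\<^sup>2 + K}" and ?c = "spectral_shift S"
  have c: "?c \<ge> 0" by (rule spectral_shift_nonneg[OF S])
  have K1: "real K \<ge> 1" using K by simp
  have D: "D \<ge> 0" using c by (simp add: D_def)
  have "(1 + (freq S n)\<^sup>2) powr \<alpha> \<le> D powr \<alpha> * real K powr (4 * \<alpha>)" if n: "n \<in> ?I" for n
  proof -
    have KK: "1 \<le> (real K)\<^sup>2" "real K \<le> (real K)\<^sup>2" "1 \<le> real K ^ 4"
      using K1 self_le_power[of "real K" 2] by simp_all
    have "real n \<le> real (B * K\<^sup>2 + K)" using n by (intro of_nat_mono) auto
    also have "\<dots> = real B * (real K)\<^sup>2 + real K" by simp
    also have "\<dots> \<le> (real B + 1) * (real K)\<^sup>2" using KK(2) unfolding distrib_right by linarith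
    finally have n': "real n \<le> (real B + 1) * (real K)\<^sup>2" .
    have "?c \<le> ?c * (real K)\<^sup>2" using mult_left_mono[OF KK(1) c] by simp
    then have nc: "real n + ?c \<le> (real B + 1 + ?c) * (real K)\<^sup>2"
      using n' by (simp add: algebra_simps)
    have "1 + (freq S n)\<^sup>2 \<le> real K ^ 4 + ((real B + 1) * (real K)\<^sup>2) * ((real B + 1 + ?c) * (real K)\<^sup>2)"
      unfolding freq_squared[OF S] using n' nc c KK by (intro add_mono mult_mono) auto
    also have "\<dots> = D * real K ^ 4" by (simp add: D_def algebra_simps eval_nat_numeral)
    finally have "(1 + (freq S n)\<^sup>2) powr \<alpha> \<le> (D * real K ^ 4) powr \<alpha>"
      using \<alpha> by (intro powr_mono2) auto
    also have "\<dots> = D powr \<alpha> * (real K ^ 4) powr \<alpha>"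
      using K1 D by (simp add: powr_mult)
    also have "real K ^ 4 = real K powr 4"
      using powr_realpow[of "real K" 4] K1 by simp
    also have "(real K powr 4) powr \<alpha> = real K powr (4 * \<alpha>)"
      by (rule powr_powr)
    finally show ?thesis .
  qed
  then have "(\<Sum>n\<in>?I. (1 + (freq S n)\<^sup>2) powr \<alpha>) \<le> real (card ?I) * (D powr \<alpha> * real K powr (4 * \<alpha>))"
    by (rule sum_bounded_above)
  moreover have "(Sobolev_norm S \<alpha> (spectral_sum S ?I))\<^sup>2 = (\<Sum>n\<in>?I. (1 + (freq S n)\<^sup>2) powr \<alpha>)"
    by (simp add: spectral_sum_Sobolev(2)[OF S] sum_nonneg)
  ultimately show ?thesis by simp
qed

theorem theorem1p6:
  fixes S :: sym_space and \<psi> :: "real \<Rightarrow> real" and \<alpha> p :: real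
  assumes "admissible S"
    and "\<psi> = schroedinger \<or> \<psi> = boussinesq \<or> \<psi> = beam"
    and "0 \<le> \<alpha>" and "\<alpha> < 1 / 4" and "p \<ge> 1"
  shows "\<not> (\<exists>C>0. \<forall>f\<in>radial_Sobolev S \<alpha>.
           Lp_norm (riem_measure S) p (maximal_function S \<psi> f)
             \<le> ennreal (C * Sobolev_norm S \<alpha> f))"
proof
  assume "\<exists>C>0. \<forall>f\<in>radial_Sobolev S \<alpha>.
           Lp_norm (riem_measure S) p (maximal_function S \<psi> f)
             \<le> ennreal (C * Sobolev_norm S \<alpha> f)"
  then obtain C where C: "C > 0" and bound: "\<And>f. f \<in> radial_Sobolev S \<alpha> \<Longrightarrow>
      Lp_norm (riem_measure S) p (maximal_function S \<psi> f) \<le> ennreal (C * Sobolev_norm S \<alpha> f)"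
    by blast
  note S = assms(1)
  define b c where "b = correlation_bound S" and "c = spectral_shift S"
  have b: "b > 0" by (simp add: b_def correlation_bound_pos)
  have c: "c \<ge> 0" by (simp add: c_def spectral_shift_nonneg[OF S])
  \<comment> \<open>With \<open>N = B * K^2\<close> the phase error is
    \<open>pi (2 + c) / (2 B)\<close>, which this makes at most \<open>b / 2\<close>; the successor
    secures \<open>B \<ge> 1\<close>.\<close>
  obtain B0 :: nat where B0: "pi * (2 + c) / b \<le> real B0" using real_arch_simple by blast
  define B where "B = Suc B0"
  have B: "B \<ge> 1" "pi * (2 + c) / b \<le> real B" using B0 by (auto simp: B_def)
  define D where "D = 1 + (real B + 1) * (real B + 1 + c)"
  \<comment> \<open>\<open>K b / 2 \<le> 2 C s\<close> gives \<open>K \<le> (4 C / b) s\<close>.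
    Squaring, inserting the bound for \<open>s^2\<close> and dividing by
    \<open>K^(1 + 4 \<alpha>)\<close> leaves \<open>E\<close>.\<close>
  define E where "E = (4 * C / b)\<^sup>2 * D powr \<alpha>"
  have "D > 0" using c by (simp add: D_def add_pos_nonneg)
  then have E: "E > 0" using C b by (simp add: E_def)
  have main: "real K powr (1 - 4 * \<alpha>) \<le> E" if K: "K \<ge> 1" for K :: nat
  proof -
    let ?N = "B * K\<^sup>2"
    let ?f = "spectral_sum S {?N..<?N + K}"
    define s where "s = Sobolev_norm S \<alpha> ?f"
    have K0: "real K > 0" using K by simp
    have N: "?N \<ge> 1" using B K by (simp add: Suc_le_eq)
    have small: "pi / 2 * ((2 + spectral_shift S) * (real K)\<^sup>2) / real ?N \<le> correlation_bound S / 2"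
    proof -
      have "pi / 2 * ((2 + c) * (real K)\<^sup>2) / real ?N = pi * (2 + c) / real B / 2"
        using K0 by simp
      also have "\<dots> \<le> b / 2"
        using B b by (simp add: field_simps)
      finally show ?thesis by (simp add: b_def c_def)
    qed
    have s_pos: "s > 0"
    proof -
      have pos: "0 < 1 + (freq S n)\<^sup>2" for n by (rule add_pos_nonneg) simp_all
      have "(1 + (freq S n)\<^sup>2) powr \<alpha> > 0" for n
        unfolding powr_gt_zero by (rule less_imp_neq[OF pos, symmetric])
      then have "0 < (\<Sum>n\<in>{?N..<?N + K}. (1 + (freq S n)\<^sup>2) powr \<alpha>)"
        using K by (intro sum_pos) auto
      then show ?thesis by (simp add: s_def spectral_sum_Sobolev(2)[OF S])
    qed
    have "ennreal (real K * b / 2) \<le> (\<integral>\<^sup>+x. maximal_function S \<psi> ?f x \<partial>riem_measure S)"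
      unfolding b_def by (rule maximal_function_lower_bound[OF S assms(2) N small])
    also have "\<dots> \<le> ennreal (2 * (C * s))"
    proof (rule nn_integral_le_Lp_norm)
      show "emeasure (riem_measure S) (space (riem_measure S)) = 1"
        by (simp add: emeasure_riem_measure_space[OF S])
      show "Lp_norm (riem_measure S) p (maximal_function S \<psi> ?f) \<le> ennreal (C * s)"
        unfolding s_def by (intro bound spectral_sum_Sobolev(1)[OF S]) simp
    qed (use assms(5) C s_pos maximal_function_spectral_sum(1)[OF S] in auto)
    finally have "real K * b / 2 \<le> 2 * (C * s)"
      using C s_pos by (subst (asm) ennreal_le_iff) auto
    then have "real K \<le> 4 * C / b * s" using b by (simp add: field_simps)
    then have "(real K)\<^sup>2 \<le> (4 * C / b * s)\<^sup>2" by (intro power_mono) auto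
    also have "\<dots> = (4 * C / b)\<^sup>2 * s\<^sup>2" by (rule power_mult_distrib)
    also have "\<dots> \<le> (4 * C / b)\<^sup>2 * (real K * (D powr \<alpha> * real K powr (4 * \<alpha>)))"
      unfolding s_def D_def c_def
      by (intro mult_left_mono Sobolev_norm_window[OF S assms(3) K B(1)]) simp
    finally have "real K * real K \<le> real K * (E * real K powr (4 * \<alpha>))"
      by (simp add: E_def power2_eq_square mult_ac)
    then have "real K \<le> E * real K powr (4 * \<alpha>)" using K0 by simp
    then have "real K * real K powr (- (4 * \<alpha>)) \<le> E * real K powr (4 * \<alpha>) * real K powr (- (4 * \<alpha>))"
      by (intro mult_right_mono) auto
    also have "\<dots> = E" using K0 by (simp add: mult.assoc powr_add[symmetric])
    also have "real K * real K powr (- (4 * \<alpha>)) = real K powr (1 - 4 * \<alpha>)"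
      using K0 powr_add[of "real K" 1 "- (4 * \<alpha>)"] by simp
    finally show ?thesis .
  qed
  define q where "q = 1 - 4 * \<alpha>"
  have q: "q > 0" using assms(4) by (simp add: q_def)
  \<comment> \<open>The exponent \<open>q\<close> is positive, so \<open>K^q\<close> exceeds
    \<open>E\<close> eventually; the maximum with 1 supplies the hypothesis of
    \<open>main\<close>.\<close>
  obtain K :: nat where K: "max 1 (E powr (1 / q)) < real K" using reals_Archimedean2 by blast
  have "E = (E powr (1 / q)) powr q" using E q by (simp add: powr_powr)
  also have "\<dots> < real K powr q" using K q by (intro powr_less_mono2) auto
  finally show False using main[of K] K by (simp add: q_def)
qed

end
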